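(* Let $k\geq l\geq 0$ be coprime integers and let $i\in\{k+l,k\}$. If the Aloff--Wallach space $N_{k,l}$ is generic, then there exists a continuous 1-parameter family of forward complete $\mathrm{Spin}(7)$ metrics $$\left\{\gamma^{(i)}_{(s_1,s_2)}\ \middle|\ (s_1,s_2)\in\mathbb{S}^1,\ s_1,s_2>0\right\}$$ on $M^{(i)}_{k,l}$. The $\mathrm{Spin}(7)$ metrics $\gamma^{(k+l)}_{(s_1,s_2)}$ on $M^{(k+l)}_{k,l}$ and the $\mathrm{Spin}(7)$ metrics $\gamma^{(k)}_{(s_1,s_2)}$ on $M^{(k)}_{k,l}$ have opposite chirality. All the metrics $\gamma^{(k+l)}_{(s_1,s_2)}$ and $\gamma^{(k)}_{(s_1,s_2)}$ have ALC asymptotics with space at infinity an $\mathbb{S}^1$ bundle over the $G_2$ cone over the nearly-K\"ahler $SU(3)/T^2$.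
   Context: Aloff--Wallach spaces. $N_{k,l}=SU(3)/U(1)_{k,l}$ with $U(1)_{k,l}=\{\mathrm{diag}(e^{\sqrt{-1}kt},e^{\sqrt{-1}lt},e^{-\sqrt{-1}(k+l)t})\}$; it is generic if $kl(k-l)\neq 0$. Put $\Delta=k^2+kl+l^2$. With $E_{pq}$ the matrix units, let $e_1=E_{12}-E_{21}$, $e_2=\sqrt{-1}(E_{12}+E_{21})$, $e_3=E_{13}-E_{31}$, $e_4=\sqrt{-1}(E_{13}+E_{31})$, $e_5=E_{23}-E_{32}$, $e_6=\sqrt{-1}(E_{23}+E_{32})$, $e_7=\sqrt{-1}\,\mathrm{diag}(2l+k,-(2k+l),k-l)$, $e_8=\sqrt{-1}\,\mathrm{diag}(k,l,-(k+l))$, so $e_8$ spans $\mathfrak{u}(1)_{k,l}$. The spaces $M^{(i)}_{k,l}$. For $i\in\{k+l,k,l\}$, $i\ne0$, $M^{(i)}_{k,l}$ is the $SU(3)$-cohomogeneity one $\mathbb{R}^4/\mathbb{Z}_{|i|}$ bundle over $\mathbb{CP}^2$ with principal orbit $N_{k,l}$ and singular orbit $\mathbb{CP}^2=SU(3)/K^{(i)}$, where $K^{(i)}$ is the connected subgroup with Lie algebra $\mathrm{span}\{e_7,e_8\}\oplus\mathfrak p^{(i)}$, $\mathfrak p^{(k+l)}=\mathrm{span}\{e_1,e_2\}$, $\mathfrak p^{(l)}=\mathrm{span}\{e_3,e_4\}$, $\mathfrak p^{(k)}=\mathrm{span}\{e_5,e_6\}$. Metrics. We consider $g=dt^2+g_{N_{k,l}}(t)$,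 where $g_{N_{k,l}}(t)$ is the $SU(3)$-invariant metric on $N_{k,l}$ for which $e_1,\dots,e_7$ are orthogonal with squared lengths $a^2,a^2,b^2,b^2,c^2,c^2,f^2$, with $a,b,c,f>0$ functions of $t>0$. Such $g$ is called a $\mathrm{Spin}(7)$ metric if, for one of the two signs $\epsilon=\pm1$ (the chirality), $$\frac{\dot a}{a}=\frac{b}{ac}+\frac{c}{ab}-\frac{a}{bc}-\epsilon\frac{k+l}{2\Delta}\frac{f}{a^2},\quad \frac{\dot b}{b}=\frac{c}{ab}+\frac{a}{bc}-\frac{b}{ac}+\epsilon\frac{l}{2\Delta}\frac{f}{b^2},\quad \frac{\dot c}{c}=\frac{a}{bc}+\frac{b}{ac}-\frac{c}{ab}+\epsilon\frac{k}{2\Delta}\frac{f}{c^2},$$ $$\frac{\dot f}{f}=\epsilon\left(\frac{k+l}{2\Delta}\frac{f}{a^2}-\frac{l}{2\Delta}\frac{f}{b^2}-\frac{k}{2\Delta}\frac{f}{c^2}\right).$$ On $M^{(k+l)}_{k,l}$ one requires $\lim_{t\to0}(a,b,c,f,\dot a,\dot b,\dot c,\dot f)=(0,a_0,a_0,0,1,0,0,\tfrac{2\Delta}{k+l})$ for some $a_0>0$, and on $M^{(k)}_{k,l}$ one requires this limit to be $(c_0,c_0,0,0,0,0,1,\tfrac{2\Delta}{k})$ for some $c_0>0$. The metric is forward complete if it is defined for all $t\in(0,\infty)$. The parametrization. Let $\mathrm{tr}L=2\frac{\dot a}{a}+2\frac{\dot b}{b}+2\frac{\dot c}{c}+\frac{\dot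 f}{f}$, $d\eta=\mathrm{tr}L\,dt$, and $X_1=\frac{\dot a/a}{\mathrm{tr}L}$, $X_2=\frac{\dot b/b}{\mathrm{tr}L}$, $X_3=\frac{\dot c/c}{\mathrm{tr}L}$, $X_4=\frac{\dot f/f}{\mathrm{tr}L}$, $Z_1=\frac{a/(bc)}{\mathrm{tr}L}$, $Z_2=\frac{b/(ac)}{\mathrm{tr}L}$, $Z_3=\frac{c/(ab)}{\mathrm{tr}L}$, $Z_4=f\,\mathrm{tr}L$. Then $\gamma^{(i)}_{(s_1,s_2)}$ denotes the $\mathrm{Spin}(7)$ metric (up to homothety) for which, for some $\delta>0$ and a suitable choice of the additive constant in $\eta$, $$(X_1,\dots,X_4,Z_1,\dots,Z_4)(\eta)=P_0^{(i)}+e^{2\eta/3}(s_1v_1+s_2v_2)+O\big(e^{(2/3+\delta)\eta}\big)\quad(\eta\to-\infty),$$ where for $i=k+l$: $P_0^{(k+l)}=(\frac13,0,0,\frac13,0,\frac13,\frac13,\frac{6\Delta}{k+l})$, $v_1=(2,0,0,-4,0,-1,-1,-\frac{36\Delta}{k+l})$, $v_2=(-3(k+l),4k+5l,5k+4l,-12(k+l),3(k+l),-5k-4l,-4k-5l,0)$; for $i=k$: $P_0^{(k)}=(0,0,\frac13,\frac13,\frac13,\frac13,0,\frac{6\Delta}{k})$, $v_1=(0,0,2,-4,-1,-1,0,-\frac{36\Delta}{k})$, $v_2=(5k+l,4k-l,-3k,-12k,-4k+l,-5k-l,3k,0)$. Asymptotics. The metric is asymptotically locally conical (ALC) with space at infinity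 an $\mathbb{S}^1$ bundle over the $G_2$ cone over the nearly-K\"ahler $SU(3)/T^2$ if, as $t\to\infty$, $a,b,c$ grow linearly with $dt^2$ plus the $(a,b,c)$-part of the metric asymptotic to the Riemannian cone (with holonomy $G_2$) over the homogeneous nearly-K\"ahler metric on $SU(3)/T^2$ (the one with $a=b=c$), while $f$ converges to a positive constant. *)

theory Defs
  imports "HOL-Analysis.Analysis" "HOL-Library.Landau_Symbols"
begin

text \<open>
  The SU(3)-invariant metrics \<open>g = dt\<^sup>2 + g\<^sub>N(t)\<close> considered on \<open>N\<^sub>k\<^sub>,\<^sub>l \<times> (0, T)\<close> make
  \<open>e\<^sub>1, \<dots>, e\<^sub>7\<close> orthogonal with squared lengths \<open>a\<^sup>2, a\<^sup>2, b\<^sup>2, b\<^sup>2, c\<^sup>2, c\<^sup>2, f\<^sup>2\<close>, so such a metric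
  is the same thing as the curve \<open>t \<mapsto> (a, b, c, f)\<close> of positive functions.  Only the values at
  \<open>0 < t < T\<close> are meaningful.
\<close>

type_synonym coh1_metric = "real \<Rightarrow> real \<times> real \<times> real \<times> real"

definition generic :: "int \<Rightarrow> int \<Rightarrow> bool" where
  "generic k l \<longleftrightarrow> k * l * (k - l) \<noteq> 0"

definition Delta :: "int \<Rightarrow> int \<Rightarrow> real" where
  "Delta k l = of_int (k\<^sup>2 + k * l + l\<^sup>2)"

text \<open>Right-hand side of the Spin(7) equations of chirality \<open>\<epsilon>\<close>, solved for the derivatives of
  \<open>(a, b, c, f)\<close>.\<close>

fun spin7_field :: "int \<Rightarrow> int \<Rightarrow> real \<Rightarrow> real \<times> real \<times> real \<times> real
    \<Rightarrow> real \<times> real \<times> real \<times> real" where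
  "spin7_field k l \<epsilon> (a, b, c, f) =
    (a * (b / (a * c) + c / (a * b) - a / (b * c) - \<epsilon> * (of_int (k + l) / (2 * Delta k l)) * (f / a\<^sup>2)),
     b * (c / (a * b) + a / (b * c) - b / (a * c) + \<epsilon> * (of_int l / (2 * Delta k l)) * (f / b\<^sup>2)),
     c * (a / (b * c) + b / (a * c) - c / (a * b) + \<epsilon> * (of_int k / (2 * Delta k l)) * (f / c\<^sup>2)),
     f * (\<epsilon> * (of_int (k + l) / (2 * Delta k l) * (f / a\<^sup>2)
               - of_int l / (2 * Delta k l) * (f / b\<^sup>2)
               - of_int k / (2 * Delta k l) * (f / c\<^sup>2))))"

fun all_pos :: "real \<times> real \<times> real \<times> real \<Rightarrow> bool" where
  "all_pos (a, b, c, f) \<longleftrightarrow> 0 < a \<and> 0 < b \<and> 0 < c \<and> 0 < f"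

definition spin7_metric :: "int \<Rightarrow> int \<Rightarrow> real \<Rightarrow> ereal \<Rightarrow> coh1_metric \<Rightarrow> bool" where
  "spin7_metric k l \<epsilon> T g \<longleftrightarrow> 0 < T \<and>
     (\<forall>t. 0 < t \<longrightarrow> ereal t < T \<longrightarrow>
        all_pos (g t) \<and> (g has_vector_derivative spin7_field k l \<epsilon> (g t)) (at t))"

definition jet :: "coh1_metric \<Rightarrow> real \<Rightarrow> (real \<times> real \<times> real \<times> real) \<times> (real \<times> real \<times> real \<times> real)" where
  "jet g t = (g t, vector_derivative g (at t))"

text \<open>
  Conditions at the singular orbit of \<open>M\<^sup>(\<^sup>i\<^sup>)\<close>, \<open>i \<in> {k + l, k}\<close>.  As in the notation \<open>M\<^sup>(\<^sup>i\<^sup>)\<close> itself,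
  the integer \<open>i\<close> serves as a label; the two labels differ as soon as \<open>l \<noteq> 0\<close>.
\<close>

definition closes_up :: "int \<Rightarrow> int \<Rightarrow> int \<Rightarrow> coh1_metric \<Rightarrow> bool" where
  "closes_up k l i g \<longleftrightarrow>
     (if i = k + l then
        \<exists>a0>0. (jet g \<longlongrightarrow> ((0, a0, a0, 0), (1, 0, 0, 2 * Delta k l / of_int (k + l)))) (at_right 0)
      else if i = k then
        \<exists>c0>0. (jet g \<longlongrightarrow> ((c0, c0, 0, 0), (0, 0, 1, 2 * Delta k l / of_int k))) (at_right 0)
      else False)"

definition spin7_metric_on_M :: "int \<Rightarrow> int \<Rightarrow> int \<Rightarrow> ereal \<Rightarrow> coh1_metric \<Rightarrow> bool" where
  "spin7_metric_on_M k l i T g \<longleftrightarrow>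
     (\<exists>\<epsilon>\<in>{-1, 1}. spin7_metric k l \<epsilon> T g) \<and> closes_up k l i g"

definition trL :: "coh1_metric \<Rightarrow> real \<Rightarrow> real" where
  "trL g t = (case jet g t of ((a, b, c, f), (a', b', c', f')) \<Rightarrow>
     2 * (a' / a) + 2 * (b' / b) + 2 * (c' / c) + f' / f)"

text \<open>The coordinates \<open>(X\<^sub>1, \<dots>, X\<^sub>4, Z\<^sub>1, \<dots>, Z\<^sub>4)\<close>.\<close>

type_synonym real8 = "real \<times> real \<times> real \<times> real \<times> real \<times> real \<times> real \<times> real"

definition XZ :: "coh1_metric \<Rightarrow> real \<Rightarrow> real8" where
  "XZ g t = (case jet g t of ((a, b, c, f), (a', b', c', f')) \<Rightarrow>
     ((a' / a) / trL g t, (b' / b) / trL g t, (c' / c) / trL g t, (f' / f) / trL g t,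
      (a / (b * c)) / trL g t, (b / (a * c)) / trL g t, (c / (a * b)) / trL g t, f * trL g t))"

definition P0 :: "int \<Rightarrow> int \<Rightarrow> int \<Rightarrow> real8" where
  "P0 k l i = (if i = k + l
     then (1/3, 0, 0, 1/3, 0, 1/3, 1/3, 6 * Delta k l / of_int (k + l))
     else (0, 0, 1/3, 1/3, 1/3, 1/3, 0, 6 * Delta k l / of_int k))"

definition v1 :: "int \<Rightarrow> int \<Rightarrow> int \<Rightarrow> real8" where
  "v1 k l i = (if i = k + l
     then (2, 0, 0, -4, 0, -1, -1, - (36 * Delta k l / of_int (k + l)))
     else (0, 0, 2, -4, -1, -1, 0, - (36 * Delta k l / of_int k)))"

definition v2 :: "int \<Rightarrow> int \<Rightarrow> int \<Rightarrow> real8" where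
  "v2 k l i = (if i = k + l
     then (of_int (- 3 * (k + l)), of_int (4 * k + 5 * l), of_int (5 * k + 4 * l), of_int (- 12 * (k + l)),
           of_int (3 * (k + l)), of_int (- 5 * k - 4 * l), of_int (- 4 * k - 5 * l), 0)
     else (of_int (5 * k + l), of_int (4 * k - l), of_int (- 3 * k), of_int (- 12 * k),
           of_int (- 4 * k + l), of_int (- 5 * k - l), of_int (3 * k), 0))"

text \<open>
  The expansion at \<open>\<eta> \<rightarrow> -\<infinity>\<close> defining the parameters \<open>(s\<^sub>1, s\<^sub>2)\<close>, written in the variable
  \<open>t \<rightarrow> 0\<close>.  The choice of the primitive \<open>\<eta>\<close> of \<open>tr L\<close> is the choice of the additive constant.
\<close>

definition has_parameters :: "int \<Rightarrow> int \<Rightarrow> int \<Rightarrow> real \<times> real \<Rightarrow> coh1_metric \<Rightarrow> bool" where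
  "has_parameters k l i s g \<longleftrightarrow>
     (\<exists>\<eta> \<delta>. 0 < \<delta> \<and>
        (\<forall>\<^sub>F t in at_right 0. (\<eta> has_real_derivative trL g t) (at t)) \<and>
        filterlim \<eta> at_bot (at_right 0) \<and>
        (\<lambda>t. norm (XZ g t - (P0 k l i
               + exp (2 * \<eta> t / 3) *\<^sub>R (fst s *\<^sub>R v1 k l i + snd s *\<^sub>R v2 k l i))))
          \<in> O[at_right 0](\<lambda>t. exp ((2 / 3 + \<delta>) * \<eta> t)))"

definition is_gamma :: "int \<Rightarrow> int \<Rightarrow> int \<Rightarrow> real \<times> real \<Rightarrow> ereal \<Rightarrow> coh1_metric \<Rightarrow> bool" where
  "is_gamma k l i s T g \<longleftrightarrow> spin7_metric_on_M k l i T g \<and> has_parameters k l i s g"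

text \<open>On \<open>(0, T)\<close>, \<open>g\<close> is the metric \<open>h\<close> rescaled by \<open>\<mu>\<^sup>2\<close>: lengths, including the
  arclength parameter \<open>t\<close>, are multiplied by \<open>\<mu>\<close>.\<close>

definition homothetic_on :: "ereal \<Rightarrow> coh1_metric \<Rightarrow> coh1_metric \<Rightarrow> bool" where
  "homothetic_on T g h \<longleftrightarrow>
     (\<exists>\<mu>>0. \<forall>t. 0 < t \<longrightarrow> ereal t < T \<longrightarrow> g t = \<mu> *\<^sub>R h (t / \<mu>))"

definition param_arc :: "(real \<times> real) set" where
  "param_arc = {s \<in> sphere 0 1. 0 < fst s \<and> 0 < snd s}"

text \<open>Continuous dependence on the parameter, up to and including the singular orbit \<open>t = 0\<close>.\<close>

definition continuous_family :: "(real \<times> real) set \<Rightarrow> (real \<times> real \<Rightarrow> coh1_metric) \<Rightarrow> bool" where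
  "continuous_family S G \<longleftrightarrow>
     (\<exists>J. continuous_on (S \<times> {0..}) J \<and> (\<forall>s\<in>S. \<forall>t>0. J (s, t) = jet (G s) t))"

text \<open>
  The torsion-free equations of the SU(3)-invariant \<open>G\<^sub>2\<close> metrics with squared lengths \<open>a\<^sup>2, b\<^sup>2, c\<^sup>2\<close> over
  \<open>SU(3)/T\<^sup>2\<close>, which are the Spin(7) equations without the circle direction \<open>f\<close>.  They determine
  which multiple \<open>a = b = c = r\<close> of the nearly-Kaehler metric has a cone with holonomy \<open>G\<^sub>2\<close>.
\<close>

fun G2_field :: "real \<times> real \<times> real \<Rightarrow> real \<times> real \<times> real" where
  "G2_field (a, b, c) =
    (a * (b / (a * c) + c / (a * b) - a / (b * c)),
     b * (c / (a * b) + a / (b * c) - b / (a * c)),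
     c * (a / (b * c) + b / (a * c) - c / (a * b)))"

definition nearly_Kaehler_G2_cone :: "real \<Rightarrow> bool" where
  "nearly_Kaehler_G2_cone r \<longleftrightarrow> 0 < r \<and>
     (\<forall>t>0. ((\<lambda>t. (r * t, r * t, r * t)) has_vector_derivative G2_field (r * t, r * t, r * t)) (at t))"

text \<open>Since both metrics are diagonal in \<open>e\<^sub>1, \<dots>, e\<^sub>6\<close>, being asymptotic to the cone (the difference
  tends to 0 in the norm of the cone metric) means that the ratios of lengths tend to 1.\<close>

definition ALC_over_nearly_Kaehler_cone :: "coh1_metric \<Rightarrow> bool" where
  "ALC_over_nearly_Kaehler_cone g \<longleftrightarrow>
     (\<exists>r. nearly_Kaehler_G2_cone r \<and>
        ((\<lambda>t. case g t of (a, b, c, f) \<Rightarrow> (a / (r * t), b / (r * t), c / (r * t)))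
            \<longlongrightarrow> (1, 1, 1)) at_top) \<and>
     (\<exists>f0>0. ((\<lambda>t. case g t of (a, b, c, f) \<Rightarrow> f) \<longlongrightarrow> f0) at_top)"

end

(*
With a suitable naming of the directions, both families solve one system for four functions
x, y, z, F: x is the collapsing direction, F a multiple of f, and a parameter -1/2 < q < 1 depends
on k, l and i.  In the time zeta with d zeta = y / (x z) dt, the scale-invariant quantities
s = x^2 / y^2, th = F z / (x y) and L = z^2 / y^2 solve the polynomial system

  L'  = -4 L (L - 1) + 2 th s (1 + q + q L),
  s'  = 2 s (2 (1 - s) - th (1 - q s)),
  th' = th (2 th (1 + q s) + s + 1 - 3 L).

Its solutions that emanate from (L, s, th) = (1, 0, 1) form, up to a shift of zeta, a one-parameter
family, because the linearisation there has eigenvalues -4, 2, 2.  Put T = exp (2 zeta) and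
c = (1 + 2 q) / 3.  After division by T the system becomes regular except for one dissipative term
-3 d / T, so Picard iteration gives existence and continuous dependence, and a one-sided
Lipschitz estimate gives uniqueness.  The crucial invariant is

  L - 1 >= c th s,

for it yields th' <= -th (1 - th) (2 - s).  The condition s_1, s_2 > 0 gives th < 1 initially; hence
th < 1 and s < 1 forever, th decreases to 0 exponentially, s and L tend to 1, and F converges since
(ln F)' is bounded by 4 th.
*)
theory Submission
  imports Defs
begin

section \<open>Singular initial value problems\<close>

text \<open>The value of c comes from the linearisation at (1, 0, 1). If s ~ S T and L - 1 ~ P T,
  the equation of L reads 2 P = - 4 P + 2 (1 + 2 q) S to first order, so P = c S with 3 c = 1 + 2 q.
  Hence d = P - c S is the coordinate of the stable direction. Its eigenvalue - 4, lowered by 2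
  through the division by T and rewritten with dT = 2 T d zeta, becomes the rate 3. In the order (L,
  s, th) the stable eigenvector is (1, 0, 1/2), and this is why V = Q + d / 2, and not Q = (1 - th)
  / T, is free of the singular term.

  Two obstacles shape the rest. The field is only locally Lipschitz and the a priori bounds hold for
  true solutions only, so existence passes through a clipped field. And an arbitrary metric with the
  same parameters is known only through limits of its values and velocities: that L - 1 ~ c s holds
  for it, and that its chirality is the expected one, has to be extracted from these limits before
  it can be compared with a profile.\<close>

text \<open>The substitution t = r T moves the dependence on T into the integrand over a fixed
  interval. It remains valid for T = 0.\<close>

lemma integral_scaled_interval:
  fixes h :: "real \<Rightarrow> 'b::banach"
  assumes "continuous_on {0..T} h" "0 \<le> T"
  shows "integral {0..T} h = T *\<^sub>R integral {0..1} (\<lambda>r. h (r * T))"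
proof -
  define H where "H = (\<lambda>u. integral {0..u} h)"
  have dH: "(H has_vector_derivative h u) (at u within {0..T})" if "u \<in> {0..T}" for u
    unfolding H_def by (rule integral_has_vector_derivative[OF assms(1) that])
  have "((\<lambda>r. H (r * T)) has_vector_derivative T *\<^sub>R h (r * T)) (at r within {0..1})"
    if r: "r \<in> {0..1}" for r
  proof -
    have sub: "(\<lambda>r. r * T) ` {0..1} \<subseteq> {0..T}"
      using assms(2) by (auto intro: mult_left_le_one_le)
    have "((\<lambda>r. r * T) has_vector_derivative T) (at r within {0..1})"
      by (auto intro!: derivative_eq_intros simp: has_real_derivative_iff_has_vector_derivative[symmetric])
    moreover have "(H has_vector_derivative h (r * T)) (at (r * T) within (\<lambda>r. r * T) ` {0..1})"
      using dH[of "r * T"] r sub has_vector_derivative_within_subset by blast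
    ultimately show ?thesis
      using vector_diff_chain_within[of "\<lambda>r. r * T" T r "{0..1}" H] by (simp add: o_def)
  qed
  then have "((\<lambda>r. T *\<^sub>R h (r * T)) has_integral (H (1 * T) - H (0 * T))) {0..1}"
    by (intro fundamental_theorem_of_calculus) auto
  moreover have "integral {0..1} (\<lambda>r. T *\<^sub>R h (r * T)) = T *\<^sub>R integral {0..1} (\<lambda>r. h (r * T))"
    by simp
  ultimately have "T *\<^sub>R integral {0..1} (\<lambda>r. h (r * T)) = H (1 * T) - H (0 * T)"
    by (metis integral_unique)
  then show ?thesis
    by (simp add: H_def)
qed

text \<open>Over the fixed interval [0, 1] obtained by rescaling, the upper limit is just one more
  parameter, so continuity under the integral sign applies.\<close>

lemma continuous_on_indefinite_integral_param:
  fixes h :: "'a::topological_space \<Rightarrow> real \<Rightarrow> 'b::banach"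
  assumes "continuous_on (U \<times> {0..}) (\<lambda>(a, T). h a T)"
  shows "continuous_on (U \<times> {0..}) (\<lambda>(a, T). integral {0..T} (h a))"
proof -
  have "continuous_on ((U \<times> {0..}) \<times> cbox 0 1) (\<lambda>q. (fst (fst q), snd q * snd (fst q) :: real))"
    by (intro continuous_intros)
  moreover have "(\<lambda>q. (fst (fst q), snd q * snd (fst q))) ` ((U \<times> {0..}) \<times> cbox 0 1) \<subseteq> U \<times> {0::real..}"
    by auto
  ultimately have "continuous_on ((U \<times> {0..}) \<times> cbox 0 1) (\<lambda>(p, r). h (fst p) (r * snd p))"
    using continuous_on_compose2[OF assms] by (fastforce simp: case_prod_beta)
  then have "continuous_on (U \<times> {0..}) (\<lambda>p. snd p *\<^sub>R integral (cbox 0 1) (\<lambda>r. h (fst p) (r * snd p)))"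
    by (intro continuous_intros integral_continuous_on_param) (simp add: case_prod_beta)
  then show ?thesis
  proof (rule continuous_on_eq)
    fix p assume p: "p \<in> U \<times> {0::real..}"
    have "continuous_on {0..snd p} (\<lambda>T. (fst p, T))" by (intro continuous_intros)
    moreover have "(\<lambda>T. (fst p, T)) ` {0..snd p} \<subseteq> U \<times> {0..}" using p by auto
    ultimately have "continuous_on {0..snd p} (h (fst p))"
      using continuous_on_compose2[OF assms] by fastforce
    then show "snd p *\<^sub>R integral (cbox 0 1) (\<lambda>r. h (fst p) (r * snd p)) = (\<lambda>(a, T). integral {0..T} (h a)) p"
      using p integral_scaled_interval[of "snd p" "h (fst p)"] by (auto simp: case_prod_beta)
  qed
qed

text \<open>The weights \<open>W r\<close> absorb a singular linear part: \<open>W r x = r\<^sup>n x\<close> corresponds to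
  \<open>u' = f(T, u) - n u / T\<close>.\<close>

theorem weighted_picard:
  fixes f :: "real \<Rightarrow> 'e::euclidean_space \<Rightarrow> 'e"
    and W :: "real \<Rightarrow> 'e \<Rightarrow> 'e" and u0 :: "'a::metric_space \<Rightarrow> 'e" and \<Lambda> L :: "real \<Rightarrow> real"
  assumes cf: "continuous_on ({0..} \<times> UNIV) (\<lambda>(T, x). f T x)"
    and cW: "continuous_on ({0..1} \<times> UNIV) (\<lambda>(r, x). W r x)"
    and Wlip: "\<And>r x y. r \<in> {0..1} \<Longrightarrow> norm (W r x - W r y) \<le> norm (x - y)"
    and Wbd: "\<And>r x. r \<in> {0..1} \<Longrightarrow> norm (W r x) \<le> norm x"
    and flip: "\<And>T x y. 0 \<le> T \<Longrightarrow> norm (f T x - f T y) \<le> L T * norm (x - y)"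
    and fbd: "\<And>T x. 0 \<le> T \<Longrightarrow> norm (f T x) \<le> L T"
    and dL: "\<And>T. 0 \<le> T \<Longrightarrow> (\<Lambda> has_real_derivative L T) (at T)"
    and L0: "\<And>T. 0 \<le> T \<Longrightarrow> 0 \<le> \<Lambda> T" and cL: "continuous_on {0..} L"
    and cu0: "continuous_on UNIV u0" and bu0: "\<And>a. norm (u0 a) \<le> K"
  shows "\<exists>u. continuous_on (UNIV \<times> {0..}) (\<lambda>(a, T). u a T) \<and>
    (\<forall>a. \<forall>T\<ge>0. u a T = u0 a + T *\<^sub>R integral {0..1} (\<lambda>r. W r (f (r * T) (u a (r * T)))))"
proof -
  \<comment> \<open>The fixed point is sought for w = \<open>om\<close> u. Since \<Lambda>' = L, the
    weight exp (- 2 \<Lambda>) makes the Picard map a contraction with factor 1/2 on the whole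
    half-line, without restricting the time interval.\<close>
  define om where "om T = exp (- 2 * \<Lambda> T)" for T
  \<comment> \<open>Negative times are clamped to 0, so that the Banach space of bounded continuous
    functions on the full product type can be used.\<close>
  define h where "h T = max T (0::real)" for T
  define G where "G w a T = integral {0..1} (\<lambda>r. W r (f (r * h T) ((1 / om (r * h T)) *\<^sub>R w (a, r * h T))))"
    for w :: "'a \<times> real \<Rightarrow> 'e" and a T
  \<comment> \<open>The parameter a belongs to the domain of w. Continuity of the single fixed point
    is therefore joint continuity in (a, T).\<close>
  define \<Phi> where "\<Phi> w p = om (h (snd p)) *\<^sub>R (u0 (fst p) + h (snd p) *\<^sub>R G w (fst p) (snd p))"
    for w :: "'a \<times> real \<Rightarrow> 'e" and p
  have h0: "0 \<le> h T" for T by (simp add: h_def)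
  have hc: "continuous_on UNIV h" unfolding h_def by (intro continuous_intros)
  have Lnn: "0 \<le> L T" if "0 \<le> T" for T
    using fbd[OF that, of 0] norm_ge_zero order_trans by blast
  have c\<Lambda>: "continuous_on {0..} \<Lambda>"
    by (rule DERIV_continuous_on[of _ _ L]) (auto intro: has_field_derivative_at_within dL)
  have omc: "continuous_on {0..} om"
    unfolding om_def by (intro continuous_intros c\<Lambda>)
  have ompos: "0 < om T" for T by (simp add: om_def)
  have om1: "om T \<le> 1" if "0 \<le> T" for T using L0[OF that] by (simp add: om_def)
  \<comment> \<open>1 / \<open>om\<close> = exp (2 \<Lambda>) has derivative 2 L /
    \<open>om\<close>, so this integral is explicit; the factor 2 is the source of the contraction
    constant 1/2.\<close>
  have int_id: "((\<lambda>r. T * (L (r * T) * (1 / om (r * T)))) has_integral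
      (exp (2 * \<Lambda> T) / 2 - exp (2 * \<Lambda> 0) / 2)) {0..1}" if T: "0 \<le> T" for T
  proof -
    have "((\<lambda>r. T * (L (r * T) * (1 / om (r * T)))) has_integral
       ((\<lambda>r. exp (2 * \<Lambda> (r * T)) / 2) 1 - (\<lambda>r. exp (2 * \<Lambda> (r * T)) / 2) 0)) {0..1}"
    proof (rule fundamental_theorem_of_calculus)
      fix r :: real assume r: "r \<in> {0..1}"
      then have "0 \<le> r * T" using T by simp
      then have "((\<lambda>r. exp (2 * \<Lambda> (r * T)) / 2) has_real_derivative T * (L (r * T) * (1 / om (r * T)))) (at r)"
        by (auto intro!: derivative_eq_intros DERIV_chain2[OF dL] simp: om_def exp_minus field_simps)
      then show "((\<lambda>r. exp (2 * \<Lambda> (r * T)) / 2) has_vector_derivative T * (L (r * T) * (1 / om (r * T)))) (at r within {0..1})"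
        by (auto simp: has_real_derivative_iff_has_vector_derivative[symmetric] intro: has_field_derivative_at_within)
    qed simp
    then show ?thesis by simp
  qed
  have key: "om T * (T * integral {0..1} (\<lambda>r. L (r * T) * (1 / om (r * T)))) \<le> 1 / 2" if T: "0 \<le> T" for T
  proof -
    have "T * integral {0..1} (\<lambda>r. L (r * T) * (1 / om (r * T))) = exp (2 * \<Lambda> T) / 2 - exp (2 * \<Lambda> 0) / 2"
      using integral_unique[OF int_id[OF T]] unfolding integral_mult_right .
    also have "\<dots> \<le> exp (2 * \<Lambda> T) / 2" by simp
    finally have "om T * (T * integral {0..1} (\<lambda>r. L (r * T) * (1 / om (r * T)))) \<le> om T * (exp (2 * \<Lambda> T) / 2)"
      using ompos[of T] by (simp add: mult_left_mono)
    also have "\<dots> = 1 / 2" by (simp add: om_def exp_minus)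
    finally show ?thesis .
  qed
  have Lom_int: "(\<lambda>r. L (r * T) * (1 / om (r * T))) integrable_on {0..1}" if T: "0 \<le> T" for T
    by (intro integrable_continuous_real continuous_intros continuous_on_compose2[OF cL] continuous_on_compose2[OF omc])
      (use T ompos in \<open>auto simp: less_imp_neq[OF ompos, symmetric]\<close>)
  have int_cont: "continuous_on ((UNIV \<times> {0..}) \<times> {0..1})
      (\<lambda>(p, r). W r (f (r * snd p) ((1 / om (r * snd p)) *\<^sub>R w (fst p, r * snd p))))"
    if w: "continuous_on UNIV w" for w :: "'a \<times> real \<Rightarrow> 'e"
  proof -
    have w': "continuous_on ((UNIV \<times> {0..}) \<times> {0..1}) (\<lambda>q::('a \<times> real) \<times> real. w (fst (fst q), snd q * snd (fst q)))"
      by (intro continuous_on_compose2[OF w] continuous_intros) auto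
    have o': "continuous_on ((UNIV \<times> {0..}) \<times> {0..1}) (\<lambda>q::('a \<times> real) \<times> real. om (snd q * snd (fst q)))"
      by (intro continuous_on_compose2[OF omc] continuous_intros) auto
    have 1: "continuous_on ((UNIV \<times> {0..}) \<times> {0..1}) (\<lambda>q::('a \<times> real) \<times> real. (1 / om (snd q * snd (fst q))) *\<^sub>R w (fst (fst q), snd q * snd (fst q)))"
      by (intro continuous_intros w' o') (use ompos in \<open>auto simp: less_imp_neq[OF ompos, symmetric]\<close>)
    have 2: "continuous_on ((UNIV \<times> {0..}) \<times> {0..1}) (\<lambda>q::('a \<times> real) \<times> real. (snd q * snd (fst q), (1 / om (snd q * snd (fst q))) *\<^sub>R w (fst (fst q), snd q * snd (fst q))))"
      by (intro continuous_on_Pair 1 continuous_intros)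
    have 3: "continuous_on ((UNIV \<times> {0..}) \<times> {0..1}) (\<lambda>q::('a \<times> real) \<times> real.
        f (snd q * snd (fst q)) ((1 / om (snd q * snd (fst q))) *\<^sub>R w (fst (fst q), snd q * snd (fst q))))"
      by (rule continuous_on_compose2[OF cf[unfolded case_prod_beta] 2, simplified]) auto
    have 4: "continuous_on ((UNIV \<times> {0..}) \<times> {0..1}) (\<lambda>q::('a \<times> real) \<times> real. (snd q,
        f (snd q * snd (fst q)) ((1 / om (snd q * snd (fst q))) *\<^sub>R w (fst (fst q), snd q * snd (fst q)))))"
      by (intro continuous_on_Pair 3 continuous_intros)
    show ?thesis
      unfolding case_prod_beta
      by (rule continuous_on_compose2[OF cW[unfolded case_prod_beta] 4, simplified]) auto
  qed
  have Gc: "continuous_on UNIV (\<lambda>p. G w (fst p) (snd p))" if w: "continuous_on UNIV w" for w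
  proof -
    have 0: "continuous_on (UNIV \<times> {0..}) (\<lambda>p. integral (cbox 0 1) (\<lambda>r. W r (f (r * snd p) ((1 / om (r * snd p)) *\<^sub>R w (fst p, r * snd p)))))"
      by (rule integral_continuous_on_param) (use int_cont[OF w] in simp)
    have "continuous_on UNIV (\<lambda>p. (fst p, h (snd p)))"
      by (intro continuous_intros continuous_on_compose2[OF hc]) auto
    from continuous_on_compose2[OF 0 this] show ?thesis
      unfolding G_def using h0 by auto
  qed
  have slice: "(\<lambda>r. W r (f (r * h T) ((1 / om (r * h T)) *\<^sub>R w (a, r * h T)))) integrable_on {0..1}"
    if w: "continuous_on UNIV w" for w :: "'a \<times> real \<Rightarrow> 'e" and a T
  proof -
    have "continuous_on {0..1} (\<lambda>r::real. ((a, h T), r))" by (intro continuous_intros)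
    from continuous_on_compose2[OF int_cont[OF w] this] show ?thesis
      using h0 by (intro integrable_continuous_real) auto
  qed
  have \<Phi>c: "continuous_on UNIV (\<Phi> w)" if w: "continuous_on UNIV w" for w
  proof -
    have 1: "continuous_on UNIV (\<lambda>p::'a \<times> real. h (snd p))"
      by (intro continuous_on_compose2[OF hc] continuous_intros) auto
    have 2: "continuous_on UNIV (\<lambda>p::'a \<times> real. om (h (snd p)))"
      by (intro continuous_on_compose2[OF omc] 1) (use h0 in auto)
    have 3: "continuous_on UNIV (\<lambda>p::'a \<times> real. u0 (fst p))"
      by (intro continuous_on_compose2[OF cu0] continuous_intros) auto
    show ?thesis
      unfolding \<Phi>_def by (intro continuous_intros 1 2 3 Gc[OF w])
  qed
  have \<Phi>b: "norm (\<Phi> w p) \<le> K + 1 / 2" if w: "continuous_on UNIV w" for w p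
  proof -
    let ?T = "h (snd p)"
    have "norm (G w (fst p) (snd p)) \<le> integral {0..1} (\<lambda>r. L (r * ?T) * (1 / om (r * ?T)))"
      unfolding G_def
    proof (rule integral_norm_bound_integral[OF slice[OF w] Lom_int[OF h0]])
      fix r :: real assume r: "r \<in> {0..1}"
      then have rT: "0 \<le> r * ?T" using h0 by simp
      have "norm (W r (f (r * ?T) ((1 / om (r * ?T)) *\<^sub>R w (fst p, r * ?T)))) \<le> L (r * ?T)"
        using Wbd[OF r] fbd[OF rT] order_trans by blast
      \<comment> \<open>Inserting the factor 1 / \<open>om\<close> \<ge> 1 brings the bound on the
        field into the form estimated by \<open>key\<close>.\<close>
      also have "\<dots> \<le> L (r * ?T) * (1 / om (r * ?T))"
        using mult_left_mono[of 1 "1 / om (r * ?T)" "L (r * ?T)"] Lnn[OF rT] om1[OF rT] ompos[of "r * ?T"] by simp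
      finally show "norm (W r (f (r * ?T) ((1 / om (r * ?T)) *\<^sub>R w (fst p, r * ?T)))) \<le> L (r * ?T) * (1 / om (r * ?T))" .
    qed
    then have "om ?T * (?T * norm (G w (fst p) (snd p))) \<le> om ?T * (?T * integral {0..1} (\<lambda>r. L (r * ?T) * (1 / om (r * ?T))))"
      using ompos[of ?T] h0[of "snd p"] by (intro mult_left_mono) auto
    also have "\<dots> \<le> 1 / 2" by (rule key[OF h0])
    finally have 1: "om ?T * (?T * norm (G w (fst p) (snd p))) \<le> 1 / 2" .
    have "norm (\<Phi> w p) \<le> om ?T * norm (u0 (fst p)) + om ?T * (?T * norm (G w (fst p) (snd p)))"
      unfolding \<Phi>_def using ompos[of ?T] h0[of "snd p"]
      by (simp add: distrib_left[symmetric]) (metis norm_triangle_ineq norm_scaleR abs_of_nonneg)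
    also have "om ?T * norm (u0 (fst p)) \<le> 1 * K"
      using om1[OF h0] bu0[of "fst p"] ompos[of ?T] by (intro mult_mono) auto
    finally show ?thesis using 1 by simp
  qed
  have \<Phi>mem: "\<Phi> (apply_bcontfun w) \<in> bcontfun" for w
    by (rule bcontfun_normI[OF \<Phi>c \<Phi>b]) auto
  define \<Psi> where "\<Psi> w = Bcontfun (\<Phi> (apply_bcontfun w))" for w
  have \<Psi>app: "apply_bcontfun (\<Psi> w) = \<Phi> (apply_bcontfun w)" for w
    unfolding \<Psi>_def by (rule Bcontfun_inverse[OF \<Phi>mem])
  have contr: "dist (\<Psi> v) (\<Psi> w) \<le> 1 / 2 * dist v w" for v w
  proof (rule dist_bound)
    fix p :: "'a \<times> real"
    let ?T = "h (snd p)"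
    have "norm (G v (fst p) (snd p) - G w (fst p) (snd p)) \<le> integral {0..1} (\<lambda>r. L (r * ?T) * (1 / om (r * ?T)) * dist v w)"
      unfolding G_def
    proof (subst integral_diff[symmetric, OF slice slice], simp, simp, rule integral_norm_bound_integral)
      show "(\<lambda>r. L (r * ?T) * (1 / om (r * ?T)) * dist v w) integrable_on {0..1}"
        using Lom_int[OF h0, of "snd p"] by (rule integrable_on_mult_left)
      fix r :: real assume r: "r \<in> {0..1}"
      then have rT: "0 \<le> r * ?T" using h0 by simp
      let ?V = "\<lambda>v. (1 / om (r * ?T)) *\<^sub>R apply_bcontfun v (fst p, r * ?T)"
      have "norm (W r (f (r * ?T) (?V v)) - W r (f (r * ?T) (?V w))) \<le> L (r * ?T) * norm (?V v - ?V w)"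
        using Wlip[OF r] flip[OF rT] order_trans by blast
      also have "norm (?V v - ?V w) = 1 / om (r * ?T) * dist (apply_bcontfun v (fst p, r * ?T)) (apply_bcontfun w (fst p, r * ?T))"
        using ompos[of "r * ?T"] by (simp add: dist_norm scaleR_diff_right[symmetric])
      also have "L (r * ?T) * \<dots> \<le> L (r * ?T) * (1 / om (r * ?T) * dist v w)"
        using Lnn[OF rT] ompos[of "r * ?T"] by (intro mult_left_mono dist_bounded) auto
      finally show "norm (W r (f (r * ?T) (?V v)) - W r (f (r * ?T) (?V w))) \<le> L (r * ?T) * (1 / om (r * ?T)) * dist v w"
        by (simp add: mult.assoc)
    qed (rule integrable_diff[OF slice slice]; simp)
    also have "\<dots> = integral {0..1} (\<lambda>r. L (r * ?T) * (1 / om (r * ?T))) * dist v w"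
      by (rule integral_mult_left)
    finally have 1: "norm (G v (fst p) (snd p) - G w (fst p) (snd p)) \<le> integral {0..1} (\<lambda>r. L (r * ?T) * (1 / om (r * ?T))) * dist v w" .
    have "dist (\<Phi> v p) (\<Phi> w p) = om ?T * (?T * norm (G v (fst p) (snd p) - G w (fst p) (snd p)))"
      unfolding \<Phi>_def dist_norm using ompos[of ?T] h0[of "snd p"]
      by (simp add: scaleR_diff_right[symmetric])
    also have "\<dots> \<le> om ?T * (?T * (integral {0..1} (\<lambda>r. L (r * ?T) * (1 / om (r * ?T))) * dist v w))"
      using 1 ompos[of ?T] h0[of "snd p"] by (intro mult_left_mono) auto
    also have "\<dots> = (om ?T * (?T * integral {0..1} (\<lambda>r. L (r * ?T) * (1 / om (r * ?T))))) * dist v w"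
      by simp
    also have "\<dots> \<le> 1 / 2 * dist v w"
      by (rule mult_right_mono[OF key[OF h0]]) simp
    finally show "dist (apply_bcontfun (\<Psi> v) p) (apply_bcontfun (\<Psi> w) p) \<le> 1 / 2 * dist v w"
      unfolding \<Psi>app .
  qed
  have "\<exists>!w. \<Psi> w = w"
    by (rule banach_fix_type[where c = "1/2"]) (use contr in auto)
  then obtain w where w: "\<Psi> w = w" by auto
  have wp: "apply_bcontfun w p = \<Phi> (apply_bcontfun w) p" for p
    using \<Psi>app[of w] w by simp
  define u where "u a T = (1 / om T) *\<^sub>R apply_bcontfun w (a, T)" for a T
  have "continuous_on (UNIV \<times> {0..}) (\<lambda>p. om (snd p))"
    by (intro continuous_on_compose2[OF omc] continuous_intros) auto
  then have "continuous_on (UNIV \<times> {0..}) (\<lambda>(a, T). u a T)"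
    unfolding u_def case_prod_beta prod.collapse
    by (intro continuous_intros) (use ompos in \<open>auto simp: less_imp_neq[OF ompos, symmetric]\<close>)
  moreover have "u a T = u0 a + T *\<^sub>R integral {0..1} (\<lambda>r. W r (f (r * T) (u a (r * T))))" if "0 \<le> T" for a T
  proof -
    have [simp]: "h T = T" using that by (simp add: h_def)
    show ?thesis
      unfolding u_def[of a T] wp[of "(a, T)"] \<Phi>_def G_def using ompos[of T] by (simp add: u_def)
  qed
  ultimately show ?thesis by blast
qed

section \<open>The invariant region\<close>

text \<open>The integrating factor exp (- \<integral> b) makes g nondecreasing. In particular g'
  \<ge> b g preserves positivity, which is how every inequality of the invariant region is obtained;
  only interior derivatives are required, so T = 0 may be singular.\<close>

lemma linear_differential_inequality:
  fixes g b :: "real \<Rightarrow> real"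
  assumes cg: "continuous_on {0..\<tau>} g" and cb: "continuous_on {0..\<tau>} b"
    and der: "\<And>T. 0 < T \<Longrightarrow> T < \<tau> \<Longrightarrow> \<exists>g'. (g has_real_derivative g') (at T) \<and> b T * g T \<le> g'"
    and T: "T \<in> {0..\<tau>}"
  shows "g 0 * exp (integral {0..T} b) \<le> g T"
proof -
  define I where "I = (\<lambda>T. integral {0..T} b)"
  have dI: "(I has_real_derivative b t) (at t within {0..\<tau>})" if "t \<in> {0..\<tau>}" for t
    unfolding I_def by (rule integral_has_real_derivative[OF cb that])
  have dI': "(I has_real_derivative b t) (at t)" if "0 < t" "t < \<tau>" for t
    using dI[of t] that by (simp add: at_within_Icc_at)
  have cI: "continuous_on {0..\<tau>} I"
    by (rule DERIV_continuous_on[OF dI])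
  have "g 0 * exp (- I 0) \<le> g T * exp (- I T)"
  proof (rule DERIV_nonneg_imp_increasing_open[of 0 T "\<lambda>T. g T * exp (- I T)"])
    show "0 \<le> T" using T by simp
    show "continuous_on {0..T} (\<lambda>T. g T * exp (- I T))"
      by (intro continuous_intros continuous_on_subset[OF cg] continuous_on_subset[OF cI]) (use T in auto)
    fix t assume t: "0 < t" "t < T"
    then obtain g' where g': "(g has_real_derivative g') (at t)" "b t * g t \<le> g'"
      using der[of t] T by auto
    have "((\<lambda>T. g T * exp (- I T)) has_real_derivative (g' - b t * g t) * exp (- I t)) (at t)"
      by (rule derivative_eq_intros g' dI' refl | use t T in \<open>force simp: algebra_simps\<close>)+
    then show "\<exists>y. ((\<lambda>T. g T * exp (- I T)) has_real_derivative y) (at t) \<and> 0 \<le> y"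
      using g'(2) by (intro exI[of _ "(g' - b t * g t) * exp (- I t)"]) auto
  qed
  then have "g 0 * exp (I T) \<le> g T"
    by (simp add: I_def exp_minus field_simps)
  then show ?thesis by (simp add: I_def)
qed

lemma ex_derivative_ge:
  "(g has_real_derivative y) (at t) \<Longrightarrow> x \<le> y \<Longrightarrow> \<exists>g'. (g has_real_derivative g') (at t) \<and> x \<le> g'"
  by blast

text \<open>The closed set where g \<le> 0 has a least element; the intermediate value theorem
  excludes a negative value there.\<close>

lemma first_nonpositive_time:
  fixes g :: "real \<Rightarrow> real"
  assumes "continuous_on {0..\<tau>} g" "0 < g 0" "T \<in> {0..\<tau>}" "g T \<le> 0"
  obtains T1 where "0 < T1" "T1 \<le> \<tau>" "g T1 = 0" "\<And>t. 0 \<le> t \<Longrightarrow> t < T1 \<Longrightarrow> 0 < g t"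
proof -
  let ?Z = "{0..\<tau>} \<inter> g -` {..0}"
  have "closed ?Z"
    by (rule continuous_closed_preimage[OF assms(1)]) auto
  then have "compact ?Z"
    by (auto simp: compact_eq_bounded_closed intro: bounded_subset[of "{0..\<tau>}"])
  moreover have "?Z \<noteq> {}" using assms by auto
  ultimately obtain T1 where T1: "T1 \<in> ?Z" "\<And>t. t \<in> ?Z \<Longrightarrow> T1 \<le> t"
    using compact_attains_inf by metis
  have "T1 \<noteq> 0" using T1(1) assms(2) by auto
  have "g T1 = 0"
  proof (rule ccontr)
    assume "g T1 \<noteq> 0"
    then have "g T1 < 0" using T1(1) by auto
    moreover have "continuous_on {0..T1} g"
      using T1(1) by (intro continuous_on_subset[OF assms(1)]) auto
    ultimately obtain t where t: "0 \<le> t" "t \<le> T1" "g t = 0"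
      using IVT2'[of g T1 0 0] assms(2) T1(1) by auto
    then have "t = T1" using T1(2)[of t] T1(1) by auto
    then show False using t \<open>g T1 < 0\<close> by simp
  qed
  show thesis
  proof (rule that[of T1])
    fix t assume "0 \<le> t" "t < T1"
    then show "0 < g t" using T1(2)[of t] T1(1) by force
  qed (use T1 \<open>T1 \<noteq> 0\<close> \<open>g T1 = 0\<close> in auto)
qed

text \<open>In terms of \<open>T = e\<^sup>2\<^sup>\<zeta>\<close>, put \<open>S = s / T\<close>, \<open>Q = (1 - \<theta>) / T\<close>, \<open>P = (L - 1) / T\<close>, \<open>d = P - c S\<close> and
  \<open>V = Q + d / 2\<close>.  This makes the equations of \<open>S\<close> and \<open>V\<close> regular at \<open>T = 0\<close>, and leaves the single
  singular term \<open>-3 d / T\<close> in that of \<open>d\<close>.\<close>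

definition cq :: "real \<Rightarrow> real" where "cq q = (1 + 2 * q) / 3"

definition fS :: "real \<Rightarrow> real \<Rightarrow> real \<Rightarrow> real \<Rightarrow> real \<Rightarrow> real" where
  "fS q T S Q d = S * (Q - 2 * S + q * S * (1 - T * Q))"

definition fd :: "real \<Rightarrow> real \<Rightarrow> real \<Rightarrow> real \<Rightarrow> real \<Rightarrow> real" where
  "fd q T S Q d = - 2 * (d + cq q * S)\<^sup>2 + q * S * (1 - T * Q) * d - 4 * cq q * Q * S + 2 * cq q * S\<^sup>2"

definition fV :: "real \<Rightarrow> real \<Rightarrow> real \<Rightarrow> real \<Rightarrow> real \<Rightarrow> real" where
  "fV q T S Q d = - (3 / 2) * Q * d - Q\<^sup>2 + q * (1 - T * Q) * S * Q + fd q T S Q d / 2"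

text \<open>The interval is finite and derivatives are required only in its interior, so that the
  estimates also apply to a clipped solution up to the moment it would leave the box, when nothing
  is yet known about global existence.\<close>

locale profile_segment =
  fixes q \<tau> :: real and S V d :: "real \<Rightarrow> real"
  assumes q: "- 1 / 2 < q" "q < 1" and tau: "0 < \<tau>"
    and cS: "continuous_on {0..\<tau>} S" and cV: "continuous_on {0..\<tau>} V" and cd: "continuous_on {0..\<tau>} d"
    and init: "0 < S 0" "0 < V 0" "d 0 = 0"
    and dS: "\<And>T. 0 < T \<Longrightarrow> T < \<tau> \<Longrightarrow> (S has_real_derivative fS q T (S T) (V T - d T / 2) (d T)) (at T)"
    and dV: "\<And>T. 0 < T \<Longrightarrow> T < \<tau> \<Longrightarrow> (V has_real_derivative fV q T (S T) (V T - d T / 2) (d T)) (at T)"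
    and dd: "\<And>T. 0 < T \<Longrightarrow> T < \<tau> \<Longrightarrow> (d has_real_derivative fd q T (S T) (V T - d T / 2) (d T) - 3 * d T / T) (at T)"
begin

definition "Q T = V T - d T / 2"
definition "\<theta> T = 1 - T * Q T"
definition "P T = d T + cq q * S T"
text \<open>\<open>D \<ge> 0\<close> is the invariant \<open>L - 1 \<ge> c \<theta> s\<close>.\<close>

definition "D T = d T + cq q * S T * (T * Q T)"

lemma cQ: "continuous_on {0..\<tau>} Q" unfolding Q_def by (intro continuous_intros cV cd) auto
lemma cth: "continuous_on {0..\<tau>} \<theta>" unfolding \<theta>_def by (intro continuous_intros cQ)
lemma cP: "continuous_on {0..\<tau>} P" unfolding P_def by (intro continuous_intros cS cd)
lemma cD: "continuous_on {0..\<tau>} D" unfolding D_def by (intro continuous_intros cS cd cQ)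

text \<open>Passing back from V to Q restores the singular term, with a positive sign: positive d
  pushes Q up. A lower bound on d is therefore the key to Q > 0.\<close>

lemma dQ:
  assumes "0 < T" "T < \<tau>"
  shows "(Q has_real_derivative - (3 / 2) * Q T * d T - (Q T)\<^sup>2 + q * \<theta> T * S T * Q T + 3 * d T / (2 * T)) (at T)"
  unfolding Q_def[abs_def]
  by (rule DERIV_cong, (rule DERIV_diff DERIV_cdivide dV dd assms)+)
    (use assms in \<open>simp add: fV_def \<theta>_def Q_def field_simps\<close>)

lemma dth:
  assumes "0 < T" "T < \<tau>"
  shows "(\<theta> has_real_derivative \<theta> T * (- Q T - 3 / 2 * d T - T * q * S T * Q T)) (at T)"
  unfolding \<theta>_def[abs_def]
  by (rule derivative_eq_intros dQ assms refl)+
    (use assms in \<open>simp add: \<theta>_def field_simps power2_eq_square\<close>)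

text \<open>\<open>D\<close> equals \<open>P\<close> - c S \<theta>. With this choice everything
  collects into a multiple of \<open>D\<close> plus a source whose sign is settled by \<theta> \<le>
  1 and q < 1 alone (see \<open>bracket_nonneg\<close>).\<close>

lemma dD:
  assumes "0 < T" "T < \<tau>"
  shows "(D has_real_derivative - 3 * D T / T - (4 * P T - 2 * \<theta> T * q * S T + cq q * S T * \<theta> T) / 2 * D T
    + cq q * (S T)\<^sup>2 * \<theta> T * (3 - \<theta> T * (cq q + 2 * q)) / 2) (at T)"
  unfolding D_def[abs_def]
  by (rule derivative_eq_intros dQ dS dd assms refl)+
    (use assms in \<open>simp add: fS_def fd_def Q_def[symmetric] P_def \<theta>_def D_def field_simps power2_eq_square cq_def\<close>)

lemma S_pos: "T \<in> {0..\<tau>} \<Longrightarrow> 0 < S T"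
proof -
  assume T: "T \<in> {0..\<tau>}"
  have "S 0 * exp (integral {0..T} (\<lambda>T. Q T - 2 * S T + q * S T * \<theta> T)) \<le> S T"
  proof (rule linear_differential_inequality[OF cS _ _ T])
    show "continuous_on {0..\<tau>} (\<lambda>T. Q T - 2 * S T + q * S T * \<theta> T)"
      by (intro continuous_intros cS cQ cth)
    fix t assume "0 < t" "t < \<tau>"
    from dS[OF this] show "\<exists>g'. (S has_real_derivative g') (at t) \<and> (Q t - 2 * S t + q * S t * \<theta> t) * S t \<le> g'"
      by (rule ex_derivative_ge) (simp add: fS_def Q_def \<theta>_def algebra_simps)
  qed
  moreover have "0 < S 0 * exp (integral {0..T} (\<lambda>T. Q T - 2 * S T + q * S T * \<theta> T))"
    using init(1) by simp
  ultimately show ?thesis by linarith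
qed

lemma th_pos: "T \<in> {0..\<tau>} \<Longrightarrow> 0 < \<theta> T"
proof -
  assume T: "T \<in> {0..\<tau>}"
  have "\<theta> 0 * exp (integral {0..T} (\<lambda>T. - Q T - 3 / 2 * d T - T * q * S T * Q T)) \<le> \<theta> T"
  proof (rule linear_differential_inequality[OF cth _ _ T])
    show "continuous_on {0..\<tau>} (\<lambda>T. - Q T - 3 / 2 * d T - T * q * S T * Q T)"
      by (intro continuous_intros cS cQ cd)
    fix t assume "0 < t" "t < \<tau>"
    from dth[OF this] show "\<exists>g'. (\<theta> has_real_derivative g') (at t) \<and> (- Q t - 3 / 2 * d t - t * q * S t * Q t) * \<theta> t \<le> g'"
      by (rule ex_derivative_ge) (simp add: algebra_simps)
  qed
  moreover have "0 < \<theta> 0 * exp (integral {0..T} (\<lambda>T. - Q T - 3 / 2 * d T - T * q * S T * Q T))"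
    by (simp add: \<theta>_def)
  ultimately show ?thesis by linarith
qed

lemma bracket_nonneg: "0 \<le> x \<Longrightarrow> x \<le> 1 \<Longrightarrow> 0 \<le> 3 - x * (cq q + 2 * q)"
proof -
  assume x: "0 \<le> x" "x \<le> 1"
  have "cq q + 2 * q \<le> 3" using q by (simp add: cq_def field_simps)
  then have "x * (cq q + 2 * q) \<le> x * 3" using x by (intro mult_left_mono) auto
  then show ?thesis using x by linarith
qed

lemma cq_pos: "0 < cq q" and cq_le: "cq q \<le> 1"
  using q by (auto simp: cq_def)

text \<open>The signs of \<open>D\<close> and \<open>Q\<close> depend on each other: the source in
  \<open>dD\<close> needs \<theta> \<le> 1, that is \<open>Q\<close> \<ge> 0, while \<open>Q\<close>
  > 0 needs \<open>D\<close> \<ge> 0. The circle is broken by arguing only up to a time before which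
  \<open>Q\<close> is positive. The factor T^3 removes - 3 D / T and makes the initial value
  0.\<close>

lemma D_nonneg_aux:
  assumes T1: "0 < T1" "T1 \<le> \<tau>" and Qp: "\<And>t. 0 \<le> t \<Longrightarrow> t < T1 \<Longrightarrow> 0 < Q t" and T: "T \<in> {0..T1}"
  shows "0 \<le> D T"
proof (cases "T = 0")
  case True then show ?thesis using init by (simp add: D_def)
next
  case False
  let ?b = "\<lambda>T. - (4 * P T - 2 * \<theta> T * q * S T + cq q * S T * \<theta> T) / 2"
  have sub: "{0..T1} \<subseteq> {0..\<tau>}" using T1 by auto
  have "0 ^ 3 * D 0 * exp (integral {0..T} ?b) \<le> T ^ 3 * D T"
  proof (rule linear_differential_inequality[where g = "\<lambda>T. T ^ 3 * D T" and \<tau> = T1, OF _ _ _ T])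
    show "continuous_on {0..T1} (\<lambda>T. T ^ 3 * D T)"
      by (intro continuous_intros continuous_on_subset[OF cD sub])
    show "continuous_on {0..T1} ?b"
      by (rule continuous_on_subset[OF _ sub]) (intro continuous_intros cS cth cP, simp)
    fix t assume t: "0 < t" "t < T1"
    then have t': "0 < t" "t < \<tau>" using T1 by auto
    have der: "((\<lambda>T. T ^ 3 * D T) has_real_derivative ?b t * (t ^ 3 * D t) +
        t ^ 3 * (cq q * (S t)\<^sup>2 * \<theta> t * (3 - \<theta> t * (cq q + 2 * q)) / 2)) (at t)"
      by (rule derivative_eq_intros dD t' refl)+
        (use t in \<open>simp add: field_simps power2_eq_square power3_eq_cube\<close>)
    have "0 < \<theta> t" using th_pos t' by auto
    moreover have "\<theta> t \<le> 1" using Qp[of t] t by (simp add: \<theta>_def)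
    ultimately have "0 \<le> t ^ 3 * (cq q * (S t)\<^sup>2 * \<theta> t * (3 - \<theta> t * (cq q + 2 * q)) / 2)"
      using cq_pos t bracket_nonneg[of "\<theta> t"] by simp
    then show "\<exists>g'. ((\<lambda>T. T ^ 3 * D T) has_real_derivative g') (at t) \<and> ?b t * (t ^ 3 * D t) \<le> g'"
      by (intro ex_derivative_ge[OF der]) linarith
  qed
  then show ?thesis using False T by (simp add: zero_le_mult_iff zero_le_power_eq)
qed

text \<open>At a first zero of \<open>Q\<close> the auxiliary lemma still gives \<open>D\<close>
  \<ge> 0 up to that time, and then \<open>Q\<close> satisfies a linear inequality that forbids
  reaching zero.\<close>

lemma Q_pos: "T \<in> {0..\<tau>} \<Longrightarrow> 0 < Q T"
proof (rule ccontr)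
  assume T: "T \<in> {0..\<tau>}" and "\<not> 0 < Q T"
  then have "Q T \<le> 0" by simp
  have "0 < Q 0" using init by (simp add: Q_def)
  obtain T1 where T1: "0 < T1" "T1 \<le> \<tau>" "Q T1 = 0" "\<And>t. 0 \<le> t \<Longrightarrow> t < T1 \<Longrightarrow> 0 < Q t"
    by (rule first_nonpositive_time[OF cQ \<open>0 < Q 0\<close> T \<open>Q T \<le> 0\<close>]) blast
  have sub: "{0..T1} \<subseteq> {0..\<tau>}" using T1 by auto
  have "Q 0 * exp (integral {0..T1} (\<lambda>T. - Q T - S T * \<theta> T / 2)) \<le> Q T1"
  proof (rule linear_differential_inequality[where \<tau> = T1])
    show "continuous_on {0..T1} Q" by (rule continuous_on_subset[OF cQ sub])
    show "continuous_on {0..T1} (\<lambda>T. - Q T - S T * \<theta> T / 2)"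
      by (rule continuous_on_subset[OF _ sub]) (intro continuous_intros cS cQ cth, simp)
    fix t assume t: "0 < t" "t < T1"
    then have t': "0 < t" "t < \<tau>" using T1 by auto
    \<comment> \<open>Replacing d by \<open>D\<close> turns the singular term into a nonnegative
      one. Because 3 c = 1 + 2 q, the parameter q cancels and the rest is a multiple of
      \<open>Q\<close>.\<close>
    have "(- Q t - S t * \<theta> t / 2) * Q t + 3 * \<theta> t * D t / (2 * t) =
        - (3 / 2) * Q t * d t - (Q t)\<^sup>2 + q * \<theta> t * S t * Q t + 3 * d t / (2 * t)"
      using t by (simp add: \<theta>_def D_def cq_def field_simps power2_eq_square)
    moreover have "0 \<le> 3 * \<theta> t * D t / (2 * t)"
      using t D_nonneg_aux[OF T1(1,2,4), of t] th_pos[of t] t' by (auto intro!: divide_nonneg_nonneg mult_nonneg_nonneg)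
    ultimately show "\<exists>g'. (Q has_real_derivative g') (at t) \<and> (- Q t - S t * \<theta> t / 2) * Q t \<le> g'"
      by (intro ex_derivative_ge[OF dQ[OF t']]) linarith
  qed (use T1 in auto)
  moreover have "0 < Q 0 * exp (integral {0..T1} (\<lambda>T. - Q T - S T * \<theta> T / 2))"
    using \<open>0 < Q 0\<close> by simp
  ultimately show False using T1(3) by linarith
qed

lemma D_nonneg: "T \<in> {0..\<tau>} \<Longrightarrow> 0 \<le> D T"
  using D_nonneg_aux[of \<tau> T] tau Q_pos by auto

lemma th_le: "T \<in> {0..\<tau>} \<Longrightarrow> \<theta> T \<le> 1"
  using Q_pos[of T] by (simp add: \<theta>_def)

lemma P_ge: "T \<in> {0..\<tau>} \<Longrightarrow> cq q * S T * \<theta> T \<le> P T"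
  using D_nonneg[of T] by (simp add: D_def P_def \<theta>_def algebra_simps)

lemma P_pos: "T \<in> {0..\<tau>} \<Longrightarrow> 0 < P T"
  using P_ge[of T] mult_pos_pos[OF mult_pos_pos[OF cq_pos S_pos[of T]] th_pos[of T]] by linarith

text \<open>At s = 1 the flow points inward: the source S \<theta> (1 - q) is nonnegative because q
  < 1.\<close>

lemma s_less_1: "T \<in> {0..\<tau>} \<Longrightarrow> T * S T < 1"
proof -
  assume T: "T \<in> {0..\<tau>}"
  let ?g = "\<lambda>T. 1 - T * S T"
  let ?b = "\<lambda>T. - S T * (2 - q * \<theta> T)"
  have "?g 0 * exp (integral {0..T} ?b) \<le> ?g T"
  proof (rule linear_differential_inequality[where g = ?g, OF _ _ _ T])
    show "continuous_on {0..\<tau>} ?g" "continuous_on {0..\<tau>} ?b" by (intro continuous_intros cS cth)+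
    fix t assume t: "0 < t" "t < \<tau>"
    have der: "(?g has_real_derivative ?b t * ?g t + S t * \<theta> t * (1 - q)) (at t)"
      by (rule derivative_eq_intros dS t refl)+
        (simp add: fS_def Q_def[symmetric] \<theta>_def algebra_simps)
    have "0 \<le> S t * \<theta> t * (1 - q)"
      using S_pos[of t] th_pos[of t] q t by auto
    then show "\<exists>g'. (?g has_real_derivative g') (at t) \<and> ?b t * ?g t \<le> g'"
      by (intro ex_derivative_ge[OF der]) linarith
  qed
  moreover have "0 < ?g 0 * exp (integral {0..T} ?b)" by simp
  ultimately show ?thesis by linarith
qed

lemma dp:
  assumes "0 < T" "T < \<tau>"
  shows "((\<lambda>T. T * P T) has_real_derivative (- 4 * (1 + T * P T) * (T * P T)
    + 2 * \<theta> T * (T * S T) * (1 + 2 * q + q * (T * P T))) / (2 * T)) (at T)"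
  unfolding P_def[abs_def]
  by (rule derivative_eq_intros dS dd assms refl)+
    (use assms in \<open>simp add: fS_def fd_def Q_def[symmetric] \<theta>_def field_simps power2_eq_square cq_def\<close>)

text \<open>The constant 3 bounds 1 + 2 q. Writing p = L - 1, the forcing \<theta> s (1 + 2 q + q p)
  is at most 3 + p, which is just compensated in the derivative of T (3 - p). The factor T removes
  the division by T and gives the initial value 0.\<close>

lemma p_le: "T \<in> {0..\<tau>} \<Longrightarrow> T * P T \<le> 3"
proof -
  assume T: "T \<in> {0..\<tau>}"
  let ?g = "\<lambda>T. T * (3 - T * P T)"
  have "?g 0 * exp (integral {0..T} (\<lambda>T. 0)) \<le> ?g T"
  proof (rule linear_differential_inequality[where g = ?g, OF _ _ _ T])
    show "continuous_on {0..\<tau>} ?g" by (intro continuous_intros cP)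
    fix t assume t: "0 < t" "t < \<tau>"
    let ?p = "t * P t" and ?u = "\<theta> t * (t * S t)"
    have der: "(?g has_real_derivative 3 + ?p + 2 * ?p\<^sup>2 - ?u * (1 + 2 * q + q * ?p)) (at t)"
      by (rule derivative_eq_intros dp t refl)+
        (use t in \<open>simp add: field_simps power2_eq_square\<close>)
    have t': "t \<in> {0..\<tau>}" using t by auto
    have "0 \<le> ?u" "?u \<le> 1 * 1"
      using th_pos[OF t'] th_le[OF t'] S_pos[OF t'] s_less_1[OF t'] t by (simp, intro mult_mono) auto
    moreover have p: "0 \<le> ?p" using P_pos[OF t'] t by simp
    moreover have "q * ?p \<le> 1 * ?p" using q calculation by (intro mult_right_mono) auto
    moreover have "?u * (1 + 2 * q + q * ?p) \<le> ?u * (3 + ?p)"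
      by (rule mult_left_mono) (use calculation q in auto)
    moreover have "?u * (3 + ?p) \<le> 1 * (3 + ?p)"
      by (rule mult_right_mono) (use calculation in auto)
    ultimately have "?u * (1 + 2 * q + q * ?p) \<le> 1 * (3 + ?p)" using order_trans by blast
    moreover have "0 \<le> A + 2 * B\<^sup>2 - C" if "C \<le> 1 * A" for A B C :: real
      using that zero_le_power2[of B] by linarith
    ultimately have "0 \<le> 3 + ?p + 2 * ?p\<^sup>2 - ?u * (1 + 2 * q + q * ?p)" by blast
    then show "\<exists>g'. (?g has_real_derivative g') (at t) \<and> 0 * ?g t \<le> g'"
      by (intro ex_derivative_ge[OF der]) linarith
  qed auto
  then show ?thesis using T by (cases "T = 0") (auto simp: zero_le_mult_iff)
qed

end

section \<open>Global existence of profiles\<close>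

text \<open>Bounds and Lipschitz constants uniform in x and polynomial in T. Keeping the bound next
  to the Lipschitz constant makes the class closed under products, and C (1 + T)^n has the explicit
  primitive that the weighted Picard theorem asks for.\<close>

definition tame :: "(real \<Rightarrow> 'e::real_normed_vector \<Rightarrow> 'b::real_normed_vector) \<Rightarrow> bool" where
  "tame g \<longleftrightarrow> (\<exists>C n. 0 \<le> C \<and> (\<forall>T\<ge>0. \<forall>x y. norm (g T x) \<le> C * (1 + T) ^ n \<and>
     norm (g T x - g T y) \<le> C * (1 + T) ^ n * norm (x - y)))"

lemma tameI:
  assumes "0 \<le> C" "\<And>T x. 0 \<le> T \<Longrightarrow> norm (g T x) \<le> C * (1 + T) ^ n"
    "\<And>T x y. 0 \<le> T \<Longrightarrow> norm (g T x - g T y) \<le> C * (1 + T) ^ n * norm (x - y)"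
  shows "tame g"
  unfolding tame_def using assms by blast

lemma tameE:
  assumes "tame g"
  obtains C n where "0 \<le> C" "\<And>T x. 0 \<le> T \<Longrightarrow> norm (g T x) \<le> C * (1 + T) ^ n"
    "\<And>T x y. 0 \<le> T \<Longrightarrow> norm (g T x - g T y) \<le> C * (1 + T) ^ n * norm (x - y)"
proof -
  from assms[unfolded tame_def] obtain C n where *: "0 \<le> C \<and> (\<forall>T\<ge>0. \<forall>x y. norm (g T x) \<le> C * (1 + T) ^ n \<and>
     norm (g T x - g T y) \<le> C * (1 + T) ^ n * norm (x - y))"
    by (elim exE) (rule that)
  show thesis by (rule that[of C n]) (use * in auto)
qed

lemma tame_common:
  assumes "tame g" "tame h"
  obtains C n where "0 \<le> C" "\<And>T x. 0 \<le> T \<Longrightarrow> norm (g T x) \<le> C * (1 + T) ^ n"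
    "\<And>T x y. 0 \<le> T \<Longrightarrow> norm (g T x - g T y) \<le> C * (1 + T) ^ n * norm (x - y)"
    "\<And>T x. 0 \<le> T \<Longrightarrow> norm (h T x) \<le> C * (1 + T) ^ n"
    "\<And>T x y. 0 \<le> T \<Longrightarrow> norm (h T x - h T y) \<le> C * (1 + T) ^ n * norm (x - y)"
proof -
  obtain C1 n1 where g: "0 \<le> C1" "\<And>T x. 0 \<le> T \<Longrightarrow> norm (g T x) \<le> C1 * (1 + T) ^ n1"
    "\<And>T x y. 0 \<le> T \<Longrightarrow> norm (g T x - g T y) \<le> C1 * (1 + T) ^ n1 * norm (x - y)"
    using tameE[OF assms(1)] by blast
  obtain C2 n2 where h: "0 \<le> C2" "\<And>T x. 0 \<le> T \<Longrightarrow> norm (h T x) \<le> C2 * (1 + T) ^ n2"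
    "\<And>T x y. 0 \<le> T \<Longrightarrow> norm (h T x - h T y) \<le> C2 * (1 + T) ^ n2 * norm (x - y)"
    using tameE[OF assms(2)] by blast
  have 1: "C1 * (1 + T) ^ n1 \<le> (C1 + C2) * (1 + T) ^ (n1 + n2)" if "0 \<le> T" for T
    using g(1) h(1) that by (intro mult_mono power_increasing) auto
  have 2: "C2 * (1 + T) ^ n2 \<le> (C1 + C2) * (1 + T) ^ (n1 + n2)" if "0 \<le> T" for T
    using g(1) h(1) that by (intro mult_mono power_increasing) auto
  show thesis
  proof (rule that[of "C1 + C2" "n1 + n2"])
    show "0 \<le> C1 + C2" using g h by simp
    fix T :: real assume T: "0 \<le> T"
    show "norm (g T x) \<le> (C1 + C2) * (1 + T) ^ (n1 + n2)" for x using g(2)[OF T] 1[OF T] order_trans by blast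
    show "norm (h T x) \<le> (C1 + C2) * (1 + T) ^ (n1 + n2)" for x using h(2)[OF T] 2[OF T] order_trans by blast
    show "norm (g T x - g T y) \<le> (C1 + C2) * (1 + T) ^ (n1 + n2) * norm (x - y)" for x y
      using g(3)[OF T] mult_right_mono[OF 1[OF T] norm_ge_zero] order_trans by blast
    show "norm (h T x - h T y) \<le> (C1 + C2) * (1 + T) ^ (n1 + n2) * norm (x - y)" for x y
      using h(3)[OF T] mult_right_mono[OF 2[OF T] norm_ge_zero] order_trans by blast
  qed
qed

lemma tame_const: "tame (\<lambda>T x. c)"
  by (rule tameI[of "norm c" _ 0]) auto

lemma tame_time: "tame (\<lambda>T x. T)"
  by (rule tameI[of 1 _ 1]) auto

lemma tame_add:
  assumes "tame g" "tame h" shows "tame (\<lambda>T x. g T x + h T x)"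
proof -
  obtain C n where *: "0 \<le> C" "\<And>T x. 0 \<le> T \<Longrightarrow> norm (g T x) \<le> C * (1 + T) ^ n"
    "\<And>T x y. 0 \<le> T \<Longrightarrow> norm (g T x - g T y) \<le> C * (1 + T) ^ n * norm (x - y)"
    "\<And>T x. 0 \<le> T \<Longrightarrow> norm (h T x) \<le> C * (1 + T) ^ n"
    "\<And>T x y. 0 \<le> T \<Longrightarrow> norm (h T x - h T y) \<le> C * (1 + T) ^ n * norm (x - y)"
    using tame_common[OF assms] by blast
  show ?thesis
  proof (rule tameI[of "2 * C" _ n])
    fix T :: real assume T: "0 \<le> T"
    show "norm (g T x + h T x) \<le> 2 * C * (1 + T) ^ n" for x
      using norm_triangle_ineq[of "g T x" "h T x"] *(2)[OF T, of x] *(4)[OF T, of x] by linarith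
    show "norm (g T x + h T x - (g T y + h T y)) \<le> 2 * C * (1 + T) ^ n * norm (x - y)" for x y
      using norm_triangle_ineq[of "g T x - g T y" "h T x - h T y"] *(3)[OF T, of x y] *(5)[OF T, of x y]
      by (simp add: algebra_simps)
  qed (use * in auto)
qed

lemma tame_mult:
  fixes g h :: "real \<Rightarrow> 'e::real_normed_vector \<Rightarrow> real"
  assumes "tame g" "tame h" shows "tame (\<lambda>T x. g T x * h T x)"
proof -
  obtain C n where *: "0 \<le> C" "\<And>T x. 0 \<le> T \<Longrightarrow> norm (g T x) \<le> C * (1 + T) ^ n"
    "\<And>T x y. 0 \<le> T \<Longrightarrow> norm (g T x - g T y) \<le> C * (1 + T) ^ n * norm (x - y)"
    "\<And>T x. 0 \<le> T \<Longrightarrow> norm (h T x) \<le> C * (1 + T) ^ n"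
    "\<And>T x y. 0 \<le> T \<Longrightarrow> norm (h T x - h T y) \<le> C * (1 + T) ^ n * norm (x - y)"
    using tame_common[OF assms] by blast
  show ?thesis
  proof (rule tameI[of "2 * C\<^sup>2" _ "2 * n"])
    fix T :: real assume T: "0 \<le> T"
    let ?K = "C * (1 + T) ^ n"
    have K: "0 \<le> ?K" using *(1) T by simp
    have KK: "2 * C\<^sup>2 * (1 + T) ^ (2 * n) = 2 * (?K * ?K)"
      by (simp add: power_mult power2_eq_square power_mult_distrib mult_ac power_even_eq)
    show "norm (g T x * h T x) \<le> 2 * C\<^sup>2 * (1 + T) ^ (2 * n)" for x
      using mult_mono[OF *(2)[OF T, of x] *(4)[OF T, of x] K norm_ge_zero] mult_nonneg_nonneg[OF K K]
      unfolding KK norm_mult by linarith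
    show "norm (g T x * h T x - g T y * h T y) \<le> 2 * C\<^sup>2 * (1 + T) ^ (2 * n) * norm (x - y)" for x y
    proof -
      have "g T x * h T x - g T y * h T y = g T x * (h T x - h T y) + (g T x - g T y) * h T y"
        by (simp add: algebra_simps)
      then have "norm (g T x * h T x - g T y * h T y) \<le>
          norm (g T x) * norm (h T x - h T y) + norm (g T x - g T y) * norm (h T y)"
        using norm_triangle_ineq[of "g T x * (h T x - h T y)" "(g T x - g T y) * h T y"] by (simp add: abs_mult)
      also have "\<dots> \<le> ?K * (?K * norm (x - y)) + (?K * norm (x - y)) * ?K"
        by (intro add_mono mult_mono * T K mult_nonneg_nonneg norm_ge_zero)
      finally show ?thesis unfolding KK by (simp add: algebra_simps)
    qed
  qed auto
qed

lemma tame_Pair: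
  assumes "tame g" "tame h" shows "tame (\<lambda>T x. (g T x, h T x))"
proof -
  obtain C n where *: "0 \<le> C" "\<And>T x. 0 \<le> T \<Longrightarrow> norm (g T x) \<le> C * (1 + T) ^ n"
    "\<And>T x y. 0 \<le> T \<Longrightarrow> norm (g T x - g T y) \<le> C * (1 + T) ^ n * norm (x - y)"
    "\<And>T x. 0 \<le> T \<Longrightarrow> norm (h T x) \<le> C * (1 + T) ^ n"
    "\<And>T x y. 0 \<le> T \<Longrightarrow> norm (h T x - h T y) \<le> C * (1 + T) ^ n * norm (x - y)"
    using tame_common[OF assms] by blast
  show ?thesis
  proof (rule tameI[of "2 * C" _ n])
    fix T :: real assume T: "0 \<le> T"
    show "norm (g T x, h T x) \<le> 2 * C * (1 + T) ^ n" for x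
      using norm_Pair_le[of "g T x" "h T x"] *(2)[OF T, of x] *(4)[OF T, of x] by linarith
    show "norm ((g T x, h T x) - (g T y, h T y)) \<le> 2 * C * (1 + T) ^ n * norm (x - y)" for x y
      using norm_Pair_le[of "g T x - g T y" "h T x - h T y"] *(3)[OF T, of x y] *(5)[OF T, of x y]
      by (simp add: algebra_simps)
  qed (use * in auto)
qed

lemma tame_diff:
  fixes g h :: "real \<Rightarrow> 'e::real_normed_vector \<Rightarrow> real"
  assumes "tame g" "tame h" shows "tame (\<lambda>T x. g T x - h T x)"
  using tame_add[OF assms(1) tame_mult[OF tame_const[of "-1"] assms(2)]] by simp

lemmas tame_intros = tame_const tame_time tame_add tame_mult tame_diff tame_Pair

section \<open>Clipping the profile field to a box\<close>

definition clip :: "real \<Rightarrow> real \<Rightarrow> real" where "clip B x = max (- B) (min B x)"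

lemma clip_id: "\<bar>x\<bar> \<le> B \<Longrightarrow> clip B x = x" by (auto simp: clip_def)

lemma tame_clip:
  assumes "0 \<le> B" and "\<And>x y. norm (p x - p y) \<le> norm (x - y)"
  shows "tame (\<lambda>T x. clip B (p x))"
proof (rule tameI[of "max 1 B" _ 0])
  have "norm (clip B (p x) - clip B (p y)) \<le> norm (x - y)" for x y
    using assms(2)[of x y] by (auto simp: clip_def)
  then show "norm (clip B (p x) - clip B (p y)) \<le> max 1 B * (1 + T) ^ 0 * norm (x - y)" for T :: real and x y
    using mult_right_mono[of 1 "max 1 B" "norm (x - y)"] by (auto intro: order_trans)
qed (use assms(1) in \<open>auto simp: clip_def\<close>)

definition clip3 :: "real \<Rightarrow> real \<times> real \<times> real \<Rightarrow> real \<times> real \<times> real" where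
  "clip3 B x = (clip B (fst x), clip B (fst (snd x)), clip B (snd (snd x)))"

definition pfield :: "real \<Rightarrow> real \<Rightarrow> real \<times> real \<times> real \<Rightarrow> real \<times> real \<times> real" where
  "pfield q T u = (fS q T (fst u) (fst (snd u) - snd (snd u) / 2) (snd (snd u)),
                   fV q T (fst u) (fst (snd u) - snd (snd u) / 2) (snd (snd u)),
                   fd q T (fst u) (fst (snd u) - snd (snd u) / 2) (snd (snd u)))"

lemma norm_components:
  fixes x :: "real \<times> real \<times> real"
  shows "\<bar>fst x\<bar> \<le> norm x" "\<bar>fst (snd x)\<bar> \<le> norm x" "\<bar>snd (snd x)\<bar> \<le> norm x"
proof -
  have 1: "norm (fst x) \<le> norm x" "norm (snd x) \<le> norm x"
    using norm_fst_le[of "fst x" "snd x"] norm_snd_le[of "snd x" "fst x"] by auto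
  have 2: "norm (fst (snd x)) \<le> norm (snd x)" "norm (snd (snd x)) \<le> norm (snd x)"
    using norm_fst_le[of "fst (snd x)" "snd (snd x)"] norm_snd_le[of "snd (snd x)" "fst (snd x)"] by auto
  show "\<bar>fst x\<bar> \<le> norm x" "\<bar>fst (snd x)\<bar> \<le> norm x" "\<bar>snd (snd x)\<bar> \<le> norm x"
    using 1 2 by auto
qed

lemma clip3_id:
  "\<bar>fst x\<bar> \<le> B \<Longrightarrow> \<bar>fst (snd x)\<bar> \<le> B \<Longrightarrow> \<bar>snd (snd x)\<bar> \<le> B \<Longrightarrow> clip3 B x = x"
  by (simp add: clip3_def clip_id)

lemma tame_pfield_clip:
  assumes "0 \<le> B" shows "tame (\<lambda>T x. pfield q T (clip3 B x))"
proof -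
  have c: "tame (\<lambda>T x::real \<times> real \<times> real. clip B (fst x))" "tame (\<lambda>T x::real \<times> real \<times> real. clip B (fst (snd x)))"
    "tame (\<lambda>T x::real \<times> real \<times> real. clip B (snd (snd x)))"
    using norm_components by (auto intro!: tame_clip assms simp: fst_diff[symmetric] snd_diff[symmetric] simp del: fst_diff snd_diff)
  show ?thesis
    unfolding pfield_def clip3_def fst_conv snd_conv fS_def fV_def fd_def power2_eq_square divide_inverse
    by (intro tame_intros c)
qed

lemma pfield_lipschitz_on_box:
  assumes "0 \<le> B"
  obtains C n where "0 \<le> C"
    "\<And>T x y. 0 \<le> T \<Longrightarrow> clip3 B x = x \<Longrightarrow> clip3 B y = y \<Longrightarrow>
        norm (pfield q T x - pfield q T y) \<le> C * (1 + T) ^ n * norm (x - y)"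
  using tame_pfield_clip[OF assms, of q] by (elim tameE) (metis (no_types, lifting))

lemma continuous_on_pfield:
  "continuous_on A T \<Longrightarrow> continuous_on A u \<Longrightarrow> continuous_on A (\<lambda>x. pfield q (T x) (u x))"
  unfolding pfield_def fS_def fV_def fd_def by (intro continuous_intros) auto

lemma continuous_on_clip3: "continuous_on A u \<Longrightarrow> continuous_on A (\<lambda>x. clip3 B (u x))"
  unfolding clip3_def clip_def by (intro continuous_intros) auto

section \<open>The weighted integral equation\<close>

definition weight :: "real \<Rightarrow> real \<times> real \<times> real \<Rightarrow> real \<times> real \<times> real" where
  "weight r x = (fst x, fst (snd x), r ^ 3 * snd (snd x))"

lemma continuous_on_slice:
  assumes "continuous_on (U \<times> X) (\<lambda>(a, T). u a T)" "a \<in> U"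
  shows "continuous_on X (u a)"
proof -
  have "continuous_on X (\<lambda>T. (a, T))" by (intro continuous_intros)
  moreover have "(\<lambda>T. (a, T)) ` X \<subseteq> U \<times> X" using assms(2) by auto
  ultimately show ?thesis using continuous_on_compose2[OF assms(1)] by fastforce
qed

lemma weight_contract: "r \<in> {0..1} \<Longrightarrow> norm (weight r x) \<le> norm x"
  and weight_diff: "weight r (x - y) = weight r x - weight r y"
proof -
  show "weight r (x - y) = weight r x - weight r y"
    by (simp add: weight_def algebra_simps)
  assume r: "r \<in> {0..1}"
  then have "\<bar>r ^ 3 * snd (snd x)\<bar> \<le> 1 * \<bar>snd (snd x)\<bar>"
    unfolding abs_mult by (intro mult_right_mono) (auto simp: power_le_one)
  then have "(r ^ 3 * snd (snd x))\<^sup>2 \<le> (snd (snd x))\<^sup>2"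
    by (simp add: abs_le_square_iff[symmetric])
  then show "norm (weight r x) \<le> norm x"
    by (cases x) (auto simp: weight_def norm_Pair intro!: real_sqrt_le_mono)
qed

text \<open>The part \<open>-3 d / T\<close> of the derivative comes from the weight \<open>r\<^sup>3\<close>.\<close>

lemma weighted_integral_derivative:
  fixes h u :: "real \<Rightarrow> real \<times> real \<times> real"
  assumes ch: "continuous_on {0..} h"
    and u: "\<And>T. 0 \<le> T \<Longrightarrow> u T = (\<alpha>, \<beta>, 0) + T *\<^sub>R integral {0..1} (\<lambda>r. weight r (h (r * T)))"
    and T: "0 < T"
  shows "(u has_vector_derivative h T - (0, 0, 3 * snd (snd (u T)) / T)) (at T)"
proof -
  define h1 h2 h3 where "h1 = (\<lambda>t. fst (h t))" and "h2 = (\<lambda>t. fst (snd (h t)))" and "h3 = (\<lambda>t. t ^ 3 * snd (snd (h t)))"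
  have c: "continuous_on {0..} h1" "continuous_on {0..} h2" "continuous_on {0..} h3"
    unfolding h1_def h2_def h3_def by (intro continuous_intros ch)+
  have cT: "continuous_on {0..T} g" if "continuous_on {0..} g" for g :: "real \<Rightarrow> real" and T
    by (rule continuous_on_subset[OF that]) auto
  have D: "((\<lambda>T. integral {0..T} g) has_real_derivative g T) (at T)" if "continuous_on {0..} g" "0 < T" for g :: "real \<Rightarrow> real" and T
  proof -
    have "((\<lambda>T. integral {0..T} g) has_real_derivative g T) (at T within {0..T + 1})"
      by (rule integral_has_real_derivative[OF cT[OF that(1)]]) (use that in auto)
    then show ?thesis using that by (simp add: at_within_Icc_at)
  qed
  \<comment> \<open>Rescaling turns the weight r^3 into t^3 / T^3. The third component is then T^(-
    3) times an ordinary indefinite integral, and differentiating this quotient produces - 3 /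
    T.\<close>
  have eq: "u T = (\<alpha> + integral {0..T} h1, \<beta> + integral {0..T} h2, integral {0..T} h3 / T ^ 3)" if T: "0 < T" for T
  proof -
    have cc: "continuous_on {0..1} (\<lambda>r. h (r * T))"
      by (rule continuous_on_compose2[OF ch]) (use T in \<open>auto intro!: continuous_intros\<close>)
    have i: "(\<lambda>r. weight r (h (r * T))) integrable_on {0..1}"
      unfolding weight_def by (intro integrable_continuous_real continuous_intros cc)
    have i2: "(\<lambda>r. snd (weight r (h (r * T)))) integrable_on {0..1}"
      unfolding weight_def by (auto intro!: integrable_continuous_real continuous_intros cc)
    let ?I = "integral {0..1} (\<lambda>r. weight r (h (r * T)))"
    have "fst ?I = integral {0..1} (\<lambda>r. h1 (r * T))"
      using integral_linear[OF i bounded_linear_fst] by (simp add: o_def weight_def h1_def)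
    then have 1: "T * fst ?I = integral {0..T} h1"
      using integral_scaled_interval[OF cT[OF c(1)], of T] T by simp
    have s: "snd ?I = integral {0..1} (\<lambda>r. snd (weight r (h (r * T))))"
      using integral_linear[OF i bounded_linear_snd] by (simp add: o_def)
    have "fst (snd ?I) = integral {0..1} (\<lambda>r. h2 (r * T))"
      unfolding s using integral_linear[OF i2 bounded_linear_fst] by (simp add: o_def weight_def h2_def)
    then have 2: "T * fst (snd ?I) = integral {0..T} h2"
      using integral_scaled_interval[OF cT[OF c(2)], of T] T by simp
    have "T ^ 3 * snd (snd ?I) = T ^ 3 * integral {0..1} (\<lambda>r. r ^ 3 * snd (snd (h (r * T))))"
      unfolding s using integral_linear[OF i2 bounded_linear_snd] by (simp add: o_def weight_def)
    also have "\<dots> = integral {0..1} (\<lambda>r. h3 (r * T))"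
      unfolding integral_mult_right[symmetric] by (rule integral_cong) (simp add: h3_def power_mult_distrib)
    finally have "T ^ 3 * (T * snd (snd ?I)) = T * integral {0..1} (\<lambda>r. h3 (r * T))"
      by simp
    then have 3: "T * snd (snd ?I) = integral {0..T} h3 / T ^ 3"
      using integral_scaled_interval[OF cT[OF c(3)], of T] T by (simp add: field_simps)
    show ?thesis
      using u[of T] T 1 2 3 by (simp add: prod_eq_iff)
  qed
  have "a * T ^ 3 / T ^ 6 = a / T ^ 3" "b * (3 * T\<^sup>2) / T ^ 6 = 3 * b / T ^ 4" for a b :: real
    using T by (simp_all add: field_simps flip: power_add)
  then have alg: "(a * T ^ 3 - b * (3 * T\<^sup>2)) / T ^ 6 = a / T ^ 3 - 3 * b / T ^ 4" for a b :: real
    unfolding diff_divide_distrib by simp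
  have "((\<lambda>T. (\<alpha> + integral {0..T} h1, \<beta> + integral {0..T} h2, integral {0..T} h3 / T ^ 3))
      has_vector_derivative (h1 T, h2 T, h3 T / T ^ 3 - 3 * integral {0..T} h3 / T ^ 4)) (at T)"
    using T by (intro has_vector_derivative_Pair)
      (auto intro!: derivative_eq_intros D c simp: has_real_derivative_iff_has_vector_derivative[symmetric] alg)
  moreover have "(h1 T, h2 T, h3 T / T ^ 3 - 3 * integral {0..T} h3 / T ^ 4) = h T - (0, 0, 3 * snd (snd (u T)) / T)"
    using T unfolding eq[OF T] by (simp add: h1_def h2_def h3_def prod_eq_iff power_numeral_reduce)
  ultimately show ?thesis
    using has_vector_derivative_transform_within_open[of _ _ T "{0<..}" u] eq T by auto
qed

text \<open>The components are (S, V, d). The singular term forces d to start at 0, so two initial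
  values are free; the second one is called Q0 because V and Q coincide at T = 0.\<close>

definition is_profile :: "real \<Rightarrow> real \<Rightarrow> real \<Rightarrow> (real \<Rightarrow> real \<times> real \<times> real) \<Rightarrow> bool" where
  "is_profile q S0 Q0 u \<longleftrightarrow> continuous_on {0..} u \<and> u 0 = (S0, Q0, 0) \<and>
     (\<forall>T>0. (u has_vector_derivative pfield q T (u T) - (0, 0, 3 * snd (snd (u T)) / T)) (at T))"

lemma profile_segmentI:
  assumes "- 1 / 2 < q" "q < 1" "0 < \<tau>" "0 < S0" "0 < Q0"
    and "continuous_on {0..\<tau>} u" "u 0 = (S0, Q0, 0)"
    and der: "\<And>T. 0 < T \<Longrightarrow> T < \<tau> \<Longrightarrow>
      (u has_vector_derivative pfield q T (u T) - (0, 0, 3 * snd (snd (u T)) / T)) (at T)"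
  shows "profile_segment q \<tau> (\<lambda>T. fst (u T)) (\<lambda>T. fst (snd (u T))) (\<lambda>T. snd (snd (u T)))"
proof
  fix T assume T: "0 < T" "T < \<tau>"
  note 1 = bounded_linear.has_vector_derivative[OF bounded_linear_fst der[OF T]]
  note 2 = bounded_linear.has_vector_derivative[OF bounded_linear_snd der[OF T]]
  note 3 = bounded_linear.has_vector_derivative[OF bounded_linear_fst 2]
  note 4 = bounded_linear.has_vector_derivative[OF bounded_linear_snd 2]
  show "((\<lambda>T. fst (u T)) has_real_derivative fS q T (fst (u T)) (fst (snd (u T)) - snd (snd (u T)) / 2) (snd (snd (u T)))) (at T)"
    using 1 by (simp add: has_real_derivative_iff_has_vector_derivative pfield_def)
  show "((\<lambda>T. fst (snd (u T))) has_real_derivative fV q T (fst (u T)) (fst (snd (u T)) - snd (snd (u T)) / 2) (snd (snd (u T)))) (at T)"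
    using 3 by (simp add: has_real_derivative_iff_has_vector_derivative pfield_def)
  show "((\<lambda>T. snd (snd (u T))) has_real_derivative fd q T (fst (u T)) (fst (snd (u T)) - snd (snd (u T)) / 2) (snd (snd (u T)))
      - 3 * snd (snd (u T)) / T) (at T)"
    using 4 by (simp add: has_real_derivative_iff_has_vector_derivative pfield_def)
qed (use assms in \<open>auto intro!: continuous_intros\<close>)

lemma is_profile_segment:
  assumes "- 1 / 2 < q" "q < 1" "0 < S0" "0 < Q0" "is_profile q S0 Q0 u" "0 < \<tau>"
  shows "profile_segment q \<tau> (\<lambda>T. fst (u T)) (\<lambda>T. fst (snd (u T))) (\<lambda>T. snd (snd (u T)))"
  using assms by (intro profile_segmentI) (auto simp: is_profile_def intro: continuous_on_subset)

text \<open>These are s < 1, 0 < \<theta> \<le> 1 and 0 < L - 1 \<le> 3 divided by T. They are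
  useless near T = 0 but do not depend on the initial data; 4 is simply large enough for all three
  components.\<close>

lemma (in profile_segment) bounds:
  assumes "T \<in> {0<..\<tau>}"
  shows "\<bar>S T\<bar> < 4 / T" "\<bar>V T\<bar> < 4 / T" "\<bar>d T\<bar> < 4 / T"
proof -
  have T: "T \<in> {0..\<tau>}" "0 < T" using assms by auto
  have 1: "0 < S T" "S T < 1 / T" using S_pos[OF T(1)] s_less_1[OF T(1)] T by (auto simp: field_simps)
  have 2: "0 < Q T" "Q T < 1 / T" using Q_pos[OF T(1)] th_pos[OF T(1)] T by (auto simp: field_simps \<theta>_def)
  have 3: "0 < P T" "P T \<le> 3 / T" using P_pos[OF T(1)] p_le[OF T(1)] T by (auto simp: field_simps)
  have "0 \<le> cq q * S T" "cq q * S T \<le> 1 * S T"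
    using cq_pos cq_le 1 by (auto intro: mult_right_mono)
  then have "d T < P T + S T" "P T - S T \<le> d T" "d T \<le> P T"
    using 1 unfolding P_def by linarith+
  moreover have "V T = Q T + d T / 2" by (simp add: Q_def)
  moreover have "3 / T = 3 * (1 / T)" "4 / T = 4 * (1 / T)" by auto
  ultimately show "\<bar>S T\<bar> < 4 / T" "\<bar>V T\<bar> < 4 / T" "\<bar>d T\<bar> < 4 / T"
    using 1 2 3 by linarith+
qed

text \<open>The global solution is obtained by clipping the field to a box.  Before time \<open>T0\<close> the solution
  cannot leave a small box for lack of speed, and after \<open>T0\<close> the invariant region gives bounds of
  order \<open>1 / T0\<close>; so a box of that size is never left.\<close>

theorem profiles_exist:
  fixes A :: real
  assumes q: "- 1 / 2 < q" "q < 1" and A: "0 < A"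
  obtains u :: "real \<times> real \<Rightarrow> real \<Rightarrow> real \<times> real \<times> real"
  where "continuous_on (({0<..A} \<times> {0<..A}) \<times> {0..}) (\<lambda>(a, T). u a T)"
    and "\<And>a. a \<in> {0<..A} \<times> {0<..A} \<Longrightarrow> is_profile q (fst a) (snd a) (u a)"
    and "\<And>a. a \<in> {0<..A} \<times> {0<..A} \<Longrightarrow> \<exists>C. \<forall>T\<in>{0..1}. norm (u a T - (fst a, snd a, 0)) \<le> C * T"
proof -
  \<comment> \<open>The initial data have norm at most 2 A; the additional 1 is the margin that the
    solution must travel before it leaves the small box.\<close>
  define b where "b = 2 * A + 1"
  have b0: "0 \<le> b" using A by (simp add: b_def)
  from tame_pfield_clip[OF b0, of q, unfolded tame_def] obtain C1 n1 where
    "0 \<le> C1 \<and> (\<forall>T\<ge>0. \<forall>x y. norm (pfield q T (clip3 b x)) \<le> C1 * (1 + T) ^ n1 \<and>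
     norm (pfield q T (clip3 b x) - pfield q T (clip3 b y)) \<le> C1 * (1 + T) ^ n1 * norm (x - y))"
    by (elim exE) (rule that)
  then have C1: "0 \<le> C1" "\<And>T x. 0 \<le> T \<Longrightarrow> norm (pfield q T (clip3 b x)) \<le> C1 * (1 + T) ^ n1"
     "\<And>T x y. 0 \<le> T \<Longrightarrow> norm (pfield q T (clip3 b x) - pfield q T (clip3 b y)) \<le> C1 * (1 + T) ^ n1 * norm (x - y)"
    by auto
  define K where "K = C1 * 2 ^ n1"
  have K0: "0 \<le> K" using C1 by (simp add: K_def)
  have K: "norm (pfield q T (clip3 b x)) \<le> K" if "0 \<le> T" "T \<le> 1" for T x
  proof -
    have "(1 + T) ^ n1 \<le> 2 ^ n1" using that by (intro power_mono) auto
    then show ?thesis using C1(2)[OF that(1), of x] mult_left_mono[OF _ C1(1)] unfolding K_def by (meson order_trans)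
  qed
  \<comment> \<open>With speed at most K the margin 1 cannot be used up before T0, because T0 K <
    1.\<close>
  define T0 where "T0 = 1 / (K + 1)"
  have T0: "0 < T0" "T0 \<le> 1" "T0 * K < 1" using K0 by (auto simp: T0_def field_simps)
  \<comment> \<open>Large enough to contain the small box and, from T0 on, the a priori bound 4 /
    T.\<close>
  define B where "B = b + 4 / T0"
  have B0: "0 \<le> B" "b \<le> B" "4 / T0 \<le> B" using A T0 by (auto simp: B_def b_def)
  from tame_pfield_clip[OF B0(1), of q, unfolded tame_def] obtain C n where
    "0 \<le> C \<and> (\<forall>T\<ge>0. \<forall>x y. norm (pfield q T (clip3 B x)) \<le> C * (1 + T) ^ n \<and>
     norm (pfield q T (clip3 B x) - pfield q T (clip3 B y)) \<le> C * (1 + T) ^ n * norm (x - y))"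
    by (elim exE) (rule that)
  then have C: "0 \<le> C" "\<And>T x. 0 \<le> T \<Longrightarrow> norm (pfield q T (clip3 B x)) \<le> C * (1 + T) ^ n"
     "\<And>T x y. 0 \<le> T \<Longrightarrow> norm (pfield q T (clip3 B x) - pfield q T (clip3 B y)) \<le> C * (1 + T) ^ n * norm (x - y)"
    by auto
  \<comment> \<open>Clamping makes the initial value bounded and continuous on the whole parameter
    space; on the parameters of interest it changes nothing.\<close>
  define u0 :: "real \<times> real \<Rightarrow> real \<times> real \<times> real" where "u0 a = (max 0 (min A (fst a)), max 0 (min A (snd a)), 0)" for a
  have cu0: "continuous_on UNIV u0" unfolding u0_def by (intro continuous_intros)
  have nu0: "norm (u0 a) \<le> 2 * A" for a
  proof -
    have "norm (u0 a) \<le> norm (max 0 (min A (fst a))) + (norm (max 0 (min A (snd a))) + norm (0::real))"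
      unfolding u0_def by (intro order_trans[OF norm_Pair_le] add_left_mono norm_Pair_le)
    also have "\<dots> \<le> 2 * A" using A by auto
    finally show ?thesis .
  qed
  have "\<exists>u. continuous_on (UNIV \<times> {0..}) (\<lambda>(a, T). u a T) \<and>
    (\<forall>a. \<forall>T\<ge>0. u a T = u0 a + T *\<^sub>R integral {0..1} (\<lambda>r. weight r (pfield q (r * T) (clip3 B (u a (r * T))))))"
  proof (rule weighted_picard[where L = "\<lambda>T. C * (1 + T) ^ n" and \<Lambda> = "\<lambda>T. C / real (Suc n) * (1 + T) ^ Suc n"])
    show "continuous_on ({0..} \<times> UNIV) (\<lambda>(T, x). pfield q T (clip3 B x))"
      unfolding case_prod_beta by (intro continuous_on_pfield continuous_on_clip3 continuous_intros)
    show "continuous_on ({0..1} \<times> UNIV) (\<lambda>(r, x). weight r x)"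
      unfolding case_prod_beta weight_def by (intro continuous_intros)
    show "norm (weight r x - weight r y) \<le> norm (x - y)" if "r \<in> {0..1}" for r x y
      unfolding weight_diff[symmetric] by (rule weight_contract[OF that])
    fix T :: real
    have "((\<lambda>T. (1 + T) ^ Suc n) has_real_derivative real (Suc n) * (1 + T) ^ n) (at T)"
      using DERIV_power[of "\<lambda>T. 1 + T" 1 T UNIV "Suc n"] DERIV_add[OF DERIV_const DERIV_ident, of 1 T UNIV] by simp
    from DERIV_cmult[OF this, of "C / real (Suc n)"]
    show "((\<lambda>T. C / real (Suc n) * (1 + T) ^ Suc n) has_real_derivative C * (1 + T) ^ n) (at T)"
      by (rule DERIV_cong) (simp del: of_nat_Suc)
  qed (use weight_contract C cu0 nu0 in \<open>auto intro!: continuous_intros\<close>)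
  then obtain u where cu: "continuous_on (UNIV \<times> {0..}) (\<lambda>(a, T). u a T)"
    and u: "\<And>a T. 0 \<le> T \<Longrightarrow> u a T = u0 a + T *\<^sub>R integral {0..1} (\<lambda>r. weight r (pfield q (r * T) (clip3 B (u a (r * T)))))"
    by blast
  have ca: "continuous_on {0..} (u a)" for a
    by (rule continuous_on_slice[OF cu]) simp
  have ci: "continuous_on {0..1} (\<lambda>r. weight r (pfield q (r * T) (clip3 B (u a (r * T)))))" if "0 \<le> T" for a T
    unfolding weight_def
    by (intro continuous_intros continuous_on_pfield continuous_on_clip3 continuous_on_compose2[OF ca])
      (use that in auto)
  \<comment> \<open>The displacement is read off the integral equation, where the singular term is
    already absorbed in a weight of norm at most 1. The derivative itself contains d / T and would
    give no such bound.\<close>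
  have incr: "norm (u a T - u0 a) \<le> M * T"
    if "0 \<le> T" "\<And>t. 0 \<le> t \<Longrightarrow> t \<le> T \<Longrightarrow> norm (pfield q t (clip3 B (u a t))) \<le> M" for a T M
  proof -
    have "norm (integral {0..1} (\<lambda>r. weight r (pfield q (r * T) (clip3 B (u a (r * T)))))) \<le> integral {0..1} (\<lambda>r::real. M)"
    proof (rule integral_norm_bound_integral)
      fix r :: real assume r: "r \<in> {0..1}"
      then have "0 \<le> r * T" "r * T \<le> T" using that by (auto intro: mult_left_le_one_le)
      then show "norm (weight r (pfield q (r * T) (clip3 B (u a (r * T))))) \<le> M"
        using weight_contract[OF r] that(2) order_trans by blast
    qed (simp_all add: integrable_continuous_real[OF ci[OF that(1)]] integrable_continuous_real)
    then have "T * norm (integral {0..1} (\<lambda>r. weight r (pfield q (r * T) (clip3 B (u a (r * T)))))) \<le> T * M"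
      using that(1) by (intro mult_left_mono) auto
    then show ?thesis unfolding u[OF that(1)] using that(1) by (simp add: mult.commute)
  qed
  have der: "(u a has_vector_derivative pfield q T (clip3 B (u a T)) - (0, 0, 3 * snd (snd (u a T)) / T)) (at T)"
    if "0 < T" for a T
    by (rule weighted_integral_derivative[where \<alpha> = "max 0 (min A (fst a))" and \<beta> = "max 0 (min A (snd a))"])
      (use u that in \<open>auto simp: u0_def intro!: continuous_on_pfield continuous_on_clip3 continuous_intros ca\<close>)
  show thesis
  proof (rule that[of u])
    show "continuous_on (({0<..A} \<times> {0<..A}) \<times> {0..}) (\<lambda>(a, T). u a T)"
      by (rule continuous_on_subset[OF cu]) auto
    fix a assume a: "a \<in> {0<..A} \<times> {0<..A}"
    have u0a: "u0 a = (fst a, snd a, 0)" using a by (auto simp: u0_def)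
    have ua0: "u a 0 = u0 a" using u[of 0 a] by simp
    \<comment> \<open>The distance to the boundary of the large box: as long as it is nonnegative,
      clipping is the identity and the curve solves the true equation.\<close>
    define g where "g T = B - max \<bar>fst (u a T)\<bar> (max \<bar>fst (snd (u a T))\<bar> \<bar>snd (snd (u a T))\<bar>)" for T
    have cg: "continuous_on {0..T} g" for T
      unfolding g_def by (intro continuous_intros continuous_on_subset[OF ca]) auto
    have g_clip: "clip3 B (u a T) = u a T" if "0 \<le> g T" for T
      using that by (intro clip3_id) (auto simp: g_def)
    have g_small: "0 < g T" if "norm (u a T) < b" for T
      using norm_components[of "u a T"] that B0 by (auto simp: g_def)
    have g_pos: "0 < g T" if T: "0 \<le> T" for T
    proof (rule ccontr)
      assume "\<not> 0 < g T"
      then have "g T \<le> 0" by simp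
      moreover have "0 < g 0" by (rule g_small) (use ua0 nu0[of a] in \<open>auto simp: b_def\<close>)
      ultimately obtain T1 where T1: "0 < T1" "T1 \<le> T" "g T1 = 0" "\<And>t. 0 \<le> t \<Longrightarrow> t < T1 \<Longrightarrow> 0 < g t"
        using first_nonpositive_time[OF cg[of T], of T] T by auto
      interpret profile_segment q T1 "\<lambda>T. fst (u a T)" "\<lambda>T. fst (snd (u a T))" "\<lambda>T. snd (snd (u a T))"
      proof (rule profile_segmentI)
        fix t assume t: "0 < t" "t < T1"
        then have "clip3 B (u a t) = u a t" using g_clip[of t] T1(4)[of t] by auto
        then show "(u a has_vector_derivative pfield q t (u a t) - (0, 0, 3 * snd (snd (u a t)) / t)) (at t)"
          using der[OF t(1), of a] by simp
      qed (use q T1 a ua0 u0a in \<open>auto intro: continuous_on_subset[OF ca]\<close>)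
      show False
      proof (cases "T0 \<le> T1")
        case True
        then have "4 / T1 \<le> 4 / T0" using T0 by (auto intro: divide_left_mono)
        moreover have "T1 \<in> {0<..T1}" using T1(1) by simp
        ultimately have "\<bar>fst (u a T1)\<bar> < B" "\<bar>fst (snd (u a T1))\<bar> < B" "\<bar>snd (snd (u a T1))\<bar> < B"
          using bounds[of T1] B0(3) by linarith+
        then have "0 < g T1" by (simp add: g_def)
        then show False using T1 by simp
      next
        case False
        \<comment> \<open>Leaving the large box implies having left the small one, so the
          displacement reaches 1 at some T2 \<le> T1. Up to T2 both clippings are the identity, the
          speed is at most K, and K T2 < 1 is a contradiction.\<close>
        have "1 - norm (u a T1 - u0 a) \<le> 0"
        proof (rule ccontr)
          assume "\<not> ?thesis"
          then have "norm (u a T1) < b"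
            using norm_triangle_ineq[of "u a T1 - u0 a" "u0 a"] nu0[of a] by (simp add: b_def)
          then show False using g_small[of T1] T1 by simp
        qed
        moreover have "continuous_on {0..T1} (\<lambda>T. 1 - norm (u a T - u0 a))"
          by (intro continuous_intros continuous_on_subset[OF ca]) auto
        ultimately obtain T2 where T2: "0 < T2" "T2 \<le> T1" "1 - norm (u a T2 - u0 a) = 0"
            "\<And>t. 0 \<le> t \<Longrightarrow> t < T2 \<Longrightarrow> 0 < 1 - norm (u a t - u0 a)"
          using first_nonpositive_time[of T1 "\<lambda>T. 1 - norm (u a T - u0 a)" T1] ua0 T1 by auto
        have "norm (u a T2 - u0 a) \<le> K * T2"
        proof (rule incr)
          fix t assume t: "0 \<le> t" "t \<le> T2"
          then have "norm (u a t - u0 a) \<le> 1"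
            using T2(3) T2(4)[of t] by (cases "t = T2") auto
          then have nb: "norm (u a t) \<le> b"
            using norm_triangle_ineq[of "u a t - u0 a" "u0 a"] nu0[of a] by (simp add: b_def)
          then have "clip3 B (u a t) = u a t" "clip3 b (u a t) = u a t"
            using norm_components[of "u a t"] B0 by (auto intro!: clip3_id)
          then show "norm (pfield q t (clip3 B (u a t))) \<le> K"
            using K[of t "u a t"] t T2 T1 False T0 by simp
        qed (use T2 in simp)
        also have "\<dots> \<le> T0 * K" using T2 False K0 by (simp add: mult.commute mult_left_mono)
        finally show False using T2(3) T0(3) by simp
      qed
    qed
    show "is_profile q (fst a) (snd a) (u a)"
      unfolding is_profile_def using ca[of a] ua0 u0a der[of _ a] g_clip[OF less_imp_le[OF g_pos]] by (metis less_imp_le)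
    have "norm (u a T - (fst a, snd a, 0)) \<le> (C * 2 ^ n) * T" if T: "T \<in> {0..1}" for T
      unfolding u0a[symmetric]
    proof (rule incr)
      fix t assume t: "0 \<le> t" "t \<le> T"
      then have "(1 + t) ^ n \<le> 2 ^ n" using T by (intro power_mono) auto
      then show "norm (pfield q t (clip3 B (u a t))) \<le> C * 2 ^ n"
        using C(2)[OF t(1), of "u a t"] mult_left_mono[OF _ C(1)] by (meson order_trans)
    qed (use T in simp)
    then show "\<exists>C. \<forall>T\<in>{0..1}. norm (u a T - (fst a, snd a, 0)) \<le> C * T" by blast
  qed
qed

section \<open>From profiles to metrics\<close>

text \<open>By monotonicity l < g (a, t) is equivalent to f a l < t, which is an open condition on
  (a, t); the opposite inequality is treated in the same way.\<close>

lemma continuous_on_inverse_param: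
  fixes f :: "'a::topological_space \<Rightarrow> real \<Rightarrow> real"
  assumes cf: "continuous_on (U \<times> {0..}) (\<lambda>(a, R). f a R)"
    and mono: "\<And>a. a \<in> U \<Longrightarrow> strict_mono_on {0..} (f a)"
    and surj: "\<And>a. a \<in> U \<Longrightarrow> f a ` {0..} = {0..}"
  shows "continuous_on (U \<times> {0..}) (\<lambda>(a, t). inv_into {0..} (f a) t)"
proof -
  define g where "g p = inv_into {0..} (f (fst p)) (snd p)" for p
  have g0: "0 \<le> g p" and fg: "f (fst p) (g p) = snd p" if "p \<in> U \<times> {0..}" for p
    using that surj[of "fst p"] inv_into_into[of "snd p" "f (fst p)" "{0..}"] f_inv_into_f[of "snd p" "f (fst p)" "{0..}"]
    by (auto simp: g_def)
  have cl: "continuous_on (U \<times> {0..}) (\<lambda>p. snd p - f (fst p) l)" if "0 \<le> l" for l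
  proof -
    have "continuous_on (U \<times> {0::real..}) (\<lambda>p. (fst p, l))" by (intro continuous_intros)
    moreover have "(\<lambda>p. (fst p, l)) ` (U \<times> {0..}) \<subseteq> U \<times> {0..}" using that by auto
    ultimately have "continuous_on (U \<times> {0::real..}) (\<lambda>p. (\<lambda>(a, R). f a R) (fst p, l))"
      by (rule continuous_on_compose2[OF cf])
    then have "continuous_on (U \<times> {0::real..}) (\<lambda>p. f (fst p) l)" by simp
    then show ?thesis by (intro continuous_intros)
  qed
  have "continuous_on (U \<times> {0..}) g"
    unfolding continuous_on_def
  proof (intro ballI order_tendstoI)
    fix p0 l assume p0: "p0 \<in> U \<times> {0..}" and l: "l < g p0"
    have nn: "\<forall>\<^sub>F p in at p0 within U \<times> {0..}. p \<in> U \<times> {0..}" by (simp add: eventually_at_topological) blast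
    show "\<forall>\<^sub>F p in at p0 within U \<times> {0..}. l < g p"
    proof (cases "0 \<le> l")
      case False show ?thesis by (rule eventually_mono[OF nn]) (use g0 False in force)
    next
      case True
      have "0 < snd p0 - f (fst p0) l"
        using strict_mono_onD[OF mono[of "fst p0"], of l "g p0"] fg[OF p0] p0 True l by auto
      moreover have "((\<lambda>p. snd p - f (fst p) l) \<longlongrightarrow> snd p0 - f (fst p0) l) (at p0 within U \<times> {0..})"
        using cl[OF True] p0 unfolding continuous_on_def by (rule bspec)
      ultimately have "\<forall>\<^sub>F p in at p0 within U \<times> {0..}. 0 < snd p - f (fst p) l"
        by (rule order_tendstoD(1)[rotated])
      then show ?thesis using nn
      proof eventually_elim
        case (elim p)
        then have "f (fst p) l < f (fst p) (g p)" using fg by simp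
        then show "l < g p" using strict_mono_on_less[OF mono[of "fst p"], of l "g p"] elim(2) g0[OF elim(2)] True by auto
      qed
    qed
  next
    fix p0 l assume p0: "p0 \<in> U \<times> {0..}" and l: "g p0 < l"
    have nn: "\<forall>\<^sub>F p in at p0 within U \<times> {0..}. p \<in> U \<times> {0..}" by (simp add: eventually_at_topological) blast
    have l0: "0 \<le> l" using g0[OF p0] l by simp
    have "snd p0 - f (fst p0) l < 0"
      using strict_mono_onD[OF mono[of "fst p0"], of "g p0" l] fg[OF p0] g0[OF p0] p0 l0 l by auto
    moreover have "((\<lambda>p. snd p - f (fst p) l) \<longlongrightarrow> snd p0 - f (fst p0) l) (at p0 within U \<times> {0..})"
      using cl[OF l0] p0 unfolding continuous_on_def by (rule bspec)
    ultimately have "\<forall>\<^sub>F p in at p0 within U \<times> {0..}. snd p - f (fst p) l < 0"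
      by (rule order_tendstoD(2)[rotated])
    then show "\<forall>\<^sub>F p in at p0 within U \<times> {0..}. g p < l" using nn
    proof eventually_elim
      case (elim p)
      then have "f (fst p) (g p) < f (fst p) l" using fg by simp
      then show "g p < l" using strict_mono_on_less[OF mono[of "fst p"], of "g p" l] elim(2) g0[OF elim(2)] l0 by auto
    qed
  qed
  then show ?thesis by (simp add: g_def[abs_def] case_prod_beta)
qed

text \<open>The time is now \<open>R = e\<^sup>\<zeta>\<close>, in which the metric is smooth up to the singular orbit:
  \<open>R\<^sup>2 mS = s\<close>, \<open>mth = F z / (x y)\<close>, \<open>ml = z\<^sup>2 / y\<^sup>2\<close>, \<open>my = y\<close>, and \<open>mt\<close> is the arclength \<open>t\<close>.\<close>

definition "mS u R = fst (u (R\<^sup>2))" for u :: "real \<Rightarrow> real \<times> real \<times> real" and R :: real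
definition "md u R = snd (snd (u (R\<^sup>2)))" for u :: "real \<Rightarrow> real \<times> real \<times> real" and R :: real
definition "mQ u R = fst (snd (u (R\<^sup>2))) - md u R / 2" for u :: "real \<Rightarrow> real \<times> real \<times> real" and R :: real
definition "mP q u R = md u R + cq q * mS u R"
definition "mth u R = 1 - R\<^sup>2 * mQ u R"
definition "ml q u R = 1 + R\<^sup>2 * mP q u R"
text \<open>R times this is the logarithmic derivative of y with respect to R. The primitive starts
  at 0, which normalises the singular orbit to y = z = 1.\<close>

definition "mpsi q u R = mP q u R + mS u R - q * mth u R * mS u R"
definition "mlny q u R = integral {0..R} (\<lambda>\<rho>. \<rho> * mpsi q u \<rho>)"
definition "my q u R = exp (mlny q u R)"
text \<open>This is dt / dR: from d zeta = y / (x z) dt and R = exp zeta one gets dt / dR = x z / (y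
  R), and the factor R in x cancels.\<close>

definition "mspeed q u R = my q u R * (sqrt (mS u R) * sqrt (ml q u R))"
definition "mt q u R = integral {0..R} (mspeed q u)"

definition met :: "real \<Rightarrow> (real \<Rightarrow> real \<times> real \<times> real) \<Rightarrow> real \<Rightarrow> real \<times> real \<times> real \<times> real" where
  "met q u R = (R * my q u R * sqrt (mS u R), my q u R, my q u R * sqrt (ml q u R),
     mth u R * R * my q u R * sqrt (mS u R) / sqrt (ml q u R))"

text \<open>The velocity with respect to arclength, with all quotients by R cancelled. In this form
  it is continuous up to R = 0, which is what makes the jet extend to the singular orbit.\<close>

definition vel :: "real \<Rightarrow> (real \<Rightarrow> real \<times> real \<times> real) \<Rightarrow> real \<Rightarrow> real \<times> real \<times> real \<times> real" where
  "vel q u R = ((1 + ml q u R - R\<^sup>2 * mS u R - mth u R) / sqrt (ml q u R),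
     R * mpsi q u R / (sqrt (mS u R) * sqrt (ml q u R)),
     R * ((mS u R - mP q u R) / sqrt (mS u R) + (1 + q) * mth u R * sqrt (mS u R) / ml q u R),
     (mth u R)\<^sup>2 / ml q u R * (1 + q * R\<^sup>2 * mS u R - (1 + q) * R\<^sup>2 * mS u R / ml q u R))"

text \<open>Common form of the Spin(7) equations in both cases. In the equation of F the
  coefficients 1, q, - (1 + q) sum to zero, reflecting that the three original ones are proportional
  to k + l, - l, - k.\<close>

fun mfield :: "real \<Rightarrow> real \<times> real \<times> real \<times> real \<Rightarrow> real \<times> real \<times> real \<times> real" where
  "mfield q (x, y, z, F) =
    (y / z + z / y - x\<^sup>2 / (y * z) - F / x,
     z / x + x / z - y\<^sup>2 / (x * z) - q * F / y,
     x / y + y / x - z\<^sup>2 / (x * y) + (1 + q) * F / z,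
     F\<^sup>2 * (1 / x\<^sup>2 + q / y\<^sup>2 - (1 + q) / z\<^sup>2))"

text \<open>Here x, l and h stand for the square roots of S and L and for \<theta>. Taking the roots
  as variables leaves purely rational identities.\<close>

lemma mfield_normal_form:
  fixes x l y R h q :: real
  assumes "0 < x" "0 < l" "0 < y" "0 < R" "0 < h"
  shows "mfield q (R * y * x, y, y * l, h * R * y * x / l) =
    ((1 + l\<^sup>2 - R\<^sup>2 * x\<^sup>2 - h) / l,
     R * ((l\<^sup>2 - 1) / R\<^sup>2 + x\<^sup>2 - q * h * x\<^sup>2) / (x * l),
     R * ((x\<^sup>2 - (l\<^sup>2 - 1) / R\<^sup>2) / x + (1 + q) * h * x / l\<^sup>2),
     h\<^sup>2 / l\<^sup>2 * (1 + q * R\<^sup>2 * x\<^sup>2 - (1 + q) * R\<^sup>2 * x\<^sup>2 / l\<^sup>2))"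
proof -
  have A: "y / (y * l) + y * l / y - (R * y * x)\<^sup>2 / (y * (y * l)) - h * R * y * x / l / (R * y * x) = (1 + l\<^sup>2 - R\<^sup>2 * x\<^sup>2 - h) / l"
    using assms by (simp add: field_simps power2_eq_square)
  have B: "y * l / (R * y * x) + R * y * x / (y * l) - y\<^sup>2 / (R * y * x * (y * l)) - q * (h * R * y * x / l) / y = R * ((l\<^sup>2 - 1) / R\<^sup>2 + x\<^sup>2 - q * h * x\<^sup>2) / (x * l)"
    using assms by (simp add: field_simps power2_eq_square)
  have C: "R * y * x / y + y / (R * y * x) - (y * l)\<^sup>2 / (R * y * x * y) + (1 + q) * (h * R * y * x / l) / (y * l) = R * ((x\<^sup>2 - (l\<^sup>2 - 1) / R\<^sup>2) / x + (1 + q) * h * x / l\<^sup>2)"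
    using assms by (simp add: field_simps power2_eq_square)
  have "(h * R * y * x / l)\<^sup>2 = h\<^sup>2 / l\<^sup>2 * (R * y * x)\<^sup>2" by (simp add: power_divide power_mult_distrib)
  moreover have "(R * y * x)\<^sup>2 * (1 / (R * y * x)\<^sup>2 + q / y\<^sup>2 - (1 + q) / (y * l)\<^sup>2) =
      1 + q * R\<^sup>2 * x\<^sup>2 - (1 + q) * R\<^sup>2 * x\<^sup>2 / l\<^sup>2"
  proof -
    have "(R * y * x)\<^sup>2 * (1 / (R * y * x)\<^sup>2) = 1" "(R * y * x)\<^sup>2 * (q / y\<^sup>2) = q * R\<^sup>2 * x\<^sup>2"
      "(R * y * x)\<^sup>2 * ((1 + q) / (y * l)\<^sup>2) = (1 + q) * R\<^sup>2 * x\<^sup>2 / l\<^sup>2"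
      using assms by (simp_all add: power_mult_distrib)
    then show ?thesis by (simp only: distrib_left right_diff_distrib)
  qed
  ultimately have "(h * R * y * x / l)\<^sup>2 * (1 / (R * y * x)\<^sup>2 + q / y\<^sup>2 - (1 + q) / (y * l)\<^sup>2) =
      h\<^sup>2 / l\<^sup>2 * (1 + q * R\<^sup>2 * x\<^sup>2 - (1 + q) * R\<^sup>2 * x\<^sup>2 / l\<^sup>2)"
    by (simp only: mult.assoc)
  with A B C show ?thesis by (simp only: mfield.simps)
qed

locale profile =
  fixes q S0 Q0 :: real and u :: "real \<Rightarrow> real \<times> real \<times> real"
  assumes q: "- 1 / 2 < q" "q < 1" and ic: "0 < S0" "0 < Q0" and prof: "is_profile q S0 Q0 u"
begin

lemma u_cont: "continuous_on {0..} u" and u_0: "u 0 = (S0, Q0, 0)"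
  and u_der: "0 < T \<Longrightarrow> (u has_vector_derivative pfield q T (u T) - (0, 0, 3 * snd (snd (u T)) / T)) (at T)"
  using prof by (auto simp: is_profile_def)

lemma seg: "0 < \<tau> \<Longrightarrow> profile_segment q \<tau> (\<lambda>T. fst (u T)) (\<lambda>T. fst (snd (u T))) (\<lambda>T. snd (snd (u T)))"
  by (rule is_profile_segment[OF q ic prof])

lemma region:
  assumes "0 \<le> R"
  shows "0 < mS u R" "R\<^sup>2 * mS u R < 1" "0 < mQ u R" "0 < mth u R" "mth u R \<le> 1"
    "0 < mP q u R" "R\<^sup>2 * mP q u R \<le> 3" "1 \<le> ml q u R" "cq q * mS u R * mth u R \<le> mP q u R"
proof -
  \<comment> \<open>The end point lies strictly beyond \<open>R\<^sup>2\<close>, and is positive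
    even for R = 0.\<close>
  interpret profile_segment q "R\<^sup>2 + 1" "\<lambda>T. fst (u T)" "\<lambda>T. fst (snd (u T))" "\<lambda>T. snd (snd (u T))"
    by (rule seg) (simp add: add_nonneg_pos)
  have R: "R\<^sup>2 \<in> {0..R\<^sup>2 + 1}" by simp
  have eqs: "mQ u R = Q (R\<^sup>2)" "mth u R = \<theta> (R\<^sup>2)" "mP q u R = P (R\<^sup>2)"
    by (simp_all add: mQ_def md_def Q_def mth_def \<theta>_def mP_def P_def mS_def)
  show "0 < mS u R" "R\<^sup>2 * mS u R < 1" using S_pos[OF R] s_less_1[OF R] by (simp_all add: mS_def)
  show "0 < mQ u R" "0 < mth u R" "mth u R \<le> 1" "0 < mP q u R" "R\<^sup>2 * mP q u R \<le> 3"
    "cq q * mS u R * mth u R \<le> mP q u R"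
    unfolding eqs using Q_pos[OF R] th_pos[OF R] th_le[OF R] P_pos[OF R] p_le[OF R] P_ge[OF R]
    by (simp_all add: mS_def)
  then show "1 \<le> ml q u R" by (simp add: ml_def)
qed

lemma profile_derivatives:
  assumes R: "0 < R"
  shows "(mS u has_real_derivative 2 * R * (mS u R * (mQ u R - 2 * mS u R + q * mS u R * mth u R))) (at R)"
    and "(mth u has_real_derivative 2 * R * (mth u R * (- mQ u R - 3 / 2 * md u R - R\<^sup>2 * q * mS u R * mQ u R))) (at R)"
    and "(ml q u has_real_derivative (- 4 * ml q u R * (R\<^sup>2 * mP q u R)
      + 2 * mth u R * (R\<^sup>2 * mS u R) * (1 + 2 * q + q * (R\<^sup>2 * mP q u R))) / R) (at R)"
proof -
  interpret profile_segment q "R\<^sup>2 + 1" "\<lambda>T. fst (u T)" "\<lambda>T. fst (snd (u T))" "\<lambda>T. snd (snd (u T))"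
    by (rule seg) (simp add: add_nonneg_pos)
  have R': "0 < R\<^sup>2" "R\<^sup>2 < R\<^sup>2 + 1" using R by auto
  have eqs: "mQ u R = Q (R\<^sup>2)" "mth u R = \<theta> (R\<^sup>2)" "mP q u R = P (R\<^sup>2)" "mS u R = fst (u (R\<^sup>2))" "md u R = snd (snd (u (R\<^sup>2)))" for R
    by (simp_all add: mQ_def md_def Q_def mth_def \<theta>_def mP_def P_def mS_def)
  have sq: "((\<lambda>R. R\<^sup>2) has_real_derivative 2 * R) (at R)" by (auto intro!: derivative_eq_intros)
  show "(mS u has_real_derivative 2 * R * (mS u R * (mQ u R - 2 * mS u R + q * mS u R * mth u R))) (at R)"
    using DERIV_chain2[OF dS[OF R'] sq] by (simp add: eqs[abs_def] fS_def Q_def \<theta>_def mult_ac)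
  show "(mth u has_real_derivative 2 * R * (mth u R * (- mQ u R - 3 / 2 * md u R - R\<^sup>2 * q * mS u R * mQ u R))) (at R)"
    using DERIV_chain2[OF dth[OF R'] sq] by (simp add: eqs[abs_def] mult_ac)
  have "(ml q u has_real_derivative (- 4 * (1 + R\<^sup>2 * P (R\<^sup>2)) * (R\<^sup>2 * P (R\<^sup>2)) +
      2 * \<theta> (R\<^sup>2) * (R\<^sup>2 * fst (u (R\<^sup>2))) * (1 + 2 * q + q * (R\<^sup>2 * P (R\<^sup>2)))) / (2 * R\<^sup>2) * (2 * R)) (at R)"
    using DERIV_add[OF DERIV_const DERIV_chain2[OF dp[OF R'] sq], of 1] by (simp add: ml_def[abs_def] eqs)
  then show "(ml q u has_real_derivative (- 4 * ml q u R * (R\<^sup>2 * mP q u R)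
      + 2 * mth u R * (R\<^sup>2 * mS u R) * (1 + 2 * q + q * (R\<^sup>2 * mP q u R))) / R) (at R)"
    by (rule DERIV_cong) (use R in \<open>simp add: ml_def eqs power2_eq_square\<close>)
qed

end

lemma continuous_on_m_basic:
  assumes "continuous_on (U \<times> {0..}) (\<lambda>(a, T). u a T)"
  shows "continuous_on (U \<times> {0..}) (\<lambda>p. mS (u (fst p)) (snd p))"
    "continuous_on (U \<times> {0..}) (\<lambda>p. md (u (fst p)) (snd p))"
    "continuous_on (U \<times> {0..}) (\<lambda>p. mQ (u (fst p)) (snd p))"
    "continuous_on (U \<times> {0..}) (\<lambda>p. mth (u (fst p)) (snd p))"
    "continuous_on (U \<times> {0..}) (\<lambda>p. mP q (u (fst p)) (snd p))"
    "continuous_on (U \<times> {0..}) (\<lambda>p. ml q (u (fst p)) (snd p))"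
    "continuous_on (U \<times> {0..}) (\<lambda>p. mpsi q (u (fst p)) (snd p))"
proof -
  have "continuous_on (U \<times> {0::real..}) (\<lambda>p. (fst p, (snd p)\<^sup>2))" by (intro continuous_intros)
  moreover have "(\<lambda>p. (fst p, (snd p)\<^sup>2)) ` (U \<times> {0..}) \<subseteq> U \<times> {0::real..}" by auto
  ultimately have "continuous_on (U \<times> {0..}) (\<lambda>p. (\<lambda>(a, T). u a T) (fst p, (snd p)\<^sup>2))"
    by (rule continuous_on_compose2[OF assms])
  then have c: "continuous_on (U \<times> {0..}) (\<lambda>p. u (fst p) ((snd p)\<^sup>2))" by simp
  show "continuous_on (U \<times> {0..}) (\<lambda>p. mS (u (fst p)) (snd p))"
    "continuous_on (U \<times> {0..}) (\<lambda>p. md (u (fst p)) (snd p))"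
    "continuous_on (U \<times> {0..}) (\<lambda>p. mQ (u (fst p)) (snd p))"
    "continuous_on (U \<times> {0..}) (\<lambda>p. mth (u (fst p)) (snd p))"
    "continuous_on (U \<times> {0..}) (\<lambda>p. mP q (u (fst p)) (snd p))"
    "continuous_on (U \<times> {0..}) (\<lambda>p. ml q (u (fst p)) (snd p))"
    "continuous_on (U \<times> {0..}) (\<lambda>p. mpsi q (u (fst p)) (snd p))"
    unfolding mpsi_def ml_def mP_def mth_def mQ_def md_def mS_def
    by (intro continuous_intros c; simp)+
qed

lemma continuous_on_m_derived:
  assumes c: "continuous_on (U \<times> {0..}) (\<lambda>(a, T). u a T)"
    and pr: "\<And>a. a \<in> U \<Longrightarrow> \<exists>S0 Q0. profile q S0 Q0 (u a)"
  shows "continuous_on (U \<times> {0..}) (\<lambda>p. my q (u (fst p)) (snd p))"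
    "continuous_on (U \<times> {0..}) (\<lambda>p. mspeed q (u (fst p)) (snd p))"
    "continuous_on (U \<times> {0..}) (\<lambda>(a, R). mt q (u a) R)"
    "continuous_on (U \<times> {0..}) (\<lambda>p. met q (u (fst p)) (snd p))"
    "continuous_on (U \<times> {0..}) (\<lambda>p. vel q (u (fst p)) (snd p))"
proof -
  note b = continuous_on_m_basic[OF c]
  have "continuous_on (U \<times> {0..}) (\<lambda>(a, R). integral {0..R} (\<lambda>\<rho>. \<rho> * mpsi q (u a) \<rho>))"
    by (rule continuous_on_indefinite_integral_param) (unfold case_prod_beta, intro continuous_intros b)
  then show y: "continuous_on (U \<times> {0..}) (\<lambda>p. my q (u (fst p)) (snd p))"
    unfolding my_def mlny_def case_prod_beta by (rule continuous_on_exp)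
  show sp: "continuous_on (U \<times> {0..}) (\<lambda>p. mspeed q (u (fst p)) (snd p))"
    unfolding mspeed_def by (intro continuous_intros b y)
  show "continuous_on (U \<times> {0..}) (\<lambda>(a, R). mt q (u a) R)"
    unfolding mt_def
    by (rule continuous_on_indefinite_integral_param) (use sp in \<open>simp add: case_prod_beta\<close>)
  have pos: "mS (u (fst p)) (snd p) \<noteq> 0" "ml q (u (fst p)) (snd p) \<noteq> 0" if p: "p \<in> U \<times> {0..}" for p
  proof -
    obtain S0 Q0 where "profile q S0 Q0 (u (fst p))" using pr[of "fst p"] p by (auto simp: mem_Times_iff)
    then interpret profile q S0 Q0 "u (fst p)" .
    show "mS (u (fst p)) (snd p) \<noteq> 0" "ml q (u (fst p)) (snd p) \<noteq> 0"
      using region(1,8)[of "snd p"] p by auto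
  qed
  show "continuous_on (U \<times> {0..}) (\<lambda>p. met q (u (fst p)) (snd p))"
    unfolding met_def by (intro continuous_intros b y) (use pos in auto)
  show "continuous_on (U \<times> {0..}) (\<lambda>p. vel q (u (fst p)) (snd p))"
    unfolding vel_def by (intro continuous_intros b y) (use pos in auto)
qed

context profile
begin

text \<open>A one-point parameter space, through which the joint continuity results specialise to a
  single profile.\<close>

lemma single_cont: "continuous_on ({0::real} \<times> {0..}) (\<lambda>(a, T). u T)"
  unfolding case_prod_beta by (intro continuous_on_compose2[OF u_cont] continuous_intros) auto

lemma conts:
  "continuous_on {0..} (mS u)" "continuous_on {0..} (md u)" "continuous_on {0..} (mQ u)" "continuous_on {0..} (mth u)"
  "continuous_on {0..} (mP q u)" "continuous_on {0..} (ml q u)" "continuous_on {0..} (mpsi q u)"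
  "continuous_on {0..} (my q u)" "continuous_on {0..} (mspeed q u)" "continuous_on {0..} (mt q u)"
  "continuous_on {0..} (met q u)" "continuous_on {0..} (vel q u)"
proof -
  have ex: "\<exists>S0 Q0. profile q S0 Q0 u" using profile_axioms by blast
  have sl: "continuous_on {0..} (\<lambda>R. f R)" if "continuous_on ({0::real} \<times> {0..}) (\<lambda>p. f (snd p))" for f :: "real \<Rightarrow> 'b::topological_space"
    by (rule continuous_on_slice[of "{0::real}" "{0..}" "\<lambda>_. f"]) (use that in \<open>auto simp: case_prod_beta\<close>)
  note b = continuous_on_m_basic[of "{0::real}" "\<lambda>_. u", OF single_cont]
    continuous_on_m_derived[of "{0::real}" "\<lambda>_. u" q, OF single_cont ex, unfolded case_prod_beta]
  show "continuous_on {0..} (mS u)" "continuous_on {0..} (md u)" "continuous_on {0..} (mQ u)" "continuous_on {0..} (mth u)"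
  "continuous_on {0..} (mP q u)" "continuous_on {0..} (ml q u)" "continuous_on {0..} (mpsi q u)"
  "continuous_on {0..} (my q u)" "continuous_on {0..} (mspeed q u)" "continuous_on {0..} (mt q u)"
  "continuous_on {0..} (met q u)" "continuous_on {0..} (vel q u)"
    by (intro sl b)+
qed

lemma integral_derivative:
  assumes "continuous_on {0..} g" "0 < R"
  shows "((\<lambda>R. integral {0..R} g) has_real_derivative g R) (at R)"
proof -
  have "((\<lambda>T. integral {0..T} g) has_real_derivative g R) (at R within {0..R + 1})"
    by (rule integral_has_real_derivative) (use assms in \<open>auto intro: continuous_on_subset\<close>)
  then show ?thesis using assms by (simp add: at_within_Icc_at)
qed

lemma my_deriv: "0 < R \<Longrightarrow> (my q u has_real_derivative my q u R * (R * mpsi q u R)) (at R)"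
  unfolding my_def[abs_def] mlny_def
  by (rule DERIV_fun_exp, rule integral_derivative[of "\<lambda>\<rho>. \<rho> * mpsi q u \<rho>"]) (intro continuous_intros conts)

lemma mt_deriv: "0 < R \<Longrightarrow> (mt q u has_real_derivative mspeed q u R) (at R)"
  unfolding mt_def[abs_def] by (rule integral_derivative[OF conts(9)])

lemma my_pos: "0 < my q u R" by (simp add: my_def)

lemma mspeed_pos: "0 \<le> R \<Longrightarrow> 0 < mspeed q u R"
  using region(1,8)[of R] my_pos[of R] by (auto simp: mspeed_def)

lemma mt_0: "mt q u 0 = 0" and my_0: "my q u 0 = 1"
  by (simp_all add: mt_def my_def mlny_def)

lemma mt_strict_mono: "strict_mono_on {0..} (mt q u)"
proof (rule strict_mono_onI)
  fix r s :: real assume rs: "r \<in> {0..}" "s \<in> {0..}" "r < s"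
  show "mt q u r < mt q u s"
  proof (rule DERIV_pos_imp_increasing_open[OF rs(3)])
    show "continuous_on {r..s} (mt q u)" by (rule continuous_on_subset[OF conts(10)]) (use rs in auto)
    fix x assume "r < x" "x < s"
    then show "\<exists>y. (mt q u has_real_derivative y) (at x) \<and> 0 < y"
      using mt_deriv[of x] mspeed_pos[of x] rs by auto
  qed
qed

lemma met_pos: "0 < R \<Longrightarrow> all_pos (met q u R)"
  using region(1,4,8)[of R] my_pos[of R] by (auto simp: met_def)

lemma vel_eq:
  assumes R: "0 < R"
  shows "mfield q (met q u R) = vel q u R"
proof -
  define x l where "x = sqrt (mS u R)" and "l = sqrt (ml q u R)"
  have pos: "0 < x" "0 < l" "0 < my q u R" "0 < mth u R"
    using region(1,4,8)[of R] R my_pos by (auto simp: x_def l_def)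
  have sq: "mS u R = x\<^sup>2" "ml q u R = l\<^sup>2"
    using region(1,8)[of R] R by (auto simp: x_def l_def)
  have P: "mP q u R = (l\<^sup>2 - 1) / R\<^sup>2" using sq(2) R by (simp add: ml_def field_simps)
  have rt: "sqrt (x\<^sup>2) = x" "sqrt (l\<^sup>2) = l" using pos by auto
  show ?thesis
    unfolding met_def vel_def mpsi_def P sq rt by (rule mfield_normal_form[OF pos(1,2,3) R pos(4)])
qed

text \<open>Combined with \<open>vel_eq\<close> and dt / dR = \<open>mspeed\<close>, this says that
  the curve solves the Spin(7) equations once it is parametrised by arclength.\<close>

lemma met_deriv:
  assumes R: "0 < R"
  shows "(met q u has_vector_derivative mspeed q u R *\<^sub>R vel q u R) (at R)"
proof -
  define x l where "x = (\<lambda>R. sqrt (mS u R))" and "l = (\<lambda>R. sqrt (ml q u R))"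
  have pos: "0 < x R" "0 < l R" "0 < my q u R" "0 < mth u R"
    using region(1,4,8)[of R] R my_pos by (auto simp: x_def l_def)
  have sq: "mS u R = (x R)\<^sup>2" "ml q u R = (l R)\<^sup>2"
    using region(1,8)[of R] R by (auto simp: x_def l_def)
  have P: "mP q u R = ((l R)\<^sup>2 - 1) / R\<^sup>2" using sq(2) R by (simp add: ml_def field_simps)
  have d: "md u R = ((l R)\<^sup>2 - 1) / R\<^sup>2 - cq q * (x R)\<^sup>2" using P by (simp add: mP_def sq)
  have Q: "mQ u R = (1 - mth u R) / R\<^sup>2" using R by (simp add: mth_def)
  have dx: "(x has_real_derivative R * x R * (mQ u R - 2 * (x R)\<^sup>2 + q * (x R)\<^sup>2 * mth u R)) (at R)"
    unfolding x_def
    by (rule DERIV_cong[OF DERIV_chain2[OF DERIV_real_sqrt profile_derivatives(1)[OF R]]])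
      (use region(1)[of R] R in \<open>auto simp: field_simps\<close>)
  have dl: "(l has_real_derivative (- 2 * (l R)\<^sup>2 * ((l R)\<^sup>2 - 1)
      + mth u R * (R\<^sup>2 * (x R)\<^sup>2) * (1 + 2 * q + q * ((l R)\<^sup>2 - 1))) / (R * l R)) (at R)"
    unfolding l_def
  proof (rule DERIV_cong[OF DERIV_chain2[OF DERIV_real_sqrt profile_derivatives(3)[OF R]]])
    have e: "R\<^sup>2 * mP q u R = (l R)\<^sup>2 - 1" "sqrt (ml q u R) = l R" using sq(2) by (simp_all add: ml_def l_def)
    show "inverse (sqrt (ml q u R)) / 2 * ((- 4 * ml q u R * (R\<^sup>2 * mP q u R)
      + 2 * mth u R * (R\<^sup>2 * mS u R) * (1 + 2 * q + q * (R\<^sup>2 * mP q u R))) / R) =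
      (- 2 * (sqrt (ml q u R))\<^sup>2 * ((sqrt (ml q u R))\<^sup>2 - 1)
      + mth u R * (R\<^sup>2 * (x R)\<^sup>2) * (1 + 2 * q + q * ((sqrt (ml q u R))\<^sup>2 - 1))) / (R * sqrt (ml q u R))"
      unfolding e sq using pos R by (simp add: field_simps power2_eq_square)
  qed (use region(8)[of R] R in auto)
  have dth: "(mth u has_real_derivative 2 * R * (mth u R * (- mQ u R - 3 / 2 * md u R - R\<^sup>2 * q * (x R)\<^sup>2 * mQ u R))) (at R)"
    using profile_derivatives(2)[OF R] by (simp add: sq)
  note ders = dx dl dth my_deriv[OF R]
  have met': "met q u = (\<lambda>R. (R * my q u R * x R, my q u R, my q u R * l R, mth u R * R * my q u R * x R / l R))"
    by (rule ext) (simp add: met_def x_def l_def)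
  have sp: "mspeed q u R = my q u R * (x R * l R)" by (simp add: mspeed_def x_def l_def)
  have v: "vel q u R = ((1 + (l R)\<^sup>2 - R\<^sup>2 * (x R)\<^sup>2 - mth u R) / l R,
     R * mpsi q u R / (x R * l R),
     R * (((x R)\<^sup>2 - mP q u R) / x R + (1 + q) * mth u R * x R / (l R)\<^sup>2),
     (mth u R)\<^sup>2 / (l R)\<^sup>2 * (1 + q * R\<^sup>2 * (x R)\<^sup>2 - (1 + q) * R\<^sup>2 * (x R)\<^sup>2 / (l R)\<^sup>2))"
    unfolding vel_def sq using pos by simp
  have psi: "mpsi q u R = mP q u R + (x R)\<^sup>2 - q * mth u R * (x R)\<^sup>2" by (simp add: mpsi_def sq)
  show ?thesis
    unfolding met' v sp scaleR_Pair
  proof (intro has_vector_derivative_Pair; (fold has_real_derivative_iff_has_vector_derivative)?)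
    show "((\<lambda>R. R * my q u R * x R) has_real_derivative (my q u R * (x R * l R)) *\<^sub>R ((1 + (l R)\<^sup>2 - R\<^sup>2 * (x R)\<^sup>2 - mth u R) / l R)) (at R)"
      by (rule derivative_eq_intros ders refl)+
        (use pos R in \<open>simp add: psi P Q field_simps power2_eq_square\<close>)
    show "(my q u has_real_derivative (my q u R * (x R * l R)) *\<^sub>R (R * mpsi q u R / (x R * l R))) (at R)"
      by (rule DERIV_cong[OF my_deriv[OF R]]) (use pos R in simp)
    show "((\<lambda>R. my q u R * l R) has_real_derivative (my q u R * (x R * l R)) *\<^sub>R (R * (((x R)\<^sup>2 - mP q u R) / x R + (1 + q) * mth u R * x R / (l R)\<^sup>2))) (at R)"
      by (rule derivative_eq_intros ders refl)+
        (use pos R in \<open>simp add: psi P field_simps power2_eq_square\<close>)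
    show "((\<lambda>R. mth u R * R * my q u R * x R / l R) has_real_derivative (my q u R * (x R * l R)) *\<^sub>R
        ((mth u R)\<^sup>2 / (l R)\<^sup>2 * (1 + q * R\<^sup>2 * (x R)\<^sup>2 - (1 + q) * R\<^sup>2 * (x R)\<^sup>2 / (l R)\<^sup>2))) (at R)"
    proof -
      \<comment> \<open>Each derivative is written as the function times its logarithmic derivative,
        so that the quotient to be differentiated contributes a sum and the identity d2 concerns
        logarithmic derivatives only.\<close>
      obtain x' l' h' where x': "(x has_real_derivative x') (at R)" "x' = x R * (R * (mQ u R - 2 * (x R)\<^sup>2 + q * (x R)\<^sup>2 * mth u R))"
        and l': "(l has_real_derivative l') (at R)" "l' = l R * ((- 2 * ((l R)\<^sup>2 - 1)
           + mth u R * (R\<^sup>2 * (x R)\<^sup>2) * (1 + 2 * q + q * ((l R)\<^sup>2 - 1)) / (l R)\<^sup>2) / R)"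
        and h': "(mth u has_real_derivative h') (at R)" "h' = mth u R * (2 * R * (- mQ u R - 3 / 2 * md u R - R\<^sup>2 * q * (x R)\<^sup>2 * mQ u R))"
        using dx dl dth pos R by (auto intro!: that[OF dx _ dl _ dth] simp: field_simps power2_eq_square)
      have d1: "((\<lambda>R. mth u R * R * my q u R * x R / l R) has_real_derivative
          mth u R * R * my q u R * x R / l R * (h' / mth u R + 1 / R + R * mpsi q u R + x' / x R - l' / l R)) (at R)"
        by (rule derivative_eq_intros x' l' h' my_deriv[OF R] refl)+
          (use pos R in \<open>simp_all add: field_simps\<close>)
      have d2: "h' / mth u R + 1 / R + R * mpsi q u R + x' / x R - l' / l R =
         mth u R / R * (1 + q * R\<^sup>2 * (x R)\<^sup>2 - (1 + q) * R\<^sup>2 * (x R)\<^sup>2 / (l R)\<^sup>2)"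
        unfolding x'(2) l'(2) h'(2)
        using pos R by (simp add: psi P Q d cq_def) (simp add: field_simps power2_eq_square)
      show ?thesis
        by (rule DERIV_cong[OF d1]) (use pos R in \<open>simp add: d2 power2_eq_square\<close>)
    qed
  qed
qed

end

section \<open>Completeness and asymptotics\<close>

text \<open>Once e < a, integrating the inequality gives g \<le> a / 2 + K / R^2. In the variable
  zeta = ln R this is exponential damping with rate 2 against a forcing that tends to 0.\<close>

lemma tendsto_zero_by_weighted_derivative:
  fixes g e :: "real \<Rightarrow> real"
  assumes g0: "\<And>R. 1 \<le> R \<Longrightarrow> 0 \<le> g R"
    and der: "\<And>R. 1 \<le> R \<Longrightarrow> \<exists>D. ((\<lambda>R. R\<^sup>2 * g R) has_real_derivative D) (at R) \<and> D \<le> e R * R"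
    and e: "(e \<longlongrightarrow> 0) at_top"
  shows "(g \<longlongrightarrow> 0) at_top"
proof (rule order_tendstoI)
  fix a :: real assume "a < 0"
  show "\<forall>\<^sub>F R in at_top. a < g R"
    by (rule eventually_mono[OF eventually_ge_at_top[of 1]]) (use g0 \<open>a < 0\<close> in force)
next
  fix a :: real assume a: "0 < a"
  obtain R1 where R1: "1 \<le> R1" "\<And>R. R1 \<le> R \<Longrightarrow> e R < a"
    using order_tendstoD(2)[OF e a] unfolding eventually_at_top_linorder by (metis linorder_le_cases order_trans)
  define K where "K = R1\<^sup>2 * g R1 - a * R1\<^sup>2 / 2"
  have K: "R\<^sup>2 * g R - a * R\<^sup>2 / 2 \<le> K" if R: "R1 \<le> R" for R
    unfolding K_def
  proof (rule DERIV_nonpos_imp_nonincreasing[OF R])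
    fix r assume r: "R1 \<le> r" "r \<le> R"
    then obtain D where D: "((\<lambda>R. R\<^sup>2 * g R) has_real_derivative D) (at r)" "D \<le> e r * r"
      using der[of r] R1 by auto
    have "((\<lambda>R. R\<^sup>2 * g R - a * R\<^sup>2 / 2) has_real_derivative D - a * r) (at r)"
      by (rule derivative_eq_intros D refl | simp)+
    moreover have "e r * r \<le> a * r" using R1(2)[OF r(1)] R1(1) r by (intro mult_right_mono) auto
    ultimately show "\<exists>y. ((\<lambda>R. R\<^sup>2 * g R - a * R\<^sup>2 / 2) has_real_derivative y) (at r) \<and> y \<le> 0"
      using D(2) by (intro exI[of _ "D - a * r"]) auto
  qed
  have "\<forall>\<^sub>F R in at_top. 2 * \<bar>K\<bar> / a < R\<^sup>2"
  proof -
    have "filterlim (\<lambda>R::real. R\<^sup>2) at_top at_top" by (rule filterlim_pow_at_top) (auto simp: filterlim_ident)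
    then show ?thesis by (simp add: filterlim_at_top_dense)
  qed
  then show "\<forall>\<^sub>F R in at_top. g R < a"
    using eventually_ge_at_top[of R1]
  proof eventually_elim
    case (elim R)
    then have "2 * \<bar>K\<bar> < a * R\<^sup>2" using a by (simp add: field_simps)
    then have "R\<^sup>2 * g R < R\<^sup>2 * a" using K[OF elim(2)] by (simp add: algebra_simps)
    then show "g R < a" using mult_less_cancel_left_pos[of "R\<^sup>2" "g R" a] R1(1) elim(2) by auto
  qed
qed

lemma decreasing_bounded_tendsto_at_top:
  fixes G :: "real \<Rightarrow> real"
  assumes dec: "\<And>x y. 1 \<le> x \<Longrightarrow> x \<le> y \<Longrightarrow> G y \<le> G x" and bd: "\<And>x. 1 \<le> x \<Longrightarrow> B \<le> G x"
  obtains L where "(G \<longlongrightarrow> L) at_top"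
proof -
  have bb: "bdd_below (G ` {1..})" using bd by (auto simp: bdd_below_def)
  define L where "L = Inf (G ` {1..})"
  have "(G \<longlongrightarrow> L) at_top"
  proof (rule order_tendstoI)
    fix a assume "a < L"
    show "\<forall>\<^sub>F x in at_top. a < G x"
      by (rule eventually_mono[OF eventually_ge_at_top[of 1]]) (use cInf_lower[OF _ bb] \<open>a < L\<close> in \<open>force simp: L_def\<close>)
  next
    fix a assume "L < a"
    then obtain x where x: "1 \<le> x" "G x < a"
      using cInf_lessD[of "G ` {1..}" a] by (auto simp: L_def)
    show "\<forall>\<^sub>F y in at_top. G y < a"
      by (rule eventually_mono[OF eventually_ge_at_top[of x]]) (use dec[OF x(1)] x(2) in force)
  qed
  then show thesis by (rule that)
qed

context profile
begin

lemma th_deriv: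
  assumes "0 < R"
  shows "(mth u has_real_derivative mth u R / R * (2 * mth u R * (1 + q * (R\<^sup>2 * mS u R)) + R\<^sup>2 * mS u R - 2 - 3 * (R\<^sup>2 * mP q u R))) (at R)"
proof (rule DERIV_cong[OF profile_derivatives(2)[OF assms]])
  have d: "md u R = mP q u R - cq q * mS u R" by (simp add: mP_def)
  show "2 * R * (mth u R * (- mQ u R - 3 / 2 * md u R - R\<^sup>2 * q * mS u R * mQ u R)) =
    mth u R / R * (2 * mth u R * (1 + q * (R\<^sup>2 * mS u R)) + R\<^sup>2 * mS u R - 2 - 3 * (R\<^sup>2 * mP q u R))"
    using assms unfolding d cq_def by (simp add: mth_def field_simps power2_eq_square)
qed

lemma s_deriv:
  assumes "0 < R"
  shows "((\<lambda>R. R\<^sup>2 * mS u R) has_real_derivative 2 / R * (R\<^sup>2 * mS u R) * (2 * (1 - R\<^sup>2 * mS u R) - mth u R * (1 - q * (R\<^sup>2 * mS u R)))) (at R)"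
  by (rule derivative_eq_intros profile_derivatives(1)[OF assms] refl)+
    (use assms in \<open>simp add: mth_def field_simps power2_eq_square\<close>)

text \<open>The invariant, in the form (1 + 2 q) s h \<le> 3 p, absorbs the term 2 q h s whatever
  the sign of q. What remains factors as - (1 - h) (2 - s), and s < 1 makes the second factor at
  least 1.\<close>

lemma th_deriv_le:
  assumes R: "0 < R"
  shows "mth u R / R * (2 * mth u R * (1 + q * (R\<^sup>2 * mS u R)) + R\<^sup>2 * mS u R - 2 - 3 * (R\<^sup>2 * mP q u R)) \<le> - (mth u R / R * (1 - mth u R))"
proof -
  note r = region[OF less_imp_le[OF R]]
  define s h p where "s = R\<^sup>2 * mS u R" and "h = mth u R" and "p = R\<^sup>2 * mP q u R"
  have "cq q * s * h \<le> p" using mult_left_mono[OF r(9), of "R\<^sup>2"] by (simp add: s_def h_def p_def algebra_simps)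
  then have 1: "(1 + 2 * q) * s * h \<le> 3 * p" by (simp add: cq_def)
  have "(1 - h) * 1 \<le> (1 - h) * (2 - s)" using r by (intro mult_left_mono) (auto simp: s_def h_def)
  then have "2 * h * (1 + q * s) + s - 2 - 3 * p \<le> - (1 - h)" using 1 by (simp add: algebra_simps)
  then have "h / R * (2 * h * (1 + q * s) + s - 2 - 3 * p) \<le> h / R * (- (1 - h))"
    using r(4) R by (intro mult_left_mono) (auto simp: h_def)
  then show ?thesis unfolding s_def h_def p_def mult_minus_right .
qed

lemma th_decreasing:
  assumes "0 < R" "R \<le> R'" shows "mth u R' \<le> mth u R"
proof (rule DERIV_nonpos_imp_nonincreasing[OF assms(2)])
  fix x assume x: "R \<le> x" "x \<le> R'"
  then have "0 < x" using assms by simp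
  moreover have "0 \<le> mth u x / x * (1 - mth u x)"
    using region(4,5)[of x] \<open>0 < x\<close> by simp
  ultimately show "\<exists>y. (mth u has_real_derivative y) (at x) \<and> y \<le> 0"
    using th_deriv[of x] th_deriv_le[of x] by (meson neg_le_0_iff_le order_trans)
qed

text \<open>As \<theta> decreases, 1 - \<theta> \<ge> \<kappa> for all R \<ge> 1; this makes
  \<kappa> a decay rate for \<theta> in the variable ln R.\<close>

definition "\<kappa> = 1 - mth u 1"

lemma kappa_pos: "0 < \<kappa>"
  using region(3)[of 1] by (simp add: \<kappa>_def mth_def)

lemma th_deriv_kappa:
  assumes R: "1 \<le> R"
  obtains D where "(mth u has_real_derivative D) (at R)" "D \<le> - \<kappa> * mth u R / R"
proof -
  have R0: "0 < R" using R by simp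
  have "mth u R / R * \<kappa> \<le> mth u R / R * (1 - mth u R)"
    using region(4)[of R] th_decreasing[OF _ R] R0 by (intro mult_left_mono) (auto simp: \<kappa>_def)
  then have "- (mth u R / R * (1 - mth u R)) \<le> - (mth u R / R * \<kappa>)" by (rule le_imp_neg_le)
  also have "- (mth u R / R * \<kappa>) = - \<kappa> * mth u R / R" by simp
  finally show thesis
    by (intro that[OF th_deriv[OF R0]] order_trans[OF th_deriv_le[OF R0]])
qed

lemma th_tendsto: "(mth u \<longlongrightarrow> 0) at_top"
proof (rule tendsto_sandwich)
  have le: "mth u R \<le> mth u 1 * exp (- \<kappa> * ln R)" if R: "1 \<le> R" for R
  proof -
    have "ln (mth u R) + \<kappa> * ln R \<le> ln (mth u 1) + \<kappa> * ln 1"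
    proof (rule DERIV_nonpos_imp_nonincreasing[OF R])
      fix x :: real assume x: "1 \<le> x" "x \<le> R"
      obtain D where D: "(mth u has_real_derivative D) (at x)" "D \<le> - \<kappa> * mth u x / x"
        using th_deriv_kappa[OF x(1)] by blast
      have p: "0 < mth u x" using region(4)[of x] x by simp
      have "((\<lambda>R. ln (mth u R) + \<kappa> * ln R) has_real_derivative D / mth u x + \<kappa> / x) (at x)"
        by (rule derivative_eq_intros D refl | use p x in \<open>simp\<close>)+
      moreover have "D / mth u x + \<kappa> / x \<le> 0" using D(2) p x by (simp add: field_simps)
      ultimately show "\<exists>y. ((\<lambda>R. ln (mth u R) + \<kappa> * ln R) has_real_derivative y) (at x) \<and> y \<le> 0" by blast
    qed
    then have "ln (mth u R) \<le> ln (mth u 1 * exp (- \<kappa> * ln R))"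
      using region(4)[of 1] by (simp add: ln_mult)
    then show ?thesis using region(4)[of 1] region(4)[of R] R by (simp add: ln_le_cancel_iff)
  qed
  show "\<forall>\<^sub>F R in at_top. mth u R \<le> mth u 1 * exp (- \<kappa> * ln R)"
    using eventually_ge_at_top[of 1] by eventually_elim (rule le)
  show "\<forall>\<^sub>F R in at_top. 0 \<le> mth u R"
    by (rule eventually_mono[OF eventually_ge_at_top[of 1]]) (use region(4) in \<open>force intro: less_imp_le\<close>)
  have "filterlim (\<lambda>R. - \<kappa> * ln R) at_bot at_top"
    using kappa_pos by (intro filterlim_tendsto_neg_mult_at_bot[OF tendsto_const] ln_at_top) auto
  then have "((\<lambda>R. exp (- \<kappa> * ln R)) \<longlongrightarrow> 0) at_top"
    by (rule filterlim_compose[OF exp_at_bot])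
  from tendsto_mult[OF tendsto_const this]
  show "((\<lambda>R. mth u 1 * exp (- \<kappa> * ln R)) \<longlongrightarrow> 0) at_top" by simp
qed simp

text \<open>The damping of L - 1 exceeds the required rate, so only the forcing 2 \<theta> s (1 + 2
  q + q p) matters. Since q < 1 and p \<le> 3 the bracket is at most 6, whence 12 \<theta>.\<close>

lemma p_tendsto: "((\<lambda>R. R\<^sup>2 * mP q u R) \<longlongrightarrow> 0) at_top"
proof (rule tendsto_zero_by_weighted_derivative[where e = "\<lambda>R. 12 * mth u R"])
  show "((\<lambda>R. 12 * mth u R) \<longlongrightarrow> 0) at_top" using tendsto_mult[OF tendsto_const th_tendsto, of 12] by simp
  fix R :: real assume R: "1 \<le> R"
  then have R0: "0 < R" by simp
  note r = region[OF less_imp_le[OF R0]]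
  show "0 \<le> R\<^sup>2 * mP q u R" using r by simp
  define s h p where "s = R\<^sup>2 * mS u R" and "h = mth u R" and "p = R\<^sup>2 * mP q u R"
  have s: "0 \<le> s" "s \<le> 1" and h: "0 \<le> h" "h \<le> 1" and p: "0 \<le> p" "p \<le> 3"
    using r by (auto simp: s_def h_def p_def)
  have D1: "((\<lambda>R. R\<^sup>2 * mP q u R) has_real_derivative (- 4 * (1 + p) * p + 2 * h * s * (1 + 2 * q + q * p)) / R) (at R)"
    using DERIV_diff[OF profile_derivatives(3)[OF R0] DERIV_const, of 1]
    by (simp add: ml_def[abs_def] s_def h_def p_def)
  have D: "((\<lambda>R. R\<^sup>2 * (R\<^sup>2 * mP q u R)) has_real_derivative
      2 * R * p + R\<^sup>2 * ((- 4 * (1 + p) * p + 2 * h * s * (1 + 2 * q + q * p)) / R)) (at R)"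
    by (rule D1 derivative_eq_intros refl)+ (simp add: p_def)
  have eqn: "2 * R * p + R\<^sup>2 * (X / R) = R * (2 * p + X)" for X
    using R0 by (simp add: power2_eq_square distrib_left)
  have "q * p \<le> 1 * p" using q p by (intro mult_right_mono) auto
  then have "2 * h * s * (1 + 2 * q + q * p) \<le> 2 * h * s * 6" using q p h s by (intro mult_left_mono) auto
  moreover have "h * s \<le> h * 1" using h s by (intro mult_left_mono) auto
  ultimately have "2 * h * s * (1 + 2 * q + q * p) \<le> 12 * h" by linarith
  moreover have "- 4 * (1 + p) * p = - 2 * p - (2 * p + 4 * (p * p))" by (simp add: algebra_simps)
  moreover have "0 \<le> 2 * p + 4 * (p * p)" using p by simp
  ultimately have "R * (2 * p + (- 4 * (1 + p) * p + 2 * h * s * (1 + 2 * q + q * p))) \<le> R * (12 * h)"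
    using R0 by (intro mult_left_mono) linarith+
  then have "2 * R * p + R\<^sup>2 * ((- 4 * (1 + p) * p + 2 * h * s * (1 + 2 * q + q * p)) / R) \<le> 12 * h * R"
    unfolding eqn by (simp add: mult_ac)
  then show "\<exists>D. ((\<lambda>R. R\<^sup>2 * (R\<^sup>2 * mP q u R)) has_real_derivative D) (at R) \<and> D \<le> 12 * mth u R * R"
    using D unfolding h_def by blast
qed

text \<open>The equation of s is of Bernoulli type, so 1 / s satisfies a linear one; 1 / s - 1 is
  nonnegative and forced only by a multiple of \<theta>.\<close>

lemma s_tendsto: "((\<lambda>R. R\<^sup>2 * mS u R) \<longlongrightarrow> 1) at_top"
proof -
  have "((\<lambda>R. 1 / (R\<^sup>2 * mS u R) - 1) \<longlongrightarrow> 0) at_top"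
  proof (rule tendsto_zero_by_weighted_derivative[where e = "\<lambda>R. 6 * mth u R"])
    show "((\<lambda>R. 6 * mth u R) \<longlongrightarrow> 0) at_top" using tendsto_mult[OF tendsto_const th_tendsto, of 6] by simp
    fix R :: real assume R: "1 \<le> R"
    then have R0: "0 < R" by simp
    note r = region[OF less_imp_le[OF R0]]
    define s h where "s = R\<^sup>2 * mS u R" and "h = mth u R"
    have s: "0 < s" "s < 1" and h: "0 \<le> h" "h \<le> 1" using r R0 by (auto simp: s_def h_def)
    show "0 \<le> 1 / (R\<^sup>2 * mS u R) - 1" using s by (simp add: s_def[symmetric])
    define sf where "sf = (\<lambda>R. R\<^sup>2 * mS u R)"
    have sf: "sf R = s" "(sf has_real_derivative 2 / R * s * (2 * (1 - s) - h * (1 - q * s))) (at R)"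
      using s_deriv[OF R0] by (simp_all add: sf_def s_def h_def)
    have "((\<lambda>R. 1 / sf R - 1) has_real_derivative - (2 / R * s * (2 * (1 - s) - h * (1 - q * s))) / s\<^sup>2) (at R)"
      using s by (auto intro!: derivative_eq_intros sf(2) simp: sf(1) power2_eq_square)
    then have D0: "((\<lambda>R. 1 / (R\<^sup>2 * mS u R) - 1) has_real_derivative - (2 / R * s * (2 * (1 - s) - h * (1 - q * s))) / s\<^sup>2) (at R)"
      by (simp add: sf_def)
    have "((\<lambda>R. R\<^sup>2 * (1 / (R\<^sup>2 * mS u R) - 1)) has_real_derivative
        2 * R * (1 / s - 1) + R\<^sup>2 * (- (2 / R * s * (2 * (1 - s) - h * (1 - q * s))) / s\<^sup>2)) (at R)"
      by (rule D0 derivative_eq_intros refl)+ (simp add: s_def)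
    moreover have "2 * R * (1 / s - 1) + R\<^sup>2 * (- (2 / R * s * (2 * (1 - s) - h * (1 - q * s))) / s\<^sup>2) \<le> 6 * h * R"
    proof -
      have "(1 - h) * (1 / s - 1) \<ge> 0" using h s by (intro mult_nonneg_nonneg) auto
      moreover have "2 * R * (1 / s - 1) + R\<^sup>2 * (- (2 / R * s * (2 * (1 - s) - h * (1 - q * s))) / s\<^sup>2) =
         2 * R * (h * (1 - q) - (1 - h) * (1 / s - 1))"
        using s R0 by (simp add: field_simps power2_eq_square)
      moreover have "h * (1 - q) \<le> h * 3" using q h by (intro mult_left_mono) auto
      ultimately show ?thesis
        using mult_left_mono[of "h * (1 - q) - (1 - h) * (1 / s - 1)" "h * 3" "2 * R"] R0 by (simp add: mult_ac)
    qed
    ultimately show "\<exists>D. ((\<lambda>R. R\<^sup>2 * (1 / (R\<^sup>2 * mS u R) - 1)) has_real_derivative D) (at R) \<and> D \<le> 6 * mth u R * R"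
      unfolding h_def by blast
  qed
  then have "((\<lambda>R. 1 / (1 + (1 / (R\<^sup>2 * mS u R) - 1))) \<longlongrightarrow> 1 / (1 + 0)) at_top"
    by (intro tendsto_intros) auto
  then show ?thesis by simp
qed

lemma l_tendsto: "(ml q u \<longlongrightarrow> 1) at_top"
  using tendsto_add[OF tendsto_const p_tendsto, of 1] by (simp add: ml_def[abs_def])

lemma psi_nonneg: "0 \<le> R \<Longrightarrow> 0 \<le> mpsi q u R"
proof -
  assume R: "0 \<le> R"
  note r = region[OF R]
  have "q * mth u R \<le> 1 * 1" using q r by (intro mult_mono) auto
  then have "0 \<le> mS u R * (1 - q * mth u R)" using r by simp
  moreover have "mpsi q u R = mP q u R + mS u R * (1 - q * mth u R)" by (simp add: mpsi_def algebra_simps)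
  ultimately show ?thesis using r by simp
qed

lemma my_ge_1: "0 \<le> R \<Longrightarrow> 1 \<le> my q u R"
proof -
  assume R: "0 \<le> R"
  have "my q u 0 \<le> my q u R"
  proof (rule DERIV_nonneg_imp_increasing_open[OF R])
    show "continuous_on {0..R} (my q u)" by (rule continuous_on_subset[OF conts(8)]) auto
    fix x assume "0 < x" "x < R"
    then show "\<exists>y. (my q u has_real_derivative y) (at x) \<and> 0 \<le> y"
      using my_deriv[of x] my_pos[of x] psi_nonneg[of x] by (auto intro!: exI mult_nonneg_nonneg)
  qed
  then show ?thesis by (simp add: my_0)
qed

text \<open>This is forward completeness. Eventually s > 1/4, so dt / dR \<ge> 1 / (2 R), and the
  arclength grows at least like half of ln R.\<close>

lemma mt_at_top: "filterlim (mt q u) at_top at_top"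
proof -
  have "\<forall>\<^sub>F R in at_top. 1 / 4 < R\<^sup>2 * mS u R"
    by (rule order_tendstoD(1)[OF s_tendsto]) simp
  then obtain R1 where R1: "1 \<le> R1" "\<And>R. R1 \<le> R \<Longrightarrow> 1 / 4 < R\<^sup>2 * mS u R"
    unfolding eventually_at_top_linorder by (metis linorder_le_cases order_trans)
  have sp: "1 / (2 * R) \<le> mspeed q u R" if "R1 \<le> R" for R
  proof -
    have R0: "0 < R" using that R1 by simp
    note r = region[OF less_imp_le[OF R0]]
    have "(1 / (2 * R))\<^sup>2 \<le> mS u R" using R1(2)[OF that] R0 by (simp add: power_divide field_simps)
    then have "1 / (2 * R) \<le> sqrt (mS u R)" by (rule real_le_rsqrt)
    moreover have "1 \<le> sqrt (ml q u R)" using r by simp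
    ultimately have "1 / (2 * R) * 1 \<le> sqrt (mS u R) * sqrt (ml q u R)" using R0 less_imp_le[OF r(1)] by (intro mult_mono) auto
    from mult_mono[OF my_ge_1[OF less_imp_le[OF R0]] this]
    have "1 * (1 / (2 * R) * 1) \<le> my q u R * (sqrt (mS u R) * sqrt (ml q u R))"
      using my_pos[of R] R0 by simp
    then show ?thesis by (simp add: mspeed_def)
  qed
  have "mt q u R1 - ln R1 / 2 + ln R / 2 \<le> mt q u R" if "R1 \<le> R" for R
  proof -
    have "mt q u R1 - ln R1 / 2 \<le> mt q u R - ln R / 2"
    proof (rule DERIV_nonneg_imp_nondecreasing[OF that])
      fix x assume x: "R1 \<le> x" "x \<le> R"
      then have "0 < x" using R1 by simp
      then have "((\<lambda>R. mt q u R - ln R / 2) has_real_derivative mspeed q u x - 1 / (2 * x)) (at x)"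
        by (auto intro!: derivative_eq_intros mt_deriv simp: field_simps)
      then show "\<exists>y. ((\<lambda>R. mt q u R - ln R / 2) has_real_derivative y) (at x) \<and> 0 \<le> y"
        using sp[OF x(1)] by (intro exI[of _ "mspeed q u x - 1 / (2 * x)"]) simp
    qed
    then show ?thesis by simp
  qed
  then have "\<forall>\<^sub>F R in at_top. mt q u R1 - ln R1 / 2 + ln R / 2 \<le> mt q u R"
    by (intro eventually_mono[OF eventually_ge_at_top[of R1]])
  moreover have "filterlim (\<lambda>R. (1/2::real) * ln R) at_top at_top"
    by (rule filterlim_tendsto_pos_mult_at_top[OF tendsto_const _ ln_at_top]) simp
  then have "filterlim (\<lambda>R. (mt q u R1 - ln R1 / 2) + (1/2) * ln R) at_top at_top"
    by (rule filterlim_tendsto_add_at_top[OF tendsto_const])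
  ultimately show ?thesis
    using filterlim_at_top_mono[of "\<lambda>R. mt q u R1 - ln R1 / 2 + ln R / 2" at_top "mt q u"] by simp
qed

lemma mt_image: "mt q u ` {0..} = {0..}"
proof
  show "mt q u ` {0..} \<subseteq> {0..}"
  proof
    fix t assume "t \<in> mt q u ` {0..}"
    then obtain R where R: "0 \<le> R" "t = mt q u R" by auto
    then show "t \<in> {0..}" using strict_mono_onD[OF mt_strict_mono, of 0 R] mt_0 by (cases "R = 0") auto
  qed
  show "{0..} \<subseteq> mt q u ` {0..}"
  proof
    fix t :: real assume t: "t \<in> {0..}"
    have "\<forall>\<^sub>F R in at_top. t \<le> mt q u R" using mt_at_top by (simp add: filterlim_at_top)
    then obtain R where R: "0 \<le> R" "t \<le> mt q u R"
      unfolding eventually_at_top_linorder by (metis linorder_le_cases)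
    have "continuous_on {0..R} (mt q u)" by (rule continuous_on_subset[OF conts(10)]) auto
    then obtain r where "0 \<le> r" "r \<le> R" "mt q u r = t"
      using IVT'[of "mt q u" 0 t R] t R mt_0 by auto
    then show "t \<in> mt q u ` {0..}" by force
  qed
qed

end

section \<open>Reparametrisation by arclength\<close>

definition "mr q u t = inv_into {0..} (mt q u) t"
definition "mm q u t = met q u (mr q u t)"

context profile
begin

lemma mr_nonneg: "0 \<le> t \<Longrightarrow> 0 \<le> mr q u t" and mt_mr: "0 \<le> t \<Longrightarrow> mt q u (mr q u t) = t"
  using inv_into_into[of t "mt q u" "{0..}"] f_inv_into_f[of t "mt q u" "{0..}"] mt_image
  by (auto simp: mr_def)

lemma mr_mt: "0 \<le> R \<Longrightarrow> mr q u (mt q u R) = R"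
  unfolding mr_def by (rule inv_into_f_f[OF strict_mono_on_imp_inj_on[OF mt_strict_mono]]) simp

lemma mr_0: "mr q u 0 = 0"
  using mr_mt[of 0] by (simp add: mt_0)

lemma mr_pos: "0 < t \<Longrightarrow> 0 < mr q u t"
  using mr_nonneg[of t] mt_mr[of t] mt_0 by (cases "mr q u t = 0") auto

lemma mr_cont: "continuous_on {0..} (mr q u)"
proof -
  have "continuous_on ({0::real} \<times> {0..}) (\<lambda>(a, t). inv_into {0..} (mt q u) t)"
  proof (rule continuous_on_inverse_param)
    show "continuous_on ({0::real} \<times> {0..}) (\<lambda>(a, R). mt q u R)"
      unfolding case_prod_beta by (intro continuous_on_compose2[OF conts(10)] continuous_intros) auto
  qed (use mt_strict_mono mt_image in auto)
  then show ?thesis unfolding mr_def[abs_def] by (rule continuous_on_slice) simp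
qed

lemma mr_isCont: "0 < t \<Longrightarrow> isCont (mr q u) t"
  using continuous_on_interior[OF mr_cont, of t] by simp

lemma mr_deriv:
  assumes t: "0 < t"
  shows "(mr q u has_real_derivative inverse (mspeed q u (mr q u t))) (at t)"
proof (rule DERIV_inverse_function[where f = "mt q u" and a = 0 and b = "t + 1"])
  show "(mt q u has_real_derivative mspeed q u (mr q u t)) (at (mr q u t))" by (rule mt_deriv[OF mr_pos[OF t]])
  show "mspeed q u (mr q u t) \<noteq> 0" using mspeed_pos[OF mr_nonneg[of t]] t by simp
qed (use t mt_mr mr_isCont in auto)

lemma mm_pos: "0 < t \<Longrightarrow> all_pos (mm q u t)"
  unfolding mm_def by (rule met_pos[OF mr_pos])

lemma mm_deriv:
  assumes t: "0 < t"
  shows "(mm q u has_vector_derivative mfield q (mm q u t)) (at t)"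
proof -
  have "(mr q u has_vector_derivative inverse (mspeed q u (mr q u t))) (at t)"
    using mr_deriv[OF t] by (simp add: has_real_derivative_iff_has_vector_derivative)
  from vector_diff_chain_at[OF this met_deriv[OF mr_pos[OF t]]]
  show ?thesis
    using mspeed_pos[OF mr_nonneg[of t]] t by (simp add: mm_def[abs_def] o_def vel_eq[OF mr_pos[OF t]])
qed

lemma mr_at_top: "filterlim (mr q u) at_top at_top"
  unfolding filterlim_at_top
proof
  fix Z :: real
  have "mr q u t \<ge> Z" if "mt q u (max 0 Z) \<le> t" for t
  proof -
    have "mt q u (max 0 Z) \<in> {0..}" using mt_image by (metis imageI atLeast_iff max.cobounded1)
    then have t0: "0 \<le> t" using that by simp
    have "max 0 Z \<le> mr q u t"
    proof (rule ccontr)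
      assume "\<not> ?thesis"
      then have "mt q u (mr q u t) < mt q u (max 0 Z)"
        using strict_mono_onD[OF mt_strict_mono, of "mr q u t" "max 0 Z"] mr_nonneg[OF t0] by auto
      then show False using mt_mr[OF t0] that by simp
    qed
    then show ?thesis by simp
  qed
  then show "\<forall>\<^sub>F t in at_top. Z \<le> mr q u t"
    unfolding eventually_at_top_linorder by blast
qed

text \<open>The variation of ln F is controlled by \<theta> itself: with k = 4 / \<kappa> the
  derivative of k \<theta> is at most - 4 \<theta> / R. Hence ln F + k \<theta> decreases and ln F -
  k \<theta> increases; the second bounds the first from below, and their difference tends to
  0.\<close>

lemma F_tendsto:
  obtains F0 where "0 < F0" "((\<lambda>R. snd (snd (snd (met q u R)))) \<longlongrightarrow> F0) at_top"
proof -
  define F where "F R = snd (snd (snd (met q u R)))" for R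
  have Fpos: "0 < F R" if "0 < R" for R
    using met_pos[OF that] by (simp add: F_def met_def)
  have dF: "\<exists>E. ((\<lambda>R. ln (F R)) has_real_derivative E) (at R) \<and> \<bar>E\<bar> \<le> 4 * (mth u R / R)" if R: "1 \<le> R" for R
  proof -
    have R0: "0 < R" using R by simp
    note r = region[OF less_imp_le[OF R0]]
    define s h l where "s = R\<^sup>2 * mS u R" and "h = mth u R" and "l = ml q u R"
    have s: "0 \<le> s" "s \<le> 1" and h: "0 < h" and l: "1 \<le> l" using r by (auto simp: s_def h_def l_def)
    define B where "B = 1 + q * s - (1 + q) * s / l"
    have "(F has_real_derivative mspeed q u R * snd (snd (snd (vel q u R)))) (at R)"
      using bounded_linear.has_vector_derivative[OF bounded_linear_snd
          bounded_linear.has_vector_derivative[OF bounded_linear_snd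
          bounded_linear.has_vector_derivative[OF bounded_linear_snd met_deriv[OF R0]]]]
      by (simp add: has_real_derivative_iff_has_vector_derivative F_def[abs_def])
    then have "((\<lambda>R. ln (F R)) has_real_derivative mspeed q u R * snd (snd (snd (vel q u R))) / F R) (at R)"
      using Fpos[OF R0] by (auto intro!: derivative_eq_intros)
    moreover have "mspeed q u R * snd (snd (snd (vel q u R))) / F R = h / R * B"
    proof -
      have v: "snd (snd (snd (vel q u R))) = h\<^sup>2 / (sqrt l)\<^sup>2 * B"
        using l by (simp add: vel_def h_def l_def B_def s_def mult_ac)
      have FR: "F R = h * R * my q u R * sqrt (mS u R) / sqrt l" by (simp add: F_def met_def h_def l_def)
      have "0 < sqrt (mS u R)" "0 < sqrt l" using r(1) l by auto
      then show ?thesis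
        unfolding v FR mspeed_def l_def[symmetric]
        using my_pos[of R] h R0 by (simp add: field_simps power2_eq_square)
    qed
    moreover have "\<bar>h / R * B\<bar> \<le> 4 * (h / R)"
    proof -
      have "\<bar>q * s\<bar> \<le> 1 * 1" unfolding abs_mult using q s by (intro mult_mono) auto
      moreover have "\<bar>(1 + q) * s / l\<bar> \<le> 2 * 1 / 1" unfolding abs_mult abs_divide using q s l by (intro frac_le mult_mono mult_nonneg_nonneg) auto
      ultimately have "\<bar>B\<bar> \<le> 4" unfolding B_def by linarith
      then have "h / R * \<bar>B\<bar> \<le> h / R * 4" using h R0 by (intro mult_left_mono) auto
      then show ?thesis using h R0 by (simp add: abs_mult mult.commute)
    qed
    ultimately show ?thesis unfolding h_def by auto
  qed
  define k where "k = 4 / \<kappa>"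
  have k: "0 < k" using kappa_pos by (simp add: k_def)
  have kth: "\<exists>D. (mth u has_real_derivative D) (at R) \<and> 4 * (mth u R / R) \<le> - (k * D)" if R: "1 \<le> R" for R
  proof -
    obtain D where D: "(mth u has_real_derivative D) (at R)" "D \<le> - \<kappa> * mth u R / R"
      using th_deriv_kappa[OF R] by blast
    have "k * D \<le> k * (- \<kappa> * mth u R / R)" using D(2) k by (intro mult_left_mono) auto
    also have "\<dots> = - (4 * (mth u R / R))" using kappa_pos by (simp add: k_def)
    finally show ?thesis using D(1) by (intro exI[of _ D]) auto
  qed
  have dec: "ln (F y) + k * mth u y \<le> ln (F x) + k * mth u x" if "1 \<le> x" "x \<le> y" for x y
  proof (rule DERIV_nonpos_imp_nonincreasing[OF that(2)])
    fix z assume z: "x \<le> z" "z \<le> y"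
    then have "1 \<le> z" using that by simp
    then obtain E D where "((\<lambda>R. ln (F R)) has_real_derivative E) (at z)" "\<bar>E\<bar> \<le> 4 * (mth u z / z)"
      "(mth u has_real_derivative D) (at z)" "4 * (mth u z / z) \<le> - (k * D)"
      using dF kth by metis
    then show "\<exists>y. ((\<lambda>R. ln (F R) + k * mth u R) has_real_derivative y) (at z) \<and> y \<le> 0"
      by (intro exI[of _ "E + k * D"] conjI DERIV_add DERIV_cmult) auto
  qed
  have inc: "ln (F x) - k * mth u x \<le> ln (F y) - k * mth u y" if "1 \<le> x" "x \<le> y" for x y
  proof (rule DERIV_nonneg_imp_nondecreasing[OF that(2)])
    fix z assume z: "x \<le> z" "z \<le> y"
    then have "1 \<le> z" using that by simp
    then obtain E D where "((\<lambda>R. ln (F R)) has_real_derivative E) (at z)" "\<bar>E\<bar> \<le> 4 * (mth u z / z)"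
      "(mth u has_real_derivative D) (at z)" "4 * (mth u z / z) \<le> - (k * D)"
      using dF kth by metis
    then show "\<exists>y. ((\<lambda>R. ln (F R) - k * mth u R) has_real_derivative y) (at z) \<and> 0 \<le> y"
      by (intro exI[of _ "E - k * D"] conjI DERIV_diff DERIV_cmult) auto
  qed
  have "ln (F 1) - k * mth u 1 \<le> ln (F x) + k * mth u x" if "1 \<le> x" for x
  proof -
    have "0 \<le> k * mth u x" using k region(4)[of x] that by simp
    then show ?thesis using inc[OF order_refl that] by linarith
  qed
  then obtain L where "((\<lambda>R. ln (F R) + k * mth u R) \<longlongrightarrow> L) at_top"
    using decreasing_bounded_tendsto_at_top[of "\<lambda>R. ln (F R) + k * mth u R"] dec by metis
  then have "((\<lambda>R. ln (F R) + k * mth u R - k * mth u R) \<longlongrightarrow> L - k * 0) at_top"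
    by (intro tendsto_intros th_tendsto)
  then have "((\<lambda>R. exp (ln (F R))) \<longlongrightarrow> exp L) at_top"
    by (intro tendsto_intros) simp
  then have "(F \<longlongrightarrow> exp L) at_top"
    by (rule Lim_transform_eventually) (rule eventually_mono[OF eventually_gt_at_top[of 0]], simp add: Fpos)
  then show thesis by (intro that[of "exp L"]) (auto simp: F_def[abs_def])
qed

text \<open>Only y needs l'Hopital's rule, applied with the limit 1 of its velocity. The other two
  follow from x / y = sqrt s and z / y = sqrt L.\<close>

lemma mm_asymptotics:
  "((\<lambda>t. fst (mm q u t) / t) \<longlongrightarrow> 1) at_top"
  "((\<lambda>t. fst (snd (mm q u t)) / t) \<longlongrightarrow> 1) at_top"
  "((\<lambda>t. fst (snd (snd (mm q u t))) / t) \<longlongrightarrow> 1) at_top"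
  "\<exists>F0>0. ((\<lambda>t. snd (snd (snd (mm q u t)))) \<longlongrightarrow> F0) at_top"
proof -
  have lim: "((\<lambda>t. f (mr q u t)) \<longlongrightarrow> c) at_top" if "(f \<longlongrightarrow> c) at_top" for f :: "real \<Rightarrow> real" and c
    by (rule filterlim_compose[OF that mr_at_top])
  have sq: "R * sqrt (mS u R) = sqrt (R\<^sup>2 * mS u R)" if "0 \<le> R" for R
    using that by (simp add: real_sqrt_mult)
  have v2: "((\<lambda>R. fst (snd (vel q u R))) \<longlongrightarrow> 1) at_top"
  proof -
    have "((\<lambda>R. (R\<^sup>2 * mP q u R + R\<^sup>2 * mS u R - q * mth u R * (R\<^sup>2 * mS u R)) / (sqrt (R\<^sup>2 * mS u R) * sqrt (ml q u R)))
       \<longlongrightarrow> (0 + 1 - q * 0 * 1) / (sqrt 1 * sqrt 1)) at_top"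
      by (intro tendsto_intros p_tendsto s_tendsto th_tendsto l_tendsto) simp
    then have "((\<lambda>R. (R\<^sup>2 * mP q u R + R\<^sup>2 * mS u R - q * mth u R * (R\<^sup>2 * mS u R)) / (sqrt (R\<^sup>2 * mS u R) * sqrt (ml q u R)))
       \<longlongrightarrow> 1) at_top" by simp
    then show ?thesis
    proof (rule Lim_transform_eventually)
      show "\<forall>\<^sub>F R in at_top. (R\<^sup>2 * mP q u R + R\<^sup>2 * mS u R - q * mth u R * (R\<^sup>2 * mS u R)) / (sqrt (R\<^sup>2 * mS u R) * sqrt (ml q u R))
         = fst (snd (vel q u R))"
        using eventually_gt_at_top[of 0]
      proof eventually_elim
        case (elim R)
        have "R\<^sup>2 * mP q u R + R\<^sup>2 * mS u R - q * mth u R * (R\<^sup>2 * mS u R) = R * (R * mpsi q u R)"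
          by (simp add: mpsi_def algebra_simps power2_eq_square)
        then show ?case using elim by (simp add: vel_def sq[symmetric])
      qed
    qed
  qed
  have y: "((\<lambda>t. fst (snd (mm q u t)) / t) \<longlongrightarrow> 1) at_top"
  proof (rule lhospital_at_top_at_top[where f' = "\<lambda>t. fst (snd (vel q u (mr q u t)))" and g' = "\<lambda>_. 1"])
    show "\<forall>\<^sub>F t in at_top. ((\<lambda>t. fst (snd (mm q u t))) has_real_derivative fst (snd (vel q u (mr q u t)))) (at t)"
      using eventually_gt_at_top[of 0]
    proof eventually_elim
      case (elim t)
      from bounded_linear.has_vector_derivative[OF bounded_linear_fst
          bounded_linear.has_vector_derivative[OF bounded_linear_snd mm_deriv[OF elim]]]
      show ?case by (simp add: has_real_derivative_iff_has_vector_derivative mm_def vel_eq[OF mr_pos[OF elim]])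
    qed
    show "((\<lambda>t. fst (snd (vel q u (mr q u t))) / 1) \<longlongrightarrow> 1) at_top" using lim[OF v2] by simp
  qed (auto simp: filterlim_ident)
  then show "((\<lambda>t. fst (snd (mm q u t)) / t) \<longlongrightarrow> 1) at_top" .
  have "((\<lambda>t. fst (snd (mm q u t)) / t * sqrt ((mr q u t)\<^sup>2 * mS u (mr q u t))) \<longlongrightarrow> 1 * sqrt 1) at_top"
    by (intro tendsto_intros y lim[OF s_tendsto])
  then have "((\<lambda>t. fst (snd (mm q u t)) / t * sqrt ((mr q u t)\<^sup>2 * mS u (mr q u t))) \<longlongrightarrow> 1) at_top" by simp
  then show "((\<lambda>t. fst (mm q u t) / t) \<longlongrightarrow> 1) at_top"
  proof (rule Lim_transform_eventually)
    show "\<forall>\<^sub>F t in at_top. fst (snd (mm q u t)) / t * sqrt ((mr q u t)\<^sup>2 * mS u (mr q u t)) = fst (mm q u t) / t"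
      using eventually_gt_at_top[of 0]
      by eventually_elim (simp add: mm_def met_def sq[symmetric] mr_nonneg)
  qed
  have "((\<lambda>t. fst (snd (mm q u t)) / t * sqrt (ml q u (mr q u t))) \<longlongrightarrow> 1 * sqrt 1) at_top"
    by (intro tendsto_intros y lim[OF l_tendsto])
  then show "((\<lambda>t. fst (snd (snd (mm q u t))) / t) \<longlongrightarrow> 1) at_top"
    by (simp add: mm_def met_def mult_ac)
  obtain F0 where "0 < F0" "((\<lambda>R. snd (snd (snd (met q u R)))) \<longlongrightarrow> F0) at_top" by (rule F_tendsto)
  then show "\<exists>F0>0. ((\<lambda>t. snd (snd (snd (mm q u t)))) \<longlongrightarrow> F0) at_top"
    using lim by (auto simp: mm_def)
qed

end

section \<open>Expansion at the singular orbit\<close>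

text \<open>A calculus of Taylor polynomials of degree one in \<open>R\<^sup>2\<close>. The
  coordinates (X, Z) are rational functions of s, \<theta> and L, which depend on R through
  \<open>R\<^sup>2\<close> only, so the next error is of order \<open>R ^ 4\<close>.
  \<open>zo\<close> is the version of degree zero.\<close>

definition fo :: "(real \<Rightarrow> real) \<Rightarrow> real \<Rightarrow> real \<Rightarrow> bool" where
  "fo f a b \<longleftrightarrow> (\<lambda>R. f R - (a + b * R\<^sup>2)) \<in> O[at_right 0](\<lambda>R. R ^ 4)"

definition zo :: "(real \<Rightarrow> real) \<Rightarrow> real \<Rightarrow> bool" where
  "zo f a \<longleftrightarrow> (\<lambda>R. f R - a) \<in> O[at_right 0](\<lambda>R. R\<^sup>2)"

lemma sq_bigo: "(\<lambda>R::real. R\<^sup>2) \<in> O[at_right 0](\<lambda>_. 1)"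
  "(\<lambda>R::real. R ^ 4) \<in> O[at_right 0](\<lambda>R. R\<^sup>2)"
proof -
  have "\<forall>\<^sub>F R::real in at_right 0. 0 < R \<and> R < 1" by (auto simp: eventually_at_right_field intro: exI[of _ 1])
  then have ev: "\<forall>\<^sub>F R::real in at_right 0. R\<^sup>2 \<le> 1"
    by eventually_elim (auto simp: power_le_one)
  show "(\<lambda>R::real. R\<^sup>2) \<in> O[at_right 0](\<lambda>_. 1)"
    by (rule bigoI[of _ 1]) (use ev in eventually_elim, simp)
  have "(\<lambda>R::real. R\<^sup>2 * R\<^sup>2) \<in> O[at_right 0](\<lambda>R. 1 * R\<^sup>2)"
    by (intro landau_o.big.mult_right, rule bigoI[of _ 1]) (use ev in eventually_elim, simp)
  then show "(\<lambda>R::real. R ^ 4) \<in> O[at_right 0](\<lambda>R. R\<^sup>2)" by (simp add: power_add[symmetric] flip: power_add)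
qed

lemma fo_imp_zo: "fo f a b \<Longrightarrow> zo f a"
proof -
  assume "fo f a b"
  then have "(\<lambda>R. f R - (a + b * R\<^sup>2)) \<in> O[at_right 0](\<lambda>R. R\<^sup>2)"
    unfolding fo_def by (rule landau_o.big_trans[OF _ sq_bigo(2)])
  moreover have "(\<lambda>R. b * R\<^sup>2) \<in> O[at_right 0](\<lambda>R. R\<^sup>2)" by simp
  ultimately have "(\<lambda>R. f R - (a + b * R\<^sup>2) + b * R\<^sup>2) \<in> O[at_right 0](\<lambda>R. R\<^sup>2)"
    by (rule sum_in_bigo)
  then show ?thesis by (simp add: zo_def)
qed

lemma zo_bounded: "zo f a \<Longrightarrow> f \<in> O[at_right 0](\<lambda>_. 1)"
proof -
  assume "zo f a"
  then have "(\<lambda>R. f R - a) \<in> O[at_right 0](\<lambda>_. 1)"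
    unfolding zo_def by (rule landau_o.big_trans[OF _ sq_bigo(1)])
  moreover have "(\<lambda>_. a) \<in> O[at_right 0](\<lambda>_::real. 1::real)" by simp
  ultimately have "(\<lambda>R. f R - a + a) \<in> O[at_right 0](\<lambda>_. 1)" by (rule sum_in_bigo)
  then show ?thesis by simp
qed

lemma zo_tendsto: "zo f a \<Longrightarrow> (f \<longlongrightarrow> a) (at_right 0)"
proof -
  assume "zo f a"
  then obtain C where C: "\<forall>\<^sub>F R in at_right 0. norm (f R - a) \<le> C * norm (R\<^sup>2)"
    unfolding zo_def by (elim landau_o.bigE)
  have "((\<lambda>R::real. C * norm (R\<^sup>2)) \<longlongrightarrow> C * norm ((0::real)\<^sup>2)) (at_right 0)" by (intro tendsto_intros)
  then have "((\<lambda>R. f R - a) \<longlongrightarrow> 0) (at_right 0)"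
    by (intro Lim_null_comparison[OF C]) simp
  then show ?thesis by (simp add: LIM_zero_iff)
qed

lemma fo_const: "fo (\<lambda>_. a) a 0" by (simp add: fo_def)

lemma fo_add: "fo f a b \<Longrightarrow> fo g a' b' \<Longrightarrow> fo (\<lambda>R. f R + g R) (a + a') (b + b')"
  unfolding fo_def by (drule (1) sum_in_bigo(1)) (simp add: algebra_simps)

lemma fo_diff: "fo f a b \<Longrightarrow> fo g a' b' \<Longrightarrow> fo (\<lambda>R. f R - g R) (a - a') (b - b')"
  unfolding fo_def by (drule (1) sum_in_bigo(2)) (simp add: algebra_simps)

lemma fo_mult:
  assumes f: "fo f a b" and g: "fo g a' b'"
  shows "fo (\<lambda>R. f R * g R) (a * a') (a * b' + b * a')"
proof -
  have gb: "g \<in> O[at_right 0](\<lambda>_. 1)" by (rule zo_bounded[OF fo_imp_zo[OF g]])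
  have ab: "(\<lambda>R. a + b * R\<^sup>2) \<in> O[at_right 0](\<lambda>_. 1)"
    by (rule zo_bounded[of _ a]) (simp add: zo_def)
  have "(\<lambda>R. (f R - (a + b * R\<^sup>2)) * g R) \<in> O[at_right 0](\<lambda>R. R ^ 4 * 1)"
    using f gb unfolding fo_def by (rule landau_o.big.mult)
  moreover have "(\<lambda>R. (a + b * R\<^sup>2) * (g R - (a' + b' * R\<^sup>2))) \<in> O[at_right 0](\<lambda>R. 1 * R ^ 4)"
    using ab g unfolding fo_def by (rule landau_o.big.mult)
  moreover have "(\<lambda>R. b * b' * R ^ 4) \<in> O[at_right 0](\<lambda>R. R ^ 4)" by simp
  ultimately have "(\<lambda>R. (f R - (a + b * R\<^sup>2)) * g R + (a + b * R\<^sup>2) * (g R - (a' + b' * R\<^sup>2)) + b * b' * R ^ 4)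
      \<in> O[at_right 0](\<lambda>R. R ^ 4)" by (intro sum_in_bigo) simp_all
  then show ?thesis
    unfolding fo_def by (rule back_subst[where P = "\<lambda>f. f \<in> O[at_right 0](\<lambda>R. R ^ 4)"])
      (simp add: fun_eq_iff algebra_simps power_numeral_even power2_eq_square)
qed

lemma fo_inverse:
  assumes g: "fo g a b" and a: "a \<noteq> 0"
  shows "fo (\<lambda>R. 1 / g R) (1 / a) (- b / a\<^sup>2)"
proof -
  have z: "zo g a" by (rule fo_imp_zo[OF g])
  have t: "(g \<longlongrightarrow> a) (at_right 0)" by (rule zo_tendsto[OF z])
  have "((\<lambda>R. 1 / g R) \<longlongrightarrow> 1 / a) (at_right 0)" using t a by (intro tendsto_intros)
  then have ib: "(\<lambda>R. 1 / g R) \<in> O[at_right 0](\<lambda>_. 1)"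
    by (intro bigoI_tendsto[of _ _ "1 / a"]) simp_all
  \<comment> \<open>Multiplied by 1 / g, this is \<open>a\<^sup>2\<close> times the error of the
    expansion of 1 / g. Both summands are small: the first by \<open>fo\<close>, the second because
    g - a is already of order \<open>R\<^sup>2\<close>.\<close>
  have "(\<lambda>R. - a * (g R - (a + b * R\<^sup>2)) + b * (R\<^sup>2 * (g R - a))) \<in> O[at_right 0](\<lambda>R. R ^ 4)"
  proof (rule sum_in_bigo)
    show "(\<lambda>R. - a * (g R - (a + b * R\<^sup>2))) \<in> O[at_right 0](\<lambda>R. R ^ 4)" using g unfolding fo_def by simp
    have "(\<lambda>R. R\<^sup>2 * (g R - a)) \<in> O[at_right 0](\<lambda>R. R\<^sup>2 * R\<^sup>2)"
      using z unfolding zo_def by (intro landau_o.big.mult) auto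
    then show "(\<lambda>R. b * (R\<^sup>2 * (g R - a))) \<in> O[at_right 0](\<lambda>R. R ^ 4)" by (simp flip: power_add)
  qed
  from landau_o.big.mult[OF this ib]
  have "(\<lambda>R. (- a * (g R - (a + b * R\<^sup>2)) + b * (R\<^sup>2 * (g R - a))) * (1 / g R)) \<in> O[at_right 0](\<lambda>R. R ^ 4)"
    by (simp only: mult_1_right)
  then have "(\<lambda>R. 1 / a\<^sup>2 * ((- a * (g R - (a + b * R\<^sup>2)) + b * (R\<^sup>2 * (g R - a))) * (1 / g R))) \<in> O[at_right 0](\<lambda>R. R ^ 4)"
    using a by (subst landau_o.big.cmult_in_iff) simp_all
  moreover have ne: "\<forall>\<^sub>F R in at_right 0. g R \<noteq> 0" by (rule tendsto_imp_eventually_ne[OF t a])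
  have "\<forall>\<^sub>F R in at_right 0. 1 / a\<^sup>2 * ((- a * (g R - (a + b * R\<^sup>2)) + b * (R\<^sup>2 * (g R - a))) * (1 / g R))
      = 1 / g R - (1 / a + - b / a\<^sup>2 * R\<^sup>2)"
    by (rule eventually_mono[OF ne]) (use a in \<open>simp add: field_simps power2_eq_square\<close>)
  from landau_o.big.in_cong[OF this] calculation(1)
  show ?thesis unfolding fo_def by blast
qed

lemma fo_divide:
  assumes "fo f a b" "fo g a' b'" "a' \<noteq> 0"
  shows "fo (\<lambda>R. f R / g R) (a / a') ((b * a' - a * b') / a'\<^sup>2)"
  using fo_mult[OF assms(1) fo_inverse[OF assms(2,3)]] assms(3)
  by (simp add: field_simps power2_eq_square)

lemma fo_cong_coeffs: "fo f a b \<Longrightarrow> a = a' \<Longrightarrow> b = b' \<Longrightarrow> fo f a' b'" by simp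

lemma zo_mult:
  assumes f: "zo f a" and g: "zo g b" shows "zo (\<lambda>R. f R * g R) (a * b)"
proof -
  have "(\<lambda>R. (f R - a) * g R) \<in> O[at_right 0](\<lambda>R. R\<^sup>2 * 1)"
    using f zo_bounded[OF g] unfolding zo_def by (rule landau_o.big.mult)
  moreover have "(\<lambda>R. a * (g R - b)) \<in> O[at_right 0](\<lambda>R. R\<^sup>2)" using g unfolding zo_def by simp
  ultimately have "(\<lambda>R. (f R - a) * g R + a * (g R - b)) \<in> O[at_right 0](\<lambda>R. R\<^sup>2)"
    by (intro sum_in_bigo) simp_all
  then show ?thesis by (simp add: zo_def algebra_simps)
qed

lemma zo_power: "zo f a \<Longrightarrow> zo (\<lambda>R. f R ^ n) (a ^ n)"
proof (induction n)
  case 0 then show ?case by (simp add: zo_def)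
next
  case (Suc n) then show ?case using zo_mult[of f a "\<lambda>R. f R ^ n" "a ^ n"] by simp
qed

lemma fo_sq_mult: "zo f a \<Longrightarrow> fo (\<lambda>R. R\<^sup>2 * f R) 0 a"
proof -
  assume "zo f a"
  then have "(\<lambda>R. R\<^sup>2 * (f R - a)) \<in> O[at_right 0](\<lambda>R. R\<^sup>2 * R\<^sup>2)"
    unfolding zo_def by (intro landau_o.big.mult) auto
  then show ?thesis by (simp add: fo_def algebra_simps flip: power_add)
qed

lemma zoI:
  assumes "\<And>R. 0 < R \<Longrightarrow> R < 1 \<Longrightarrow> \<bar>f R - a\<bar> \<le> C * R\<^sup>2"
  shows "zo f a"
  unfolding zo_def
proof (rule bigoI[of _ C])
  have "\<forall>\<^sub>F R::real in at_right 0. 0 < R \<and> R < 1" by (auto simp: eventually_at_right_field intro: exI[of _ 1])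
  then show "\<forall>\<^sub>F R in at_right 0. norm (f R - a) \<le> C * norm (R\<^sup>2)"
    by eventually_elim (use assms in simp)
qed

section \<open>Scale-invariant coordinates of a metric\<close>

definition mtr :: "real \<Rightarrow> real \<times> real \<times> real \<times> real \<Rightarrow> real" where
  "mtr q m = (case (m, mfield q m) of ((x, y, z, F), (x', y', z', F')) \<Rightarrow>
     2 * (x' / x) + 2 * (y' / y) + 2 * (z' / z) + F' / F)"

definition mXZ :: "real \<Rightarrow> real \<times> real \<times> real \<times> real \<Rightarrow> real \<times> real \<times> real \<times> real \<times> real \<times> real \<times> real \<times> real" where
  "mXZ q m = (case (m, mfield q m) of ((x, y, z, F), (x', y', z', F')) \<Rightarrow>
     ((x' / x) / mtr q m, (y' / y) / mtr q m, (z' / z) / mtr q m, (F' / F) / mtr q m,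
      (x / (y * z)) / mtr q m, (y / (x * z)) / mtr q m, (z / (x * y)) / mtr q m, F * mtr q m))"

text \<open>\<open>Ntr\<close> is \<open>d\<eta> / d\<zeta> = tr L \<cdot> x z / y\<close>; the coordinates \<open>(X, Z)\<close> only depend on
  \<open>s\<close>, \<open>h = F z / (x y)\<close> and \<open>l = z\<^sup>2 / y\<^sup>2\<close>.\<close>

definition Ntr :: "real \<Rightarrow> real \<Rightarrow> real \<Rightarrow> real \<Rightarrow> real" where
  "Ntr q s h l = 2 * (1 + s + l) - h * (1 + q * s - (1 + q) * s / l)"

definition nXZ :: "real \<Rightarrow> real \<Rightarrow> real \<Rightarrow> real \<Rightarrow> real \<times> real \<times> real \<times> real \<times> real \<times> real \<times> real \<times> real" where
  "nXZ q s h l = ((1 + l - s - h) / Ntr q s h l, (l - 1 + s - q * h * s) / Ntr q s h l,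
     (1 - l + s + (1 + q) * h * s / l) / Ntr q s h l, h * (1 + q * s - (1 + q) * s / l) / Ntr q s h l,
     s / Ntr q s h l, 1 / Ntr q s h l, l / Ntr q s h l, h * Ntr q s h l / l)"

lemma mXZ_normal_form:
  fixes x l y R h q :: real
  assumes "0 < x" "0 < l" "0 < y" "0 < R" "0 < h"
  defines "m \<equiv> (R * y * x, y, y * l, h * R * y * x / l)"
  shows "mtr q m = Ntr q (R\<^sup>2 * x\<^sup>2) h (l\<^sup>2) / (R * x * l * y)"
    "mXZ q m = nXZ q (R\<^sup>2 * x\<^sup>2) h (l\<^sup>2)"
proof -
  define K where "K = 1 / (R * x * l * y)"
  have K: "0 < K" using assms by (simp add: K_def)
  define s where "s = R\<^sup>2 * x\<^sup>2"
  define B where "B = 1 + q * s - (1 + q) * s / l\<^sup>2"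
  have mf: "mfield q m = ((1 + l\<^sup>2 - R\<^sup>2 * x\<^sup>2 - h) / l,
     R * ((l\<^sup>2 - 1) / R\<^sup>2 + x\<^sup>2 - q * h * x\<^sup>2) / (x * l),
     R * ((x\<^sup>2 - (l\<^sup>2 - 1) / R\<^sup>2) / x + (1 + q) * h * x / l\<^sup>2),
     h\<^sup>2 / l\<^sup>2 * B)"
    unfolding m_def mfield_normal_form[OF assms(1-5)] by (simp add: B_def s_def mult_ac)
  have q1: "(1 + l\<^sup>2 - R\<^sup>2 * x\<^sup>2 - h) / l / (R * y * x) = K * (1 + l\<^sup>2 - s - h)"
    using assms by (simp add: K_def s_def field_simps)
  have q2: "R * ((l\<^sup>2 - 1) / R\<^sup>2 + x\<^sup>2 - q * h * x\<^sup>2) / (x * l) / y = K * (l\<^sup>2 - 1 + s - q * h * s)"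
    using assms by (simp add: K_def s_def field_simps power2_eq_square)
  have q3: "R * ((x\<^sup>2 - (l\<^sup>2 - 1) / R\<^sup>2) / x + (1 + q) * h * x / l\<^sup>2) / (y * l) = K * (1 - l\<^sup>2 + s + (1 + q) * h * s / l\<^sup>2)"
    using assms by (simp add: K_def s_def field_simps power2_eq_square)
  have q4: "h\<^sup>2 / l\<^sup>2 * B / (h * R * y * x / l) = K * (h * B)"
    using assms by (simp add: K_def field_simps power2_eq_square)
  have N: "2 * (1 + l\<^sup>2 - s - h) + 2 * (l\<^sup>2 - 1 + s - q * h * s) + 2 * (1 - l\<^sup>2 + s + (1 + q) * h * s / l\<^sup>2) + h * B = Ntr q s h (l\<^sup>2)"
    by (simp add: Ntr_def B_def algebra_simps)
  have tr: "mtr q m = K * Ntr q s h (l\<^sup>2)"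
    unfolding mtr_def mf unfolding m_def case_prod_conv q1 q2 q3 q4 N[symmetric] by (simp add: algebra_simps)
  then show "mtr q m = Ntr q (R\<^sup>2 * x\<^sup>2) h (l\<^sup>2) / (R * x * l * y)"
    by (simp add: K_def s_def)
  have q5: "R * y * x / (y * (y * l)) = K * s" "y / (R * y * x * (y * l)) = K * 1" "y * l / (R * y * x * y) = K * l\<^sup>2"
    "h * R * y * x / l * (K * Ntr q s h (l\<^sup>2)) = h * Ntr q s h (l\<^sup>2) / l\<^sup>2"
    using assms by (simp_all add: K_def s_def field_simps power2_eq_square)
  have c: "K * a / (K * b) = a / b" for a b using K by simp
  show "mXZ q m = nXZ q (R\<^sup>2 * x\<^sup>2) h (l\<^sup>2)"
    unfolding mXZ_def tr mf s_def[symmetric] unfolding m_def case_prod_conv Let_def nXZ_def B_def[symmetric]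
    unfolding q1[unfolded s_def] q2[unfolded s_def] q3[unfolded s_def] q4[unfolded B_def s_def] q5[unfolded s_def] c s_def B_def by simp
qed

lemma bigo_norm_Pair:
  assumes "(\<lambda>t. norm (f t)) \<in> O[F](h)" "(\<lambda>t. norm (g t)) \<in> O[F](h)"
  shows "(\<lambda>t. norm (f t, g t)) \<in> O[F](h)"
proof (rule landau_o.big_trans)
  show "(\<lambda>t. norm (f t, g t)) \<in> O[F](\<lambda>t. norm (f t) + norm (g t))"
    by (rule bigoI[of _ 1]) (auto simp: norm_Pair_le)
  show "(\<lambda>t. norm (f t) + norm (g t)) \<in> O[F](h)"
    by (rule sum_in_bigo(1)[OF assms])
qed

text \<open>\<open>coeff0\<close> and \<open>coeff1\<close> are P0 and s1 v1 + s2 v2 in the common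
  naming, with w = i s2. The last entries lose the factor 2 \<Delta> / i because F = i f / (2
  \<Delta>).\<close>

definition coeff0 :: "real \<times> real \<times> real \<times> real \<times> real \<times> real \<times> real \<times> real" where
  "coeff0 = (1/3, 0, 0, 1/3, 0, 1/3, 1/3, 3)"

definition coeff1 :: "real \<Rightarrow> real \<Rightarrow> real \<Rightarrow> real \<times> real \<times> real \<times> real \<times> real \<times> real \<times> real \<times> real" where
  "coeff1 q s1 w = (2 * s1 - 3 * w, (4 - q) * w, (5 + q) * w, - 4 * s1 - 12 * w,
     3 * w, - s1 - (5 + q) * w, - s1 - (4 - q) * w, - 18 * s1)"

context profile
begin

lemma vel_0: "vel q u 0 = (1, 0, 0, 1)" and met_0: "met q u 0 = (0, 1, 1, 0)"
  by (simp_all add: vel_def met_def ml_def mth_def my_0)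

lemma mr_at_right_0: "filterlim (mr q u) (at_right 0) (at_right 0)"
proof (rule filterlim_at_withinI)
  have "(mr q u \<longlongrightarrow> mr q u 0) (at 0 within {0..})"
    using mr_cont by (auto simp: continuous_on_def)
  then have "(mr q u \<longlongrightarrow> mr q u 0) (at_right 0)"
    by (rule tendsto_mono[rotated]) (auto intro: at_le)
  then show "(mr q u \<longlongrightarrow> 0) (at_right 0)" by (simp add: mr_0)
  show "\<forall>\<^sub>F t in at_right 0. mr q u t \<in> {0<..} - {0}"
    unfolding eventually_at_right_field using mr_pos by (intro exI[of _ 1]) force
qed

lemma zo_profile:
  assumes est: "\<And>T. T \<in> {0..1} \<Longrightarrow> norm (u T - (S0, Q0, 0)) \<le> C * T"
  shows "zo (mS u) S0" "zo (mQ u) Q0" "zo (mP q u) (cq q * S0)"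
proof -
  have e: "\<bar>mS u R - S0\<bar> \<le> C * R\<^sup>2" "\<bar>fst (snd (u (R\<^sup>2))) - Q0\<bar> \<le> C * R\<^sup>2" "\<bar>md u R\<bar> \<le> C * R\<^sup>2"
    if R: "0 < R" "R < 1" for R
  proof -
    have "norm (u (R\<^sup>2) - (S0, Q0, 0)) \<le> C * R\<^sup>2" using R by (intro est) (auto simp: power_le_one)
    then show "\<bar>mS u R - S0\<bar> \<le> C * R\<^sup>2" "\<bar>fst (snd (u (R\<^sup>2))) - Q0\<bar> \<le> C * R\<^sup>2" "\<bar>md u R\<bar> \<le> C * R\<^sup>2"
      using norm_components[of "u (R\<^sup>2) - (S0, Q0, 0)"] by (auto simp: mS_def md_def)
  qed
  show "zo (mS u) S0" using e(1) by (rule zoI)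
  show "zo (mQ u) Q0"
  proof (rule zoI)
    fix R :: real assume R: "0 < R" "R < 1"
    have "mQ u R - Q0 = (fst (snd (u (R\<^sup>2))) - Q0) - md u R / 2" by (simp add: mQ_def)
    then show "\<bar>mQ u R - Q0\<bar> \<le> 2 * C * R\<^sup>2" using e(2,3)[OF R] by linarith
  qed
  show "zo (mP q u) (cq q * S0)"
  proof (rule zoI)
    fix R :: real assume R: "0 < R" "R < 1"
    have c: "0 \<le> cq q" "cq q \<le> 1" using q by (auto simp: cq_def)
    have gen: "\<bar>a + b\<bar> \<le> 2 * k" if "\<bar>b\<bar> \<le> 1 * x" "x \<le> k" "\<bar>a\<bar> \<le> k" for a b x k :: real
      using that by linarith
    have eq: "mP q u R - cq q * S0 = md u R + cq q * (mS u R - S0)" by (simp add: mP_def algebra_simps)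
    have "\<bar>cq q * (mS u R - S0)\<bar> \<le> 1 * \<bar>mS u R - S0\<bar>"
      unfolding abs_mult using c by (intro mult_right_mono) auto
    then show "\<bar>mP q u R - cq q * S0\<bar> \<le> 2 * C * R\<^sup>2"
      unfolding eq mult.assoc[of 2] using gen[OF _ e(1)[OF R] e(3)[OF R]] by blast
  qed
qed

text \<open>The derivative of y carries a factor R, so y leaves its initial value 1 only
  quadratically.\<close>

lemma zo_my: "zo (my q u) 1"
proof -
  define f where "f \<rho> = my q u \<rho> * (\<rho> * mpsi q u \<rho>)" for \<rho>
  have "continuous_on {0..1} (\<lambda>\<rho>. my q u \<rho> * mpsi q u \<rho>)"
    by (intro continuous_intros continuous_on_subset[OF conts(7)] continuous_on_subset[OF conts(8)]) auto
  then have "bounded ((\<lambda>\<rho>. my q u \<rho> * mpsi q u \<rho>) ` {0..1})"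
    by (intro compact_imp_bounded compact_continuous_image) auto
  then obtain B where "\<forall>\<rho>\<in>{0..1}. \<bar>my q u \<rho> * mpsi q u \<rho>\<bar> \<le> B"
    by (auto simp: bounded_iff)
  then have B: "\<bar>my q u \<rho> * mpsi q u \<rho>\<bar> \<le> B" if "\<rho> \<in> {0..1}" for \<rho> using that by blast
  show ?thesis
  proof (rule zoI)
    fix R :: real assume R: "0 < R" "R < 1"
    have cf: "continuous_on {0..R} f"
      unfolding f_def by (intro continuous_intros continuous_on_subset[OF conts(7)] continuous_on_subset[OF conts(8)]) auto
    have "(f has_integral (my q u R - my q u 0)) {0..R}"
    proof (rule fundamental_theorem_of_calculus_interior)
      show "continuous_on {0..R} (my q u)" by (rule continuous_on_subset[OF conts(8)]) auto
      fix x assume "x \<in> {0<..<R}"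
      then show "(my q u has_vector_derivative f x) (at x)"
        using my_deriv[of x] by (simp add: f_def has_real_derivative_iff_has_vector_derivative)
    qed (use R in simp)
    then have "my q u R - 1 = integral {0..R} f" by (simp add: my_0 integral_unique)
    also have "norm \<dots> \<le> (B * R) * (R - 0)"
    proof (rule integral_bound[OF _ cf])
      fix t assume t: "t \<in> {0..R}"
      have "norm (f t) = \<bar>my q u t * mpsi q u t\<bar> * t" using t by (simp add: f_def abs_mult)
      also have "\<dots> \<le> B * R" using B[of t] t R by (intro mult_mono) auto
      finally show "norm (f t) \<le> B * R" .
    qed (use R in simp)
    finally show "\<bar>my q u R - 1\<bar> \<le> B * R\<^sup>2" by (simp add: power2_eq_square mult_ac)
  qed
qed

text \<open>The values of S0 and Q0 are dictated by two of the eight entries: s / N has first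
  coefficient S0 / 3, to be 3 w, and \<theta> N / L has first coefficient (3 - c) S0 - 2 Q0, to be -
  18 s1. The other six entries then agree.\<close>

lemma expansion:
  assumes est: "\<And>T. T \<in> {0..1} \<Longrightarrow> norm (u T - (S0, Q0, 0)) \<le> C * T"
    and S0: "S0 = 9 * w" and Q0: "Q0 = 9 * s1 + (27 - 9 * cq q) / 2 * w"
  shows "\<exists>\<eta>. (\<forall>t>0. (\<eta> has_real_derivative mtr q (mm q u t)) (at t)) \<and>
    filterlim \<eta> at_bot (at_right 0) \<and>
    (\<lambda>t. norm (mXZ q (mm q u t) - (coeff0 + exp (2 * \<eta> t / 3) *\<^sub>R coeff1 q s1 w)))
      \<in> O[at_right 0](\<lambda>t. exp ((2 / 3 + 2 / 3) * \<eta> t))"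
proof -
  define s where "s R = R\<^sup>2 * mS u R" for R
  define pr :: "real \<times> real \<times> real \<times> real \<Rightarrow> real" where
    "pr m = (fst m)\<^sup>2 * (fst (snd m))\<^sup>2 * (fst (snd (snd m)))\<^sup>2 * snd (snd (snd m))" for m
  \<comment> \<open>x^2 y^2 z^2 F has logarithmic derivative tr L. The additive constant is chosen
    so that exp (2 \<eta> / 3) = R^2 (1 + O(R^2)); without it the coefficients would be
    rescaled.\<close>
  define \<eta> where "\<eta> t = ln (pr (mm q u t)) - 3 / 2 * ln S0" for t
  define G where "G R = my q u R ^ 14 * ((mS u R / S0) ^ 3 * (ml q u R * (mth u R)\<^sup>2))" for R
  define E where "E R = exp (2 * (ln (pr (met q u R)) - 3 / 2 * ln S0) / 3)" for R
  note zp = zo_profile[OF est]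
  have fs: "fo s 0 S0" unfolding s_def by (rule fo_sq_mult[OF zp(1)])
  have fh: "fo (mth u) 1 (- Q0)"
    unfolding mth_def[abs_def] using fo_diff[OF fo_const[of 1] fo_sq_mult[OF zp(2)]] by simp
  have fl: "fo (ml q u) 1 (cq q * S0)"
    unfolding ml_def[abs_def] using fo_add[OF fo_const[of 1] fo_sq_mult[OF zp(3)]] by simp
  have "0 < pr m" if "all_pos m" for m
    using that by (cases m) (simp add: pr_def)
  then have pr_pos: "0 < pr (met q u R)" if "0 < R" for R
    using met_pos[OF that] by blast
  have pr2: "(pr (met q u R))\<^sup>2 = R ^ 6 * S0 ^ 3 * G R" if R: "0 < R" for R
  proof -
    have r: "0 \<le> mS u R" "0 < ml q u R" using region(1,8)[of R] R by auto
    define x l where "x = sqrt (mS u R)" and "l = sqrt (ml q u R)"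
    have xl: "mS u R = x\<^sup>2" "ml q u R = l\<^sup>2" "l \<noteq> 0" using r by (auto simp: x_def l_def)
    have "pr (met q u R) = (R * my q u R * x)\<^sup>2 * (my q u R)\<^sup>2 * (my q u R * l)\<^sup>2 * (mth u R * R * my q u R * x / l)"
      by (simp add: pr_def met_def x_def l_def)
    also have "\<dots> = R ^ 3 * my q u R ^ 7 * x ^ 3 * l * mth u R"
      using xl(3) by (simp add: power_mult_distrib power2_eq_square eval_nat_numeral)
    finally have "(pr (met q u R))\<^sup>2 = R ^ 6 * my q u R ^ 14 * x ^ 6 * l\<^sup>2 * (mth u R)\<^sup>2"
      by (simp add: power_mult_distrib flip: power_mult)
    moreover have "x ^ 6 = S0 ^ 3 * (x\<^sup>2 / S0) ^ 3" using ic by (simp add: power_divide flip: power_mult)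
    ultimately show ?thesis unfolding G_def xl by simp
  qed
  have Gpos: "0 < G R" if "0 < R" for R
    using region(1,4,8)[of R] that my_pos[of R] ic unfolding G_def by (intro mult_pos_pos zero_less_power divide_pos_pos) auto
  have E3: "E R ^ 3 = R ^ 6 * G R" if R: "0 < R" for R
  proof -
    have "E R ^ 3 = exp (2 * (ln (pr (met q u R)) - 3 / 2 * ln S0))"
      unfolding E_def by (simp flip: exp_of_nat_mult)
    also have "\<dots> = exp (ln ((pr (met q u R))\<^sup>2) - ln (S0 ^ 3))"
      using pr_pos[OF R] ic by (simp add: ln_realpow)
    also have "\<dots> = R ^ 6 * G R"
      using pr_pos[OF R] ic R Gpos[OF R] unfolding pr2[OF R] by (simp add: exp_diff)
    finally show ?thesis .
  qed
  have zG: "zo G 1"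
  proof -
    have 1: "zo (\<lambda>R. mS u R / S0) 1"
      using zo_mult[OF zp(1), of "\<lambda>_. 1 / S0" "1 / S0"] ic by (simp add: zo_def)
    have "zo G (1 ^ 14 * (1 ^ 3 * (1 * 1\<^sup>2)))"
      unfolding G_def[abs_def] by (intro zo_mult zo_power zo_my 1 fo_imp_zo[OF fl] fo_imp_zo[OF fh])
    then show ?thesis by simp
  qed
  define v where "v R = E R / R\<^sup>2" for R
  \<comment> \<open>v is the cube root of G. Since v^3 - 1 = (v - 1) (v^2 + v + 1) with second
    factor at least 1, an estimate for G passes to v without differentiating a root.\<close>
  have vle: "\<bar>v R - 1\<bar> \<le> \<bar>G R - 1\<bar>" if R: "0 < R" for R
  proof -
    have v3: "v R ^ 3 = G R" using E3[OF R] R by (simp add: v_def power_divide flip: power_mult)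
    have "0 < v R" using R by (simp add: v_def E_def)
    then have "1 \<le> (v R)\<^sup>2 + v R + 1" by simp
    moreover have "G R - 1 = (v R - 1) * ((v R)\<^sup>2 + v R + 1)"
      unfolding v3[symmetric] by (simp add: power2_eq_square power3_eq_cube algebra_simps)
    ultimately show ?thesis
      using mult_left_mono[of 1 "(v R)\<^sup>2 + v R + 1" "\<bar>v R - 1\<bar>"] by (simp add: abs_mult)
  qed
  have evR: "\<forall>\<^sub>F R::real in at_right 0. 0 < R" by (simp add: eventually_at_right_less)
  have zv: "zo v 1"
    unfolding zo_def
  proof (rule landau_o.big_trans)
    show "(\<lambda>R. v R - 1) \<in> O[at_right 0](\<lambda>R. G R - 1)"
      by (rule bigoI[of _ 1]) (rule eventually_mono[OF evR], use vle in simp)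
    show "(\<lambda>R. G R - 1) \<in> O[at_right 0](\<lambda>R. R\<^sup>2)" using zG by (simp add: zo_def)
  qed
  have fE: "fo E 0 1"
  proof -
    have "fo (\<lambda>R. R\<^sup>2 * v R) 0 1" by (rule fo_sq_mult[OF zv])
    moreover have "\<forall>\<^sub>F R in at_right 0. R\<^sup>2 * v R - (0 + 1 * R\<^sup>2) = E R - (0 + 1 * R\<^sup>2)"
      by (rule eventually_mono[OF evR]) (simp add: v_def)
    ultimately show ?thesis unfolding fo_def by (simp only: landau_o.big.in_cong)
  qed
  \<comment> \<open>R^2 and exp (2 \<eta> / 3) are comparable, so an error of order R^4 is of order
    exp (4 \<eta> / 3). This gives \<delta> = 2/3.\<close>
  have R4: "(\<lambda>R. R ^ 4) \<in> O[at_right 0](\<lambda>R. (E R)\<^sup>2)"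
  proof (rule bigoI[of _ 4])
    have "\<forall>\<^sub>F R in at_right 0. 1 / 2 < v R" by (rule order_tendstoD(1)[OF zo_tendsto[OF zv]]) simp
    then show "\<forall>\<^sub>F R in at_right 0. norm (R ^ 4) \<le> 4 * norm ((E R)\<^sup>2)"
      using evR
    proof eventually_elim
      case (elim R)
      then have "R\<^sup>2 \<le> 2 * E R" by (simp add: v_def field_simps)
      then have "(R\<^sup>2)\<^sup>2 \<le> (2 * E R)\<^sup>2" by (intro power_mono) auto
      then show ?case by (simp add: power_mult_distrib flip: power_mult)
    qed
  qed
  have err: "(\<lambda>R. norm (f R - (a + E R * b))) \<in> O[at_right 0](\<lambda>R. (E R)\<^sup>2)" if "fo f a b" for f a b
  proof -
    have "fo (\<lambda>R. f R - E R * b) (a - 0) (b - b)"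
      using fo_diff[OF that fo_mult[OF fE fo_const[of b]]] by simp
    then have "(\<lambda>R. f R - E R * b - a) \<in> O[at_right 0](\<lambda>R. R ^ 4)" by (simp add: fo_def)
    then have "(\<lambda>R. f R - (a + E R * b)) \<in> O[at_right 0](\<lambda>R. R ^ 4)" by (simp add: algebra_simps)
    then show ?thesis by (intro landau_o.big_trans[OF _ R4]) simp
  qed
  define N where "N = (\<lambda>R. Ntr q (s R) (mth u R) (ml q u R))"
  define B where "B = (\<lambda>R. 1 + q * s R - (1 + q) * s R / ml q u R)"
  have fB: "fo B 1 (- S0)"
    unfolding B_def
    by (rule fo_cong_coeffs[OF fo_diff[OF fo_add[OF fo_const fo_mult[OF fo_const fs]] fo_divide[OF fo_mult[OF fo_const fs] fl]]])
      (simp_all add: algebra_simps)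
  have fhB: "fo (\<lambda>R. mth u R * B R) 1 (- S0 - Q0)"
    by (rule fo_cong_coeffs[OF fo_mult[OF fh fB]]) simp_all
  have fN: "fo N 3 (3 * S0 + 2 * cq q * S0 + Q0)"
    unfolding N_def Ntr_def B_def[symmetric, THEN fun_cong]
    by (rule fo_cong_coeffs[OF fo_diff[OF fo_mult[OF fo_const fo_add[OF fo_add[OF fo_const fs] fl]] fhB]])
      simp_all
  have N0: "(3::real) \<noteq> 0" "(1::real) \<noteq> 0" by auto
  have c1: "fo (\<lambda>R. (1 + ml q u R - s R - mth u R) / N R) (1/3) (2 * s1 - 3 * w)"
    by (rule fo_cong_coeffs[OF fo_divide[OF fo_diff[OF fo_diff[OF fo_add[OF fo_const fl] fs] fh] fN N0(1)]])
      (simp_all add: S0 Q0 cq_def field_simps)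
  have c2: "fo (\<lambda>R. (ml q u R - 1 + s R - q * mth u R * s R) / N R) 0 ((4 - q) * w)"
    by (rule fo_cong_coeffs[OF fo_divide[OF fo_diff[OF fo_add[OF fo_diff[OF fl fo_const] fs] fo_mult[OF fo_mult[OF fo_const fh] fs]] fN N0(1)]])
      (simp_all add: S0 Q0 cq_def field_simps)
  have c3: "fo (\<lambda>R. (1 - ml q u R + s R + (1 + q) * mth u R * s R / ml q u R) / N R) 0 ((5 + q) * w)"
    by (rule fo_cong_coeffs[OF fo_divide[OF fo_add[OF fo_add[OF fo_diff[OF fo_const fl] fs] fo_divide[OF fo_mult[OF fo_mult[OF fo_const fh] fs] fl N0(2)]] fN N0(1)]])
      (simp_all add: S0 Q0 cq_def field_simps)
  have c4: "fo (\<lambda>R. mth u R * B R / N R) (1/3) (- 4 * s1 - 12 * w)"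
    by (rule fo_cong_coeffs[OF fo_divide[OF fhB fN N0(1)]]) (simp_all add: S0 Q0 cq_def field_simps)
  have c5: "fo (\<lambda>R. s R / N R) 0 (3 * w)"
    by (rule fo_cong_coeffs[OF fo_divide[OF fs fN N0(1)]]) (simp_all add: S0 Q0 cq_def field_simps)
  have c6: "fo (\<lambda>R. 1 / N R) (1/3) (- s1 - (5 + q) * w)"
    by (rule fo_cong_coeffs[OF fo_divide[OF fo_const fN N0(1)]]) (simp_all add: S0 Q0 cq_def field_simps)
  have c7: "fo (\<lambda>R. ml q u R / N R) (1/3) (- s1 - (4 - q) * w)"
    by (rule fo_cong_coeffs[OF fo_divide[OF fl fN N0(1)]]) (simp_all add: S0 Q0 cq_def field_simps)
  have c8: "fo (\<lambda>R. mth u R * N R / ml q u R) 3 (- 18 * s1)"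
    by (rule fo_cong_coeffs[OF fo_divide[OF fo_mult[OF fh fN] fl N0(2)]]) (simp_all add: S0 Q0 cq_def field_simps)
  have total: "(\<lambda>R. norm (nXZ q (s R) (mth u R) (ml q u R) - (coeff0 + E R *\<^sub>R coeff1 q s1 w))) \<in> O[at_right 0](\<lambda>R. (E R)\<^sup>2)"
    unfolding nXZ_def coeff0_def coeff1_def scaleR_Pair add_Pair diff_Pair real_scaleR_def
      N_def[symmetric, THEN fun_cong] B_def[symmetric, THEN fun_cong]
    by (intro bigo_norm_Pair err c1 c2 c3 c4 c5 c6 c7 c8)
  have eqR: "mXZ q (met q u R) = nXZ q (s R) (mth u R) (ml q u R)" if R: "0 < R" for R
  proof -
    have r: "0 < mS u R" "0 < ml q u R" "0 < mth u R" using region(1,4,8)[of R] R by auto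
    then show ?thesis
      using mXZ_normal_form(2)[of "sqrt (mS u R)" "sqrt (ml q u R)" "my q u R" R "mth u R" q] my_pos R
      by (simp add: met_def s_def)
  qed
  have E_eta: "exp (2 * \<eta> t / 3) = E (mr q u t)" for t by (simp add: \<eta>_def E_def mm_def)
  show ?thesis
  proof (intro exI[of _ \<eta>] conjI allI impI)
    fix t :: real assume t: "0 < t"
    obtain x y z F x' y' z' F' where m: "mm q u t = (x, y, z, F)" and f: "mfield q (mm q u t) = (x', y', z', F')"
      by (metis prod_cases4)
    have pos: "0 < x" "0 < y" "0 < z" "0 < F" using mm_pos[OF t] m by auto
    note d = mm_deriv[OF t, unfolded f]
    note d1 = bounded_linear.has_vector_derivative[OF bounded_linear_fst d, folded has_real_derivative_iff_has_vector_derivative]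
    note e1 = bounded_linear.has_vector_derivative[OF bounded_linear_snd d]
    note d2 = bounded_linear.has_vector_derivative[OF bounded_linear_fst e1, folded has_real_derivative_iff_has_vector_derivative]
    note e2 = bounded_linear.has_vector_derivative[OF bounded_linear_snd e1]
    note d3 = bounded_linear.has_vector_derivative[OF bounded_linear_fst e2, folded has_real_derivative_iff_has_vector_derivative]
    note d4 = bounded_linear.has_vector_derivative[OF bounded_linear_snd e2, folded has_real_derivative_iff_has_vector_derivative]
    have dpr: "((\<lambda>t. pr (mm q u t)) has_real_derivative pr (mm q u t) * mtr q (mm q u t)) (at t)"
      unfolding pr_def mtr_def f
      by (rule derivative_eq_intros d1 d2 d3 d4 refl)+
        (use pos in \<open>simp add: m field_simps power2_eq_square\<close>)
    have "0 < pr (mm q u t)" using pos by (simp add: pr_def m)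
    then show "(\<eta> has_real_derivative mtr q (mm q u t)) (at t)"
      unfolding \<eta>_def[abs_def] by (auto intro!: derivative_eq_intros dpr)
  next
    have "(met q u \<longlongrightarrow> met q u 0) (at 0 within {0..})" using conts(11) by (auto simp: continuous_on_def)
    then have "(met q u \<longlongrightarrow> (0, 1, 1, 0)) (at_right 0)" unfolding met_0
      by (rule tendsto_mono[rotated]) (auto intro: at_le)
    then have "((\<lambda>R. pr (met q u R)) \<longlongrightarrow> pr (0, 1, 1, 0)) (at_right 0)"
      unfolding pr_def by (intro tendsto_intros)
    then have "((\<lambda>R. pr (met q u R)) \<longlongrightarrow> 0) (at_right 0)" by (simp add: pr_def)
    then have "filterlim (\<lambda>R. pr (met q u R)) (at_right 0) (at_right 0)"
      by (rule filterlim_at_withinI) (rule eventually_mono[OF evR], use pr_pos in force)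
    then have "filterlim (\<lambda>R. ln (pr (met q u R))) at_bot (at_right 0)"
      by (rule filterlim_compose[OF ln_at_0])
    then have l: "filterlim (\<lambda>t. ln (pr (mm q u t))) at_bot (at_right 0)"
      unfolding mm_def by (rule filterlim_compose[OF _ mr_at_right_0])
    show "filterlim \<eta> at_bot (at_right 0)"
      unfolding filterlim_at_bot
    proof
      fix Z
      have "\<forall>\<^sub>F t in at_right 0. ln (pr (mm q u t)) \<le> Z + 3 / 2 * ln S0"
        using l unfolding filterlim_at_bot by blast
      then show "\<forall>\<^sub>F t in at_right 0. \<eta> t \<le> Z" by eventually_elim (simp add: \<eta>_def)
    qed
  next
    have "(\<lambda>R. norm (mXZ q (met q u R) - (coeff0 + E R *\<^sub>R coeff1 q s1 w))) \<in> O[at_right 0](\<lambda>R. (E R)\<^sup>2)"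
      using total by (rule landau_o.big.in_cong[THEN iffD1, rotated]) (rule eventually_mono[OF evR], simp add: eqR)
    from landau_o.big.compose[OF this mr_at_right_0]
    have "(\<lambda>t. norm (mXZ q (mm q u t) - (coeff0 + exp (2 * \<eta> t / 3) *\<^sub>R coeff1 q s1 w))) \<in> O[at_right 0](\<lambda>t. (exp (2 * \<eta> t / 3))\<^sup>2)"
      by (simp add: E_eta mm_def)
    then show "(\<lambda>t. norm (mXZ q (mm q u t) - (coeff0 + exp (2 * \<eta> t / 3) *\<^sub>R coeff1 q s1 w))) \<in> O[at_right 0](\<lambda>t. exp ((2 / 3 + 2 / 3) * \<eta> t))"
      by (simp flip: exp_of_nat_mult)
  qed
qed

end

section \<open>Uniqueness\<close>

lemma continuous_on_extend_0:
  fixes f :: "real \<Rightarrow> 'b::topological_space"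
  assumes c: "continuous_on {0<..b} f" and l: "(f \<longlongrightarrow> L) (at_right 0)"
  shows "continuous_on {0..b} (\<lambda>t. if t = 0 then L else f t)"
proof -
  define g where "g t = (if t = 0 then L else f t)" for t
  have "continuous_on {0..b} g"
    unfolding continuous_on_def
  proof
    fix t assume t: "t \<in> {0..b}"
    show "(g \<longlongrightarrow> g t) (at t within {0..b})"
    proof (cases "t = 0")
      case True
      have "(f \<longlongrightarrow> L) (at 0 within {0..b})"
        by (rule tendsto_mono[OF _ l], unfold at_within_def, rule inf_mono[OF order_refl]) auto
      then have "(g \<longlongrightarrow> L) (at 0 within {0..b})"
        by (rule Lim_transform_eventually) (auto simp: eventually_at_filter g_def)
      then show ?thesis using True by (simp add: g_def)
    next
      case False
      then have t0: "0 < t" "t \<in> {0<..b}" using t by auto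
      have "(f \<longlongrightarrow> f t) (at t within {0<..b})" using c t0 by (auto simp: continuous_on_def)
      moreover have "at t within {0<..b} = at t within {0..b}"
        by (rule at_within_nhd[of t "{0<..}"]) (use t0 in auto)
      ultimately have "(f \<longlongrightarrow> f t) (at t within {0..b})" by simp
      moreover have "\<forall>\<^sub>F x in at t within {0..b}. f x = g x"
        unfolding eventually_at_topological
        by (intro exI[of _ "{0<..}"]) (use t0 in \<open>auto simp: g_def\<close>)
      ultimately show ?thesis using False by (auto simp: g_def intro: Lim_transform_eventually)
    qed
  qed
  then show ?thesis by (simp add: g_def[abs_def])
qed

lemma bounded_of_limit_at_right_0:
  fixes f :: "real \<Rightarrow> 'b::real_normed_vector"
  assumes c: "continuous_on {0<..b} f" and l: "(f \<longlongrightarrow> L) (at_right 0)"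
  obtains B where "0 \<le> B" "\<And>t. 0 < t \<Longrightarrow> t \<le> b \<Longrightarrow> norm (f t) \<le> B"
proof -
  define g where "g t = (if t = 0 then L else f t)" for t
  have "continuous_on {0..b} g"
    unfolding g_def[abs_def] by (rule continuous_on_extend_0[OF c l])
  then have "bounded (g ` {0..b})" by (intro compact_imp_bounded compact_continuous_image) auto
  then obtain B where B: "\<forall>t\<in>{0..b}. norm (g t) \<le> B" by (auto simp: bounded_iff)
  show thesis
  proof (rule that[of "max 0 B"])
    fix t assume "0 < t" "t \<le> b"
    then show "norm (f t) \<le> max 0 B" using B[rule_format, of t] by (auto simp: g_def)
  qed simp
qed

text \<open>Monotonicity on the open interval, with the initial value replaced by a limit, since a
  metric is not defined at the singular orbit.\<close>

lemma nonincreasing_from_limit_0: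
  fixes f :: "real \<Rightarrow> real"
  assumes der: "\<And>t. 0 < t \<Longrightarrow> t < \<tau> \<Longrightarrow> \<exists>D. (f has_real_derivative D) (at t) \<and> D \<le> 0"
    and l: "(f \<longlongrightarrow> c) (at_right 0)" and t: "0 < t" "t < \<tau>"
  shows "f t \<le> c"
proof (rule tendsto_lowerbound[OF l])
  have "\<forall>\<^sub>F x in at_right 0. 0 < x \<and> x < t"
    using t unfolding eventually_at_right_field by (intro exI[of _ t]) auto
  then show "\<forall>\<^sub>F x in at_right 0. f t \<le> f x"
  proof eventually_elim
    case (elim x)
    show ?case
    proof (rule DERIV_nonpos_imp_nonincreasing[of x t f])
      show "x \<le> t" using elim by simp
      fix y assume "x \<le> y" "y \<le> t"
      then show "\<exists>D. (f has_real_derivative D) (at y) \<and> D \<le> 0"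
        using der[of y] elim t by auto
    qed
  qed
qed simp

lemma constant_from_limit_0:
  fixes f :: "real \<Rightarrow> real"
  assumes der: "\<And>t. 0 < t \<Longrightarrow> t < \<tau> \<Longrightarrow> (f has_real_derivative 0) (at t)"
    and l: "(f \<longlongrightarrow> c) (at_right 0)" and t: "0 < t" "t < \<tau>"
  shows "f t = c"
proof (rule antisym)
  show "f t \<le> c"
    by (rule nonincreasing_from_limit_0[OF _ l t]) (use der in blast)
  have "- f t \<le> - c"
  proof (rule nonincreasing_from_limit_0[OF _ tendsto_minus[OF l] t])
    fix r assume r: "0 < r" "r < \<tau>"
    show "\<exists>D. ((\<lambda>x. - f x) has_real_derivative D) (at r) \<and> D \<le> 0"
      using DERIV_minus[OF der[OF r]] by auto
  qed
  then show "c \<le> f t" by simp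
qed

section \<open>Solutions with the boundary values of a singular orbit\<close>

lemma mfield_log_derivatives:
  fixes x y z F :: real
  assumes pos: "0 < x" "0 < y" "0 < z" "0 < F"
  defines "s \<equiv> x\<^sup>2 / y\<^sup>2" and "h \<equiv> F * z / (x * y)" and "L \<equiv> z\<^sup>2 / y\<^sup>2" and "k \<equiv> y / (x * z)"
  shows "mfield q (x, y, z, F) = (x * (k * (1 + L - s - h)), y * (k * (L - 1 + s - q * h * s)),
     z * (k * (1 - L + s + (1 + q) * h * s / L)), F * (k * (h * (1 + q * s - (1 + q) * s / L))))"
proof -
  define X l where "X = x / y" and "l = z / y"
  have p: "0 < X" "0 < l" "0 < h" using pos by (auto simp: X_def l_def h_def)
  have n: "(x, y, z, F) = (1 * y * X, y, y * l, h * 1 * y * X / l)"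
    using pos by (simp add: X_def l_def h_def field_simps)
  have e: "s = X\<^sup>2" "L = l\<^sup>2" "k = 1 / (y * X * l)"
    using pos by (simp_all add: s_def L_def k_def X_def l_def power_divide field_simps power2_eq_square)
  have x: "x = y * X" "z = y * l" "F = h * y * X / l" using n by auto
  have 1: "mfield q (x, y, z, F) = ((1 + l\<^sup>2 - 1\<^sup>2 * X\<^sup>2 - h) / l,
     1 * ((l\<^sup>2 - 1) / 1\<^sup>2 + X\<^sup>2 - q * h * X\<^sup>2) / (X * l),
     1 * ((X\<^sup>2 - (l\<^sup>2 - 1) / 1\<^sup>2) / X + (1 + q) * h * X / l\<^sup>2),
     h\<^sup>2 / l\<^sup>2 * (1 + q * 1\<^sup>2 * X\<^sup>2 - (1 + q) * 1\<^sup>2 * X\<^sup>2 / l\<^sup>2))"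
    unfolding n by (rule mfield_normal_form[OF p(1,2) pos(2) zero_less_one p(3)])
  have "x * (k * (1 + L - s - h)) = (1 + l\<^sup>2 - 1\<^sup>2 * X\<^sup>2 - h) / l"
    unfolding e x(1) using p pos(2) by simp
  moreover have "y * (k * (L - 1 + s - q * h * s)) = 1 * ((l\<^sup>2 - 1) / 1\<^sup>2 + X\<^sup>2 - q * h * X\<^sup>2) / (X * l)"
    unfolding e using p pos(2) by simp
  moreover have "z * (k * (1 - L + s + (1 + q) * h * s / L)) = 1 * ((X\<^sup>2 - (l\<^sup>2 - 1) / 1\<^sup>2) / X + (1 + q) * h * X / l\<^sup>2)"
    unfolding e x(2) using p pos(2) by (simp add: field_simps power2_eq_square)
  moreover have "F * (k * (h * (1 + q * s - (1 + q) * s / L))) = h\<^sup>2 / l\<^sup>2 * (1 + q * 1\<^sup>2 * X\<^sup>2 - (1 + q) * 1\<^sup>2 * X\<^sup>2 / l\<^sup>2)"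
    unfolding e x(3) using p pos(2) by (simp add: power2_eq_square)
  ultimately show ?thesis unfolding 1 by simp
qed

text \<open>An arbitrary solution n, known only through the limits of its value and velocity. The
  size y0 of its singular orbit will be the homothety factor.\<close>

locale competitor = profile +
  fixes n :: "real \<Rightarrow> real \<times> real \<times> real \<times> real" and \<tau> y0 :: real
  assumes tau: "0 < \<tau>" and y0: "0 < y0"
    and n_pos: "\<And>t. 0 < t \<Longrightarrow> t < \<tau> \<Longrightarrow> all_pos (n t)"
    and n_der: "\<And>t. 0 < t \<Longrightarrow> t < \<tau> \<Longrightarrow> (n has_vector_derivative mfield q (n t)) (at t)"
    and n_lim: "(n \<longlongrightarrow> (0, y0, y0, 0)) (at_right 0)"
    and v_lim: "((\<lambda>t. mfield q (n t)) \<longlongrightarrow> (1, 0, 0, 1)) (at_right 0)"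
begin

definition "x t = fst (n t)"
definition "y t = fst (snd (n t))"
definition "z t = fst (snd (snd (n t)))"
definition "F t = snd (snd (snd (n t)))"
definition "s t = (x t)\<^sup>2 / (y t)\<^sup>2"
definition "h t = F t * z t / (x t * y t)"
definition "L t = (z t)\<^sup>2 / (y t)\<^sup>2"
definition "k t = y t / (x t * z t)"

lemma n_eq: "n t = (x t, y t, z t, F t)" by (simp add: x_def y_def z_def F_def)

lemma pos:
  assumes "0 < t" "t < \<tau>"
  shows "0 < x t" "0 < y t" "0 < z t" "0 < F t" "0 < s t" "0 < h t" "0 < L t" "0 < k t"
  using n_pos[OF assms] by (auto simp: n_eq s_def h_def L_def k_def)

lemma mfield_n:
  assumes "0 < t" "t < \<tau>"
  shows "mfield q (n t) = (x t * (k t * (1 + L t - s t - h t)), y t * (k t * (L t - 1 + s t - q * h t * s t)),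
     z t * (k t * (1 - L t + s t + (1 + q) * h t * s t / L t)), F t * (k t * (h t * (1 + q * s t - (1 + q) * s t / L t))))"
  using mfield_log_derivatives[OF pos(1-4)[OF assms], of q]
  unfolding s_def[of t, symmetric] h_def[of t, symmetric] L_def[of t, symmetric] k_def[of t, symmetric] n_eq[of t, symmetric] .

lemma derivs:
  assumes t: "0 < t" "t < \<tau>"
  shows "(x has_real_derivative fst (mfield q (n t))) (at t)"
    "(y has_real_derivative fst (snd (mfield q (n t)))) (at t)"
    "(z has_real_derivative fst (snd (snd (mfield q (n t))))) (at t)"
    "(F has_real_derivative snd (snd (snd (mfield q (n t))))) (at t)"
proof -
  note d = n_der[OF t]
  note e1 = bounded_linear.has_vector_derivative[OF bounded_linear_snd d]
  note e2 = bounded_linear.has_vector_derivative[OF bounded_linear_snd e1]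
  show "(x has_real_derivative fst (mfield q (n t))) (at t)"
    "(y has_real_derivative fst (snd (mfield q (n t)))) (at t)"
    "(z has_real_derivative fst (snd (snd (mfield q (n t))))) (at t)"
    "(F has_real_derivative snd (snd (snd (mfield q (n t))))) (at t)"
    unfolding x_def[abs_def] y_def[abs_def] z_def[abs_def] F_def[abs_def] has_real_derivative_iff_has_vector_derivative
    using bounded_linear.has_vector_derivative[OF bounded_linear_fst d]
      bounded_linear.has_vector_derivative[OF bounded_linear_fst e1]
      bounded_linear.has_vector_derivative[OF bounded_linear_fst e2]
      bounded_linear.has_vector_derivative[OF bounded_linear_snd e2] by simp_all
qed

lemma dx: "0 < t \<Longrightarrow> t < \<tau> \<Longrightarrow> (x has_real_derivative x t * (k t * (1 + L t - s t - h t))) (at t)"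
  and dy: "0 < t \<Longrightarrow> t < \<tau> \<Longrightarrow> (y has_real_derivative y t * (k t * (L t - 1 + s t - q * h t * s t))) (at t)"
  and dz: "0 < t \<Longrightarrow> t < \<tau> \<Longrightarrow> (z has_real_derivative z t * (k t * (1 - L t + s t + (1 + q) * h t * s t / L t))) (at t)"
  and dF: "0 < t \<Longrightarrow> t < \<tau> \<Longrightarrow> (F has_real_derivative F t * (k t * (h t * (1 + q * s t - (1 + q) * s t / L t)))) (at t)"
  using derivs[of t] by (simp_all add: mfield_n)

lemma ds:
  assumes t: "0 < t" "t < \<tau>"
  shows "(s has_real_derivative k t * (2 * s t * (2 * (1 - s t) - h t * (1 - q * s t)))) (at t)"
proof -
  have "((\<lambda>t. (x t)\<^sup>2 / (y t)\<^sup>2) has_real_derivative (x t)\<^sup>2 / (y t)\<^sup>2 * (2 * (k t * (1 + L t - s t - h t)) - 2 * (k t * (L t - 1 + s t - q * h t * s t)))) (at t)"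
    by (rule derivative_eq_intros dx dy t refl)+
      (use pos[OF t] in \<open>simp_all add: field_simps power2_eq_square\<close>)
  then show ?thesis
    unfolding s_def[abs_def, symmetric] by (rule DERIV_cong) (simp add: s_def[symmetric] algebra_simps)
qed

lemma dL:
  assumes t: "0 < t" "t < \<tau>"
  shows "(L has_real_derivative k t * (- 4 * L t * (L t - 1) + 2 * h t * s t * (1 + 2 * q + q * (L t - 1)))) (at t)"
proof -
  have "((\<lambda>t. (z t)\<^sup>2 / (y t)\<^sup>2) has_real_derivative (z t)\<^sup>2 / (y t)\<^sup>2 * (2 * (k t * (1 - L t + s t + (1 + q) * h t * s t / L t)) - 2 * (k t * (L t - 1 + s t - q * h t * s t)))) (at t)"
    by (rule derivative_eq_intros dz dy t refl)+
      (use pos[OF t] in \<open>simp_all add: field_simps power2_eq_square\<close>)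
  then show ?thesis
    unfolding L_def[abs_def, symmetric]
    by (rule DERIV_cong) (use pos(7)[OF t] in \<open>simp add: L_def[symmetric] field_simps\<close>)
qed

lemma dh:
  assumes t: "0 < t" "t < \<tau>"
  shows "(h has_real_derivative k t * (h t * (2 * h t * (1 + q * s t) + s t + 1 - 3 * L t))) (at t)"
proof -
  have "((\<lambda>t. F t * z t / (x t * y t)) has_real_derivative F t * z t / (x t * y t) *
     (k t * (h t * (1 + q * s t - (1 + q) * s t / L t)) + k t * (1 - L t + s t + (1 + q) * h t * s t / L t)
      - k t * (1 + L t - s t - h t) - k t * (L t - 1 + s t - q * h t * s t))) (at t)"
    by (rule derivative_eq_intros dF dz dy dx t refl)+
      (use pos(1-4)[OF t] in \<open>simp_all add: field_simps\<close>)
  then show ?thesis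
    unfolding h_def[abs_def, symmetric]
    by (rule DERIV_cong) (use pos(7)[OF t] in \<open>simp add: h_def[symmetric] field_simps\<close>)
qed

lemma ev_interval: "\<forall>\<^sub>F t in at_right 0. 0 < t \<and> t < \<tau>"
  using tau unfolding eventually_at_right_field by (intro exI[of _ \<tau>]) auto

lemma limits:
  "(x \<longlongrightarrow> 0) (at_right 0)" "(y \<longlongrightarrow> y0) (at_right 0)" "(z \<longlongrightarrow> y0) (at_right 0)" "(F \<longlongrightarrow> 0) (at_right 0)"
  "((\<lambda>t. fst (mfield q (n t))) \<longlongrightarrow> 1) (at_right 0)"
  "((\<lambda>t. snd (snd (snd (mfield q (n t))))) \<longlongrightarrow> 1) (at_right 0)"
  unfolding x_def[abs_def] y_def[abs_def] z_def[abs_def] F_def[abs_def]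
  using tendsto_fst[OF n_lim] tendsto_fst[OF tendsto_snd[OF n_lim]] tendsto_fst[OF tendsto_snd[OF tendsto_snd[OF n_lim]]]
    tendsto_snd[OF tendsto_snd[OF tendsto_snd[OF n_lim]]] tendsto_fst[OF v_lim] tendsto_snd[OF tendsto_snd[OF tendsto_snd[OF v_lim]]]
  by simp_all

text \<open>Numerator and denominator both vanish with derivative 1. This limit is what identifies h
  = 1 at the singular orbit.\<close>

lemma Fx_lim: "((\<lambda>t. F t / x t) \<longlongrightarrow> 1) (at_right 0)"
proof (rule lhopital_right_0[where f' = "\<lambda>t. snd (snd (snd (mfield q (n t))))" and g' = "\<lambda>t. fst (mfield q (n t))"])
  show "\<forall>\<^sub>F t in at_right 0. x t \<noteq> 0"
    by (rule eventually_mono[OF ev_interval]) (use pos(1) in force)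
  show "\<forall>\<^sub>F t in at_right 0. fst (mfield q (n t)) \<noteq> 0"
    by (rule tendsto_imp_eventually_ne[OF limits(5)]) simp
  show "\<forall>\<^sub>F t in at_right 0. (F has_real_derivative snd (snd (snd (mfield q (n t))))) (at t)"
    "\<forall>\<^sub>F t in at_right 0. (x has_real_derivative fst (mfield q (n t))) (at t)"
    by (rule eventually_mono[OF ev_interval], use derivs in blast)+
  show "((\<lambda>t. snd (snd (snd (mfield q (n t)))) / fst (mfield q (n t))) \<longlongrightarrow> 1) (at_right 0)"
    using tendsto_divide[OF limits(6,5)] by simp
qed (rule limits)+

lemma s_lim: "(s \<longlongrightarrow> 0) (at_right 0)" and h_lim: "(h \<longlongrightarrow> 1) (at_right 0)" and L_lim: "(L \<longlongrightarrow> 1) (at_right 0)"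
proof -
  have "((\<lambda>t. (x t)\<^sup>2 / (y t)\<^sup>2) \<longlongrightarrow> 0\<^sup>2 / y0\<^sup>2) (at_right 0)"
    by (intro tendsto_intros limits) (use y0 in auto)
  then show "(s \<longlongrightarrow> 0) (at_right 0)" by (simp add: s_def[abs_def])
  have "((\<lambda>t. (F t / x t) * (z t / y t)) \<longlongrightarrow> 1 * (y0 / y0)) (at_right 0)"
    by (intro tendsto_intros limits Fx_lim) (use y0 in auto)
  then show "(h \<longlongrightarrow> 1) (at_right 0)" using y0 by (simp add: h_def[abs_def])
  have "((\<lambda>t. (z t)\<^sup>2 / (y t)\<^sup>2) \<longlongrightarrow> y0\<^sup>2 / y0\<^sup>2) (at_right 0)"
    by (intro tendsto_intros limits) (use y0 in auto)
  then show "(L \<longlongrightarrow> 1) (at_right 0)" using y0 by (simp add: L_def[abs_def])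
qed

text \<open>The factor \<open>x\<^sup>2 F\<^sup>2\<close> is an approximate integrating factor of the linear equation for
  \<open>z\<^sup>2 - y\<^sup>2\<close>; with it, l'Hopital's rule no longer needs to know that the quotient is bounded.\<close>

lemma L_over_s_lim: "((\<lambda>t. (L t - 1) / s t) \<longlongrightarrow> cq q) (at_right 0)"
proof -
  define N D where "N t = ((z t)\<^sup>2 - (y t)\<^sup>2) * (x t)\<^sup>2 * (F t)\<^sup>2" and "D t = (x t) ^ 4 * (F t)\<^sup>2" for t
  define x' F' where "x' t = fst (mfield q (n t))" and "F' t = snd (snd (snd (mfield q (n t))))" for t
  define N' D' where "N' t = (x t) ^ 3 * (F t)\<^sup>2 * (F t / x t * (2 * ((z t)\<^sup>2 - (y t)\<^sup>2) * (q / (y t)\<^sup>2 - (1 + q) / (z t)\<^sup>2) + 2 * (1 + 2 * q)))"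
    and "D' t = (x t) ^ 3 * (F t)\<^sup>2 * (4 * x' t + 2 * F' t / (F t / x t))" for t
  have l6: "((\<lambda>t. 4 * x' t + 2 * F' t / (F t / x t)) \<longlongrightarrow> 4 * 1 + 2 * 1 / 1) (at_right 0)"
    unfolding x'_def F'_def by (intro tendsto_intros limits Fx_lim) simp
  have ne: "\<forall>\<^sub>F t in at_right 0. 4 * x' t + 2 * F' t / (F t / x t) \<noteq> 0"
    by (rule tendsto_imp_eventually_ne[OF l6]) simp
  have "((\<lambda>t. N t / D t) \<longlongrightarrow> cq q) (at_right 0)"
  proof (rule lhopital_right_0[where f' = N' and g' = D'])
    have "((\<lambda>t. ((z t)\<^sup>2 - (y t)\<^sup>2) * (x t)\<^sup>2 * (F t)\<^sup>2) \<longlongrightarrow> (y0\<^sup>2 - y0\<^sup>2) * 0\<^sup>2 * 0\<^sup>2) (at_right 0)"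
      by (intro tendsto_intros limits)
    then show "(N \<longlongrightarrow> 0) (at_right 0)" by (simp add: N_def[abs_def])
    have "((\<lambda>t. (x t) ^ 4 * (F t)\<^sup>2) \<longlongrightarrow> 0 ^ 4 * 0\<^sup>2) (at_right 0)"
      by (intro tendsto_intros limits)
    then show "(D \<longlongrightarrow> 0) (at_right 0)" by (simp add: D_def[abs_def])
    show "\<forall>\<^sub>F t in at_right 0. D t \<noteq> 0"
      by (rule eventually_mono[OF ev_interval]) (use pos(1,4) in \<open>force simp: D_def\<close>)
    show "\<forall>\<^sub>F t in at_right 0. D' t \<noteq> 0"
      using ne ev_interval by eventually_elim (use pos(1,4) in \<open>force simp: D'_def\<close>)
    show "\<forall>\<^sub>F t in at_right 0. (N has_real_derivative N' t) (at t)"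
      using ev_interval
    proof eventually_elim
      case (elim t)
      then have t: "0 < t" "t < \<tau>" by auto
      note p = pos[OF t]
      define a where "a = (z t)\<^sup>2 - (y t)\<^sup>2"
      have m: "mfield q (n t) = mfield q (x t, y t, z t, F t)" by (simp add: n_eq)
      have 1: "((\<lambda>t. (z t)\<^sup>2 - (y t)\<^sup>2) has_real_derivative
          - 2 * ((z t)\<^sup>2 - (y t)\<^sup>2) * (((y t)\<^sup>2 + (z t)\<^sup>2 - (x t)\<^sup>2) / (x t * y t * z t)) + 2 * (1 + 2 * q) * F t) (at t)"
        by (rule derivative_eq_intros derivs t refl)+
          (use p in \<open>simp add: m field_simps power2_eq_square\<close>)
      have x'2: "x' t / x t = ((y t)\<^sup>2 + (z t)\<^sup>2 - (x t)\<^sup>2) / (x t * y t * z t) - F t / (x t)\<^sup>2"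
        using p by (simp add: x'_def m field_simps power2_eq_square)
      have F'2: "F' t / F t = F t / (x t)\<^sup>2 + F t * (q / (y t)\<^sup>2 - (1 + q) / (z t)\<^sup>2)"
        using p by (simp add: F'_def m field_simps power2_eq_square)
      define u v w where "u = ((y t)\<^sup>2 + (z t)\<^sup>2 - (x t)\<^sup>2) / (x t * y t * z t)" and "v = F t / (x t)\<^sup>2"
        and "w = q / (y t)\<^sup>2 - (1 + q) / (z t)\<^sup>2"
      have x'3: "x' t = x t * (u - v)" and F'3: "F' t = F t * (v + F t * w)"
        using x'2[folded u_def v_def] F'2[folded v_def w_def] p by (simp_all add: nonzero_divide_eq_eq mult.commute)
      have vx: "v * (x t)\<^sup>2 = F t" using p by (simp add: v_def)
      have 2: "(N has_real_derivative (- 2 * a * u + 2 * (1 + 2 * q) * F t) * (x t)\<^sup>2 * (F t)\<^sup>2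
          + a * (2 * x t * x' t) * (F t)\<^sup>2 + a * (x t)\<^sup>2 * (2 * F t * F' t)) (at t)"
        unfolding N_def[abs_def] x'_def F'_def
        by (rule 1 derivative_eq_intros derivs t refl)+
          (simp add: a_def u_def algebra_simps)
      \<comment> \<open>The singular contributions cancel: - 2 u from
        \<open>z\<^sup>2 - y\<^sup>2\<close>, 2 (u - v) from \<open>x\<^sup>2\<close> and 2 v from
        \<open>F\<^sup>2\<close>. Only the regular term w and the inhomogeneity survive.\<close>
      have 3: "(- 2 * a * u + 2 * (1 + 2 * q) * F t) * (x t)\<^sup>2 * (F t)\<^sup>2
          + a * (2 * x t * x' t) * (F t)\<^sup>2 + a * (x t)\<^sup>2 * (2 * F t * F' t) =
          (x t)\<^sup>2 * (F t) ^ 3 * (2 * a * w + 2 * (1 + 2 * q))"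
        unfolding x'3 F'3 by (simp add: algebra_simps power2_eq_square power3_eq_cube)
      have 4: "N' t = (x t)\<^sup>2 * (F t) ^ 3 * (2 * a * w + 2 * (1 + 2 * q))"
        using p by (simp add: N'_def a_def w_def power2_eq_square power3_eq_cube)
      show ?case using 2 unfolding 3 4 .
    qed
    show "\<forall>\<^sub>F t in at_right 0. (D has_real_derivative D' t) (at t)"
      using ev_interval
    proof eventually_elim
      case (elim t)
      then have t: "0 < t" "t < \<tau>" by auto
      note p = pos[OF t]
      show ?case
        unfolding D_def[abs_def] D'_def x'_def F'_def
        by (rule derivative_eq_intros derivs t refl)+
          (use p in \<open>simp add: field_simps eval_nat_numeral\<close>)
    qed
    \<comment> \<open>The denominator 6 = 4 + 2 counts the orders of vanishing in x^4 F^2; the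
      quotient 2 (1 + 2 q) / 6 is the slope c again.\<close>
    have val: "(1 * (2 * (y0\<^sup>2 - y0\<^sup>2) * (q / y0\<^sup>2 - (1 + q) / y0\<^sup>2) + 2 * (1 + 2 * q))) / (4 * 1 + 2 * 1 / 1) = cq q"
      by (simp add: cq_def field_simps)
    have "((\<lambda>t. (F t / x t * (2 * ((z t)\<^sup>2 - (y t)\<^sup>2) * (q / (y t)\<^sup>2 - (1 + q) / (z t)\<^sup>2) + 2 * (1 + 2 * q))) /
        (4 * x' t + 2 * F' t / (F t / x t))) \<longlongrightarrow> cq q) (at_right 0)"
      unfolding val[symmetric] by (intro tendsto_intros limits Fx_lim l6) (use y0 in auto)
    then show "((\<lambda>t. N' t / D' t) \<longlongrightarrow> cq q) (at_right 0)"
    proof (rule Lim_transform_eventually)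
      have e: "(c * a) / (c * b) = a / b" if "c \<noteq> 0" for a b c :: real using that by simp
      show "\<forall>\<^sub>F t in at_right 0. (F t / x t * (2 * ((z t)\<^sup>2 - (y t)\<^sup>2) * (q / (y t)\<^sup>2 - (1 + q) / (z t)\<^sup>2) + 2 * (1 + 2 * q))) /
        (4 * x' t + 2 * F' t / (F t / x t)) = N' t / D' t"
        unfolding N'_def D'_def
        by (rule eventually_mono[OF ev_interval], rule e[symmetric]) (use pos(1,4) in force)
    qed
  qed
  then show ?thesis
  proof (rule Lim_transform_eventually)
    show "\<forall>\<^sub>F t in at_right 0. N t / D t = (L t - 1) / s t"
      by (rule eventually_mono[OF ev_interval])
        (use pos(1-4) in \<open>force simp: N_def D_def L_def s_def field_simps eval_nat_numeral\<close>)
  qed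
qed

end

text \<open>The limit of (1 - h) / s is unchanged under a shift of zeta, so it is the invariant that
  selects one profile from the one-parameter family.\<close>

locale matching_competitor = competitor +
  assumes ratio: "((\<lambda>t. (1 - h t) / s t) \<longlongrightarrow> Q0 / S0) (at_right 0)"
begin

lemma conts_n:
  assumes "b < \<tau>"
  shows "continuous_on {0<..b} x" "continuous_on {0<..b} y" "continuous_on {0<..b} z" "continuous_on {0<..b} F"
    "continuous_on {0<..b} s" "continuous_on {0<..b} h" "continuous_on {0<..b} L"
  by (intro continuous_at_imp_continuous_on ballI; (rule DERIV_isCont[OF dx] DERIV_isCont[OF dy] DERIV_isCont[OF dz]
      DERIV_isCont[OF dF] DERIV_isCont[OF ds] DERIV_isCont[OF dh] DERIV_isCont[OF dL]); use assms in auto)+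

text \<open>The logarithmic derivative of s minus 2 k. Although k blows up at t = 0, this difference
  is k s = x / (y z) times a bounded factor, hence integrable from 0. It is the correction that
  turns s into an exact solution of T' = 2 k T.\<close>

definition "hh t = (if t = 0 then 0 else 2 * (x t / (y t * z t)) * ((1 - h t) / s t - 2 + q * h t))"
definition "I t = integral {0..t} hh"

text \<open>The analogue of \<open>e\<^sup>2\<^sup>\<zeta>\<close> for the competitor, normalised so that \<open>s / Tg\<close> tends to \<open>S0\<close>.\<close>

definition "Tg t = s t / S0 * exp (- I t)"

lemma hh_cont: "b < \<tau> \<Longrightarrow> continuous_on {0..b} hh"
  unfolding hh_def[abs_def]
proof (rule continuous_on_extend_0)
  assume b: "b < \<tau>"
  show "continuous_on {0<..b} (\<lambda>t. 2 * (x t / (y t * z t)) * ((1 - h t) / s t - 2 + q * h t))"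
    by (intro continuous_intros conts_n b) (use pos b in force)+
  have "((\<lambda>t. 2 * (x t / (y t * z t)) * ((1 - h t) / s t - 2 + q * h t)) \<longlongrightarrow>
      2 * (0 / (y0 * y0)) * (Q0 / S0 - 2 + q * 1)) (at_right 0)"
    by (intro tendsto_intros limits ratio h_lim) (use y0 in auto)
  then show "((\<lambda>t. 2 * (x t / (y t * z t)) * ((1 - h t) / s t - 2 + q * h t)) \<longlongrightarrow> 0) (at_right 0)" by simp
qed

lemma dI:
  assumes "0 < t" "t < \<tau>"
  shows "(I has_real_derivative hh t) (at t)"
proof -
  define b where "b = (t + \<tau>) / 2"
  have b: "t < b" "b < \<tau>" using assms by (auto simp: b_def)
  have "(I has_real_derivative hh t) (at t within {0..b})"
    unfolding I_def[abs_def] by (rule integral_has_real_derivative[OF hh_cont]) (use b assms in auto)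
  then show ?thesis using b assms by (simp add: at_within_Icc_at)
qed

lemma I_lim: "(I \<longlongrightarrow> 0) (at_right 0)"
proof -
  define b where "b = \<tau> / 2"
  have b: "0 < b" "b < \<tau>" using tau by (auto simp: b_def)
  have "continuous_on {0..b} I"
    unfolding I_def[abs_def]
    by (intro indefinite_integral_continuous_1 integrable_continuous_real hh_cont b)
  then have "(I \<longlongrightarrow> I 0) (at 0 within {0..b})" using b by (auto simp: continuous_on_def)
  then show ?thesis using b by (simp add: at_within_Icc_at_right I_def)
qed

lemma Tg_pos: "0 < t \<Longrightarrow> t < \<tau> \<Longrightarrow> 0 < Tg t"
  using pos(5)[of t] ic by (simp add: Tg_def)

lemma dTg:
  assumes t: "0 < t" "t < \<tau>"
  shows "(Tg has_real_derivative 2 * k t * Tg t) (at t)"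
proof -
  have p: "x t / (y t * z t) = k t * s t" using pos[OF t] by (simp add: k_def s_def field_simps power2_eq_square)
  have "(Tg has_real_derivative Tg t * (k t * (2 * (2 * (1 - s t) - h t * (1 - q * s t))) - hh t)) (at t)"
    unfolding Tg_def[abs_def]
    by (rule DERIV_cong[OF DERIV_mult[OF DERIV_cdivide[OF ds[OF t]] DERIV_fun_exp[OF DERIV_minus[OF dI[OF t]]]]])
      (use ic in \<open>simp add: field_simps\<close>)
  then show ?thesis
    by (rule DERIV_cong) (use pos[OF t] t in \<open>simp add: hh_def p field_simps\<close>)
qed

lemma s_over_Tg: "0 < t \<Longrightarrow> t < \<tau> \<Longrightarrow> s t / Tg t = S0 * exp (I t)"
  using pos(5)[of t] ic by (simp add: Tg_def exp_minus field_simps)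

definition "Sg t = s t / Tg t"
definition "Qg t = (1 - h t) / Tg t"
definition "dg t = (L t - 1) / Tg t - cq q * Sg t"
definition "ug t = (Sg t, Qg t + dg t / 2, dg t)"

text \<open>The competitor starts at the same singular initial value: S by the normalisation of
  \<open>Tg\<close>, Q by \<open>ratio\<close>, and d = 0 by \<open>L_over_s_lim\<close>.\<close>

lemma ug_lim: "(ug \<longlongrightarrow> (S0, Q0, 0)) (at_right 0)"
proof -
  have "((\<lambda>t. S0 * exp (I t)) \<longlongrightarrow> S0 * exp 0) (at_right 0)" by (intro tendsto_intros I_lim)
  then have "((\<lambda>t. S0 * exp (I t)) \<longlongrightarrow> S0) (at_right 0)" by simp
  then have S: "(Sg \<longlongrightarrow> S0) (at_right 0)"
    by (rule Lim_transform_eventually) (rule eventually_mono[OF ev_interval], simp add: s_over_Tg Sg_def)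
  have "((\<lambda>t. (1 - h t) / s t * Sg t) \<longlongrightarrow> Q0 / S0 * S0) (at_right 0)" by (intro tendsto_intros ratio S)
  then have "((\<lambda>t. (1 - h t) / s t * Sg t) \<longlongrightarrow> Q0) (at_right 0)" using ic by simp
  then have Q: "(Qg \<longlongrightarrow> Q0) (at_right 0)"
    by (rule Lim_transform_eventually) (rule eventually_mono[OF ev_interval], use pos(5) in \<open>force simp: Sg_def Qg_def\<close>)
  have "((\<lambda>t. (L t - 1) / s t * Sg t - cq q * Sg t) \<longlongrightarrow> cq q * S0 - cq q * S0) (at_right 0)"
    by (intro tendsto_intros L_over_s_lim S)
  then have "((\<lambda>t. (L t - 1) / s t * Sg t - cq q * Sg t) \<longlongrightarrow> 0) (at_right 0)" by simp
  then have d: "(dg \<longlongrightarrow> 0) (at_right 0)"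
    by (rule Lim_transform_eventually) (rule eventually_mono[OF ev_interval], use pos(5) in \<open>force simp: Sg_def dg_def\<close>)
  have "((\<lambda>t. (Sg t, Qg t + dg t / 2, dg t)) \<longlongrightarrow> (S0, Q0 + 0 / 2, 0)) (at_right 0)"
    by (intro tendsto_intros S Q d) simp
  then show ?thesis by (simp add: ug_def[abs_def])
qed

lemma dug:
  assumes t: "0 < t" "t < \<tau>"
  shows "(ug has_vector_derivative (2 * k t * Tg t) *\<^sub>R (pfield q (Tg t) (ug t) - (0, 0, 3 * snd (snd (ug t)) / Tg t))) (at t)"
proof -
  note p = pos[OF t] and T = Tg_pos[OF t]
  have e: "s t = Tg t * Sg t" "h t = 1 - Tg t * Qg t" "L t = 1 + Tg t * (dg t + cq q * Sg t)"
    using T by (simp_all add: Sg_def Qg_def dg_def)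
  have S: "(Sg has_real_derivative 2 * k t * Tg t * fS q (Tg t) (Sg t) (Qg t) (dg t)) (at t)"
  proof -
    have "(Sg has_real_derivative (k t * (2 * s t * (2 * (1 - s t) - h t * (1 - q * s t))) - 2 * k t * s t) / Tg t) (at t)"
      unfolding Sg_def[abs_def]
      by (rule derivative_eq_intros ds dTg t refl)+ (use T in \<open>simp_all add: field_simps\<close>)
    then show ?thesis
      by (rule DERIV_cong) (use T in \<open>simp add: e fS_def field_simps\<close>)
  qed
  have Q: "(Qg has_real_derivative 2 * k t * Tg t * (fV q (Tg t) (Sg t) (Qg t) (dg t) - fd q (Tg t) (Sg t) (Qg t) (dg t) / 2 + 3 * dg t / (2 * Tg t))) (at t)"
  proof -
    have "(Qg has_real_derivative (- (k t * (h t * (2 * h t * (1 + q * s t) + s t + 1 - 3 * L t))) - 2 * k t * (1 - h t)) / Tg t) (at t)"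
      unfolding Qg_def[abs_def]
      by (rule derivative_eq_intros dh dTg t refl)+ (use T in \<open>simp_all add: field_simps\<close>)
    then show ?thesis
      by (rule DERIV_cong) (use T in \<open>simp add: e fV_def cq_def field_simps power2_eq_square\<close>)
  qed
  have d: "(dg has_real_derivative 2 * k t * Tg t * (fd q (Tg t) (Sg t) (Qg t) (dg t) - 3 * dg t / Tg t)) (at t)"
  proof -
    have "((\<lambda>t. (L t - 1) / Tg t) has_real_derivative (k t * (- 4 * L t * (L t - 1) + 2 * h t * s t * (1 + 2 * q + q * (L t - 1))) - 2 * k t * (L t - 1)) / Tg t) (at t)"
      by (rule derivative_eq_intros dL dTg t refl)+ (use T in \<open>simp_all add: field_simps\<close>)
    from DERIV_diff[OF this DERIV_cmult[OF S, of "cq q"]]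
    show ?thesis
      unfolding dg_def[abs_def, symmetric]
      by (rule DERIV_cong) (use T in \<open>simp add: e fS_def fd_def cq_def field_simps power2_eq_square\<close>)
  qed
  have V: "((\<lambda>t. Qg t + dg t / 2) has_real_derivative 2 * k t * Tg t * fV q (Tg t) (Sg t) (Qg t) (dg t)) (at t)"
    by (rule DERIV_cong[OF DERIV_add[OF Q DERIV_cdivide[OF d, of 2]]]) (use T in \<open>simp add: field_simps\<close>)
  have eq: "(2 * k t * Tg t) *\<^sub>R (pfield q (Tg t) (ug t) - (0, 0, 3 * snd (snd (ug t)) / Tg t)) =
    (2 * k t * Tg t * fS q (Tg t) (Sg t) (Qg t) (dg t), 2 * k t * Tg t * fV q (Tg t) (Sg t) (Qg t) (dg t),
     2 * k t * Tg t * (fd q (Tg t) (Sg t) (Qg t) (dg t) - 3 * dg t / Tg t))"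
    by (simp add: pfield_def ug_def)
  show ?thesis
    unfolding eq unfolding ug_def[abs_def]
    by (intro has_vector_derivative_Pair S[unfolded has_real_derivative_iff_has_vector_derivative]
        V[unfolded has_real_derivative_iff_has_vector_derivative] d[unfolded has_real_derivative_iff_has_vector_derivative])
qed

lemma Tg_lim: "(Tg \<longlongrightarrow> 0) (at_right 0)"
proof -
  have "((\<lambda>t. s t / S0 * exp (- I t)) \<longlongrightarrow> 0 / S0 * exp (- 0)) (at_right 0)"
    by (intro tendsto_intros s_lim I_lim) (use ic in auto)
  then show ?thesis by (simp add: Tg_def[abs_def])
qed

lemma um_lim: "((\<lambda>t. u (Tg t)) \<longlongrightarrow> (S0, Q0, 0)) (at_right 0)"
proof -
  have "(u \<longlongrightarrow> u 0) (at 0 within {0..})" using u_cont by (auto simp: continuous_on_def)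
  then have "(u \<longlongrightarrow> u 0) (at_right 0)" by (rule tendsto_mono[rotated]) (auto intro: at_le)
  moreover have "filterlim Tg (at_right 0) (at_right 0)"
    by (rule filterlim_at_withinI[OF Tg_lim]) (rule eventually_mono[OF ev_interval], use Tg_pos in force)
  ultimately show ?thesis unfolding u_0 by (rule filterlim_compose)
qed

lemma dum:
  assumes t: "0 < t" "t < \<tau>"
  shows "((\<lambda>t. u (Tg t)) has_vector_derivative (2 * k t * Tg t) *\<^sub>R (pfield q (Tg t) (u (Tg t)) - (0, 0, 3 * snd (snd (u (Tg t))) / Tg t))) (at t)"
  using vector_diff_chain_at[OF dTg[OF t, unfolded has_real_derivative_iff_has_vector_derivative] u_der[OF Tg_pos[OF t]]]
  by (simp add: o_def)

text \<open>The difference of two solutions of the singular system satisfies a one-sided Lipschitz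
  estimate, since the singular term \<open>-3 d / T\<close> is dissipative.\<close>

theorem curves_agree:
  assumes t: "0 < t" "t < \<tau>"
  shows "ug t = u (Tg t)"
proof -
  define b where "b = (t + \<tau>) / 2"
  have b: "0 < b" "b < \<tau>" "t < b" using t by (auto simp: b_def)
  have cug: "continuous_on {0<..b} ug" "continuous_on {0<..b} (\<lambda>t. u (Tg t))" "continuous_on {0<..b} Tg"
    using b by (auto intro!: continuous_at_imp_continuous_on has_vector_derivative_continuous[OF dug]
      has_vector_derivative_continuous[OF dum] DERIV_isCont[OF dTg])
  obtain B1 where B1: "0 \<le> B1" "\<And>r. 0 < r \<Longrightarrow> r \<le> b \<Longrightarrow> norm (ug r) \<le> B1"
    using bounded_of_limit_at_right_0[OF cug(1) ug_lim] by blast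
  obtain B2 where B2: "0 \<le> B2" "\<And>r. 0 < r \<Longrightarrow> r \<le> b \<Longrightarrow> norm (u (Tg r)) \<le> B2"
    using bounded_of_limit_at_right_0[OF cug(2) um_lim] by blast
  obtain B3 where B3: "0 \<le> B3" "\<And>r. 0 < r \<Longrightarrow> r \<le> b \<Longrightarrow> norm (Tg r) \<le> B3"
    using bounded_of_limit_at_right_0[OF cug(3) Tg_lim] by blast
  obtain C m where C: "0 \<le> C" "\<And>T x y. 0 \<le> T \<Longrightarrow> clip3 (B1 + B2) x = x \<Longrightarrow> clip3 (B1 + B2) y = y \<Longrightarrow>
        norm (pfield q T x - pfield q T y) \<le> C * (1 + T) ^ m * norm (x - y)"
    using pfield_lipschitz_on_box[of "B1 + B2" q] B1(1) B2(1) by (metis add_nonneg_nonneg)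
  define M where "M = C * (1 + B3) ^ m"
  \<comment> \<open>M bounds the Lipschitz constant of the regular part on a box and time range
    containing both curves, so the exponential makes the squared distance nonincreasing.\<close>
  define W where "W r = (norm (ug r - u (Tg r)))\<^sup>2 * exp (- 2 * M * Tg r)" for r
  have dW: "\<exists>D. (W has_real_derivative D) (at r) \<and> D \<le> 0" if r: "0 < r" "r < b" for r
  proof -
    have r': "r < \<tau>" using r b by simp
    define \<Delta> where "\<Delta> r = ug r - u (Tg r)" for r
    define K where "K = 2 * k r * Tg r"
    have K0: "0 < K" using pos(8)[OF r(1) r'] Tg_pos[OF r(1) r'] by (simp add: K_def)
    define X where "X = pfield q (Tg r) (ug r) - pfield q (Tg r) (u (Tg r))"
    define Y where "Y = (0::real, 0::real, 3 * snd (snd (\<Delta> r)) / Tg r)"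
    have "(\<Delta> has_vector_derivative K *\<^sub>R (X - Y)) (at r)"
    proof -
      have "K *\<^sub>R (X - Y) = K *\<^sub>R (pfield q (Tg r) (ug r) - (0, 0, 3 * snd (snd (ug r)) / Tg r))
          - K *\<^sub>R (pfield q (Tg r) (u (Tg r)) - (0, 0, 3 * snd (snd (u (Tg r))) / Tg r))"
        by (simp add: X_def Y_def \<Delta>_def scaleR_diff_right[symmetric] diff_divide_distrib prod_eq_iff)
      then show ?thesis
        unfolding \<Delta>_def[abs_def] K_def using has_vector_derivative_diff[OF dug[OF r(1) r'] dum[OF r(1) r']] by simp
    qed
    from bounded_bilinear.has_vector_derivative[OF bounded_bilinear_inner this this]
    have dn: "((\<lambda>r. (norm (\<Delta> r))\<^sup>2) has_real_derivative 2 * K * (inner (\<Delta> r) X - inner (\<Delta> r) Y)) (at r)"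
      by (simp add: power2_norm_eq_inner has_real_derivative_iff_has_vector_derivative inner_commute inner_diff_right algebra_simps)
    \<comment> \<open>The singular part contributes a positive multiple of the square of the third
      component, divided by \<open>Tg\<close>; it is simply discarded, whatever its size.\<close>
    have iY: "0 \<le> inner (\<Delta> r) Y"
      using Tg_pos[OF r(1) r'] by (simp add: Y_def inner_prod_def)
    have "norm X \<le> C * (1 + Tg r) ^ m * norm (\<Delta> r)"
      unfolding X_def \<Delta>_def
    proof (rule C(2))
      show "0 \<le> Tg r" using Tg_pos[OF r(1) r'] by simp
      have "norm (ug r) \<le> B1 + B2" "norm (u (Tg r)) \<le> B1 + B2" using B1 B2 r by (auto intro: add_increasing add_increasing2)
      then show "clip3 (B1 + B2) (ug r) = ug r" "clip3 (B1 + B2) (u (Tg r)) = u (Tg r)"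
        using norm_components[of "ug r"] norm_components[of "u (Tg r)"] by (auto intro!: clip3_id)
    qed
    also have "\<dots> \<le> M * norm (\<Delta> r)"
      unfolding M_def using B3(2)[of r] r Tg_pos[OF r(1) r'] C(1)
      by (intro mult_right_mono mult_left_mono power_mono) auto
    finally have "norm (\<Delta> r) * norm X \<le> norm (\<Delta> r) * (M * norm (\<Delta> r))" by (rule mult_left_mono) simp
    then have iX: "inner (\<Delta> r) X \<le> M * (norm (\<Delta> r))\<^sup>2"
      using norm_cauchy_schwarz[of "\<Delta> r" X] by (simp add: power2_eq_square mult_ac)
    have "(W has_real_derivative (2 * K * (inner (\<Delta> r) X - inner (\<Delta> r) Y) - 2 * M * K * (norm (\<Delta> r))\<^sup>2) * exp (- 2 * M * Tg r)) (at r)"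
      unfolding W_def[abs_def] \<Delta>_def[symmetric]
      by (rule dn derivative_eq_intros dTg r r' refl)+ (simp add: K_def algebra_simps)
    moreover have "(2 * K * (inner (\<Delta> r) X - inner (\<Delta> r) Y) - 2 * M * K * (norm (\<Delta> r))\<^sup>2) * exp (- 2 * M * Tg r) \<le> 0"
    proof -
      have "2 * K * (inner (\<Delta> r) X - inner (\<Delta> r) Y) \<le> 2 * K * (M * (norm (\<Delta> r))\<^sup>2)"
        using iX iY K0 by (intro mult_left_mono) auto
      then show ?thesis by (intro mult_nonpos_nonneg) (auto simp: mult_ac)
    qed
    ultimately show ?thesis by blast
  qed
  have "((\<lambda>r. (norm (ug r - u (Tg r)))\<^sup>2 * exp (- 2 * M * Tg r)) \<longlongrightarrow>
      (norm ((S0, Q0, 0) - (S0, Q0, 0::real)))\<^sup>2 * exp (- 2 * M * 0)) (at_right 0)"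
    by (intro tendsto_intros ug_lim um_lim Tg_lim)
  then have Wl: "(W \<longlongrightarrow> 0) (at_right 0)" by (simp add: W_def[abs_def])
  have "W t \<le> 0"
    by (rule nonincreasing_from_limit_0[OF dW Wl t(1) b(3)])
  then show ?thesis by (auto simp: W_def mult_le_0_iff not_le)
qed

definition "\<rho> t = sqrt (Tg t)"

text \<open>Agreement of the curves makes s, h and L those of the profile at R =
  \<open>\<rho> t\<close>. Positivity then allows square roots, which recover the ratios x / y and z
  / y.\<close>

lemma rho:
  assumes t: "0 < t" "t < \<tau>"
  shows "0 < \<rho> t" "(\<rho> t)\<^sup>2 = Tg t" "(\<rho> has_real_derivative k t * \<rho> t) (at t)"
    "s t = (\<rho> t)\<^sup>2 * mS u (\<rho> t)" "h t = mth u (\<rho> t)" "L t = ml q u (\<rho> t)"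
    "k t = 1 / (y t * \<rho> t * (sqrt (mS u (\<rho> t)) * sqrt (ml q u (\<rho> t))))"
    "x t = y t * \<rho> t * sqrt (mS u (\<rho> t))" "z t = y t * sqrt (ml q u (\<rho> t))"
proof -
  note p = pos[OF t] and T = Tg_pos[OF t]
  show r: "0 < \<rho> t" "(\<rho> t)\<^sup>2 = Tg t" using T by (simp_all add: \<rho>_def)
  have "(\<rho> has_real_derivative inverse (sqrt (Tg t)) / 2 * (2 * k t * Tg t)) (at t)"
    unfolding \<rho>_def[abs_def] by (rule DERIV_chain2[OF DERIV_real_sqrt[OF T] dTg[OF t]])
  then show "(\<rho> has_real_derivative k t * \<rho> t) (at t)"
    by (rule DERIV_cong) (use r in \<open>simp add: \<rho>_def[symmetric] r(2)[symmetric] power2_eq_square\<close>)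
  note c = curves_agree[OF t, unfolded ug_def]
  have S: "mS u (\<rho> t) = Sg t" and d: "md u (\<rho> t) = dg t" and Q: "mQ u (\<rho> t) = Qg t"
    unfolding mQ_def mS_def md_def r(2) c[symmetric] by simp_all
  show s: "s t = (\<rho> t)\<^sup>2 * mS u (\<rho> t)" unfolding S r(2) using T by (simp add: Sg_def)
  show "h t = mth u (\<rho> t)" unfolding mth_def Q r(2) using T by (simp add: Qg_def)
  show L: "L t = ml q u (\<rho> t)" unfolding ml_def mP_def S d r(2) using T by (simp add: dg_def)
  have x2: "(x t)\<^sup>2 = (y t * \<rho> t * sqrt (mS u (\<rho> t)))\<^sup>2"
    using s p region(1)[of "\<rho> t"] r by (simp add: s_def power_mult_distrib field_simps)
  have "0 \<le> sqrt (mS u (\<rho> t))" "0 \<le> sqrt (ml q u (\<rho> t))"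
    using region(1,8)[of "\<rho> t"] r(1) by auto
  then have nn: "0 \<le> y t * \<rho> t * sqrt (mS u (\<rho> t))" "0 \<le> y t * sqrt (ml q u (\<rho> t))"
    using p(2) r(1) by (auto intro!: mult_nonneg_nonneg)
  show x: "x t = y t * \<rho> t * sqrt (mS u (\<rho> t))"
    by (rule power2_eq_imp_eq[OF x2 less_imp_le[OF p(1)] nn(1)])
  have z2: "(z t)\<^sup>2 = (y t * sqrt (ml q u (\<rho> t)))\<^sup>2"
    using L p region(8)[of "\<rho> t"] r by (simp add: L_def power_mult_distrib field_simps)
  show z: "z t = y t * sqrt (ml q u (\<rho> t))"
    by (rule power2_eq_imp_eq[OF z2 less_imp_le[OF p(3)] nn(2)])
  show "k t = 1 / (y t * \<rho> t * (sqrt (mS u (\<rho> t)) * sqrt (ml q u (\<rho> t))))"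
    unfolding k_def x z using p by (simp add: field_simps)
qed

lemma rho_lim: "(\<rho> \<longlongrightarrow> 0) (at_right 0)"
  using tendsto_real_sqrt[OF Tg_lim] by (simp add: \<rho>_def[abs_def])

text \<open>The logarithmic derivative of y is determined by s, h and L, so y and the y of the
  profile differ by a constant factor, found at t = 0.\<close>

lemma y_ratio:
  assumes t: "0 < t" "t < \<tau>"
  shows "y t = y0 * my q u (\<rho> t)"
proof -
  have "y t / my q u (\<rho> t) = y0"
  proof (rule constant_from_limit_0[OF _ _ t])
    fix r assume r: "0 < r" "r < \<tau>"
    note R = rho[OF r]
    have dm: "((\<lambda>t. my q u (\<rho> t)) has_real_derivative my q u (\<rho> r) * (\<rho> r * mpsi q u (\<rho> r)) * (k r * \<rho> r)) (at r)"
      by (rule DERIV_chain2[OF my_deriv[OF R(1)] R(3)])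
    have "L r - 1 + s r - q * h r * s r = (\<rho> r)\<^sup>2 * mpsi q u (\<rho> r)"
      unfolding R(4,5,6) by (simp add: ml_def mpsi_def algebra_simps)
    then have "(y has_real_derivative y r * (k r * ((\<rho> r)\<^sup>2 * mpsi q u (\<rho> r)))) (at r)"
      using dy[OF r] by simp
    note dd = DERIV_divide[OF this dm]
    show "((\<lambda>t. y t / my q u (\<rho> t)) has_real_derivative 0) (at r)"
      by (rule DERIV_cong[OF dd]) (use my_pos[of "\<rho> r"] in \<open>simp_all add: power2_eq_square less_imp_neq[symmetric]\<close>)
  next
    have "(my q u \<longlongrightarrow> my q u 0) (at 0 within {0..})" using conts(8) by (auto simp: continuous_on_def)
    then have "(my q u \<longlongrightarrow> 1) (at_right 0)" unfolding my_0 by (rule tendsto_mono[rotated]) (auto intro: at_le)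
    moreover have "filterlim \<rho> (at_right 0) (at_right 0)"
      by (rule filterlim_at_withinI[OF rho_lim]) (rule eventually_mono[OF ev_interval], use rho(1) in force)
    ultimately have "((\<lambda>t. my q u (\<rho> t)) \<longlongrightarrow> 1) (at_right 0)" by (rule filterlim_compose)
    from tendsto_divide[OF limits(2) this]
    show "((\<lambda>t. y t / my q u (\<rho> t)) \<longlongrightarrow> y0) (at_right 0)" by simp
  qed
  then show ?thesis using my_pos[of "\<rho> t"] by (simp add: field_simps)
qed

text \<open>k depends on y as well, so the two arclengths differ by the factor y0.\<close>

lemma rho_eq:
  assumes t: "0 < t" "t < \<tau>"
  shows "\<rho> t = mr q u (t / y0)"
proof -
  have "mt q u (\<rho> t) - t / y0 = 0"
  proof (rule constant_from_limit_0[OF _ _ t])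
    fix r assume r: "0 < r" "r < \<tau>"
    note R = rho[OF r]
    have pp: "0 < sqrt (mS u (\<rho> r))" "0 < sqrt (ml q u (\<rho> r))" using region(1,8)[of "\<rho> r"] R(1) by auto
    have "((\<lambda>t. mt q u (\<rho> t) - t / y0) has_real_derivative mspeed q u (\<rho> r) * (k r * \<rho> r) - 1 / y0) (at r)"
      by (intro DERIV_diff DERIV_chain2[OF mt_deriv[OF R(1)] R(3)] DERIV_cdivide DERIV_ident)
    then show "((\<lambda>t. mt q u (\<rho> t) - t / y0) has_real_derivative 0) (at r)"
      by (rule DERIV_cong)
        (use R(1) pp my_pos[of "\<rho> r"] y0 in \<open>simp add: R(7) y_ratio[OF r] mspeed_def field_simps\<close>)
  next
    have "(mt q u \<longlongrightarrow> mt q u 0) (at 0 within {0..})" using conts(10) by (auto simp: continuous_on_def)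
    then have "(mt q u \<longlongrightarrow> 0) (at_right 0)" unfolding mt_0 by (rule tendsto_mono[rotated]) (auto intro: at_le)
    moreover have "filterlim \<rho> (at_right 0) (at_right 0)"
      by (rule filterlim_at_withinI[OF rho_lim]) (rule eventually_mono[OF ev_interval], use rho(1) in force)
    ultimately have 1: "((\<lambda>t. mt q u (\<rho> t)) \<longlongrightarrow> 0) (at_right 0)" by (rule filterlim_compose)
    have "((\<lambda>t. mt q u (\<rho> t) - t / y0) \<longlongrightarrow> 0 - 0 / y0) (at_right 0)"
      by (intro tendsto_intros 1) (use y0 in auto)
    then show "((\<lambda>t. mt q u (\<rho> t) - t / y0) \<longlongrightarrow> 0) (at_right 0)" by simp
  qed
  then show ?thesis using mr_mt[of "\<rho> t"] rho(1)[OF t] by simp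
qed

theorem competitor_eq:
  assumes t: "0 < t" "t < \<tau>"
  shows "n t = y0 *\<^sub>R mm q u (t / y0)"
proof -
  note R = rho[OF t] and p = pos[OF t]
  have pp: "0 < sqrt (mS u (\<rho> t))" "0 < sqrt (ml q u (\<rho> t))" using region(1,8)[of "\<rho> t"] R(1) by auto
  have "F t = h t * x t * y t / z t" using p by (simp add: h_def)
  also have "\<dots> = y0 * (mth u (\<rho> t) * \<rho> t * my q u (\<rho> t) * sqrt (mS u (\<rho> t)) / sqrt (ml q u (\<rho> t)))"
    unfolding R(8,9) R(5) y_ratio[OF t] using pp my_pos[of "\<rho> t"] y0 by (simp add: field_simps)
  finally show ?thesis
    unfolding mm_def rho_eq[OF t, symmetric] met_def n_eq[of t]
    using R(8,9) y_ratio[OF t] by (simp add: mult_ac)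
qed

end

section \<open>Aloff--Wallach spaces\<close>

type_synonym real4 = "real \<times> real \<times> real \<times> real"

text \<open>Besides rescaling f, the first and third directions are exchanged when the flag is
  false: for i = k it is c, not a, that collapses.\<close>

definition scale_last :: "real \<Rightarrow> bool \<Rightarrow> real4 \<Rightarrow> real4" where
  "scale_last r b m = (if b then (fst m, fst (snd m), fst (snd (snd m)), r * snd (snd (snd m)))
     else (fst (snd (snd m)), fst (snd m), fst m, r * snd (snd (snd m))))"

text \<open>The induced map on (X, Z). Only Z4 = f tr L notices a rescaling of f alone.\<close>

definition scale_last8 :: "real \<Rightarrow> bool \<Rightarrow> real8 \<Rightarrow> real8" where
  "scale_last8 r b = (\<lambda>(X1, X2, X3, X4, Z1, Z2, Z3, Z4).
     if b then (X1, X2, X3, X4, Z1, Z2, Z3, r * Z4) else (X3, X2, X1, X4, Z3, Z2, Z1, r * Z4))"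

lemma linear_scale_last: "linear (scale_last r b)"
  by (rule linearI) (auto simp: scale_last_def algebra_simps)

lemma linear_scale_last8: "linear (scale_last8 r b)"
  by (rule linearI) (auto simp: scale_last8_def algebra_simps split: prod.splits)

lemmas bounded_linear_scale_last = linear_scale_last[THEN linear_conv_bounded_linear[THEN iffD1]]

lemma scale_last_inverse: "r \<noteq> 0 \<Longrightarrow> scale_last r b (scale_last (1 / r) b m) = m"
  by (cases m) (simp add: scale_last_def)

lemma scale_last8_inverse: "r \<noteq> 0 \<Longrightarrow> scale_last8 r b (scale_last8 (1 / r) b m) = m"
  by (auto simp: scale_last8_def split: prod.splits)

lemma all_pos_scale_last: "0 < r \<Longrightarrow> all_pos (scale_last r b m) \<longleftrightarrow> all_pos m"
  by (cases m) (auto simp: scale_last_def zero_less_mult_iff)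

lemma bigo_norm_linear:
  fixes L :: "'a::euclidean_space \<Rightarrow> 'b::euclidean_space"
  assumes "linear L" "(\<lambda>t. norm (f t)) \<in> O[F](h)"
  shows "(\<lambda>t. norm (L (f t))) \<in> O[F](h)"
proof -
  obtain K where K: "\<And>x. norm (L x) \<le> norm x * K"
    using assms(1) bounded_linear.bounded linear_conv_bounded_linear by blast
  show "(\<lambda>t. norm (L (f t))) \<in> O[F](h)"
    by (rule landau_o.big_trans[OF bigoI[of _ K] assms(2)]) (use K in \<open>auto simp: mult.commute\<close>)
qed

text \<open>For a = b = c the field has all entries 1, so the cone has slope r = 1.\<close>

lemma nearly_Kaehler_1: "nearly_Kaehler_G2_cone 1"
  unfolding nearly_Kaehler_G2_cone_def
proof (intro conjI allI impI)
  fix t :: real assume t: "0 < t"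
  have "G2_field (1 * t, 1 * t, 1 * t) = (1, 1, 1)" using t by (simp add: field_simps)
  moreover have "((\<lambda>t. (t, t, t)) has_vector_derivative (1, 1, 1)) (at t)"
    by (intro has_vector_derivative_Pair has_vector_derivative_id)
  ultimately show "((\<lambda>t. (1 * t, 1 * t, 1 * t)) has_vector_derivative G2_field (1 * t, 1 * t, 1 * t)) (at t)"
    by simp
qed simp

text \<open>The two cases \<open>i = k + l\<close> and \<open>i = k\<close> are both brought to the form of \<^const>\<open>mfield\<close>: the
  collapsing direction comes first, and \<open>F = i f / (2 \<Delta>)\<close>.\<close>

locale aloff_wallach =
  fixes k l i :: int
  assumes kl: "0 < l" "l < k" and i: "i = k + l \<or> i = k"
begin

definition "kpl \<longleftrightarrow> i = k + l"
text \<open>Thus - 1/2 < q < 0 in the case i = k + l, and 0 < q < 1 in the case i = k. The strict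
  bounds - 1/2 and 1 come from l < k.\<close>

definition "q = (if kpl then - of_int l / of_int (k + l) else of_int l / of_int k :: real)"
definition "p = of_int i / (2 * Delta k l)"
text \<open>The collapsing direction has velocity tending to 2 - \<epsilon> for i = k + l and to 2 +
  \<epsilon> for i = k; smoothness demands the value 1. This is the origin of the opposite
  chiralities.\<close>

definition "eps = (if kpl then 1 else - 1 :: real)"
abbreviation "\<sigma> \<equiv> scale_last (1 / p) kpl"
abbreviation "\<sigma>' \<equiv> scale_last p kpl"
abbreviation "\<sigma>8 \<equiv> scale_last8 (1 / p) kpl"

lemma i_pos: "0 < i" using i kl by auto

lemma Delta_pos: "0 < Delta k l"
proof -
  have "0 < k\<^sup>2 + k * l + l\<^sup>2" using kl by (simp add: add_pos_pos)
  then show ?thesis unfolding Delta_def by (simp only: of_int_0_less_iff)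
qed

lemma p_pos: "0 < p" using i_pos Delta_pos by (simp add: p_def)

lemma q_bounds: "- 1 / 2 < q" "q < 1"
  using kl by (auto simp: q_def field_simps)

definition "ca = real_of_int (k + l) / (2 * Delta k l)"
definition "cb = real_of_int l / (2 * Delta k l)"
definition "cc = real_of_int k / (2 * Delta k l)"

lemma spin7_field_eq:
  "spin7_field k l \<epsilon> (x, y, z, f) =
    (x * (y / (x * z) + z / (x * y) - x / (y * z) - \<epsilon> * ca * (f / x\<^sup>2)),
     y * (z / (x * y) + x / (y * z) - y / (x * z) + \<epsilon> * cb * (f / y\<^sup>2)),
     z * (x / (y * z) + y / (x * z) - z / (x * y) + \<epsilon> * cc * (f / z\<^sup>2)),
     f * (\<epsilon> * (ca * (f / x\<^sup>2) - cb * (f / y\<^sup>2) - cc * (f / z\<^sup>2))))"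
  by (simp only: spin7_field.simps ca_def cb_def cc_def)

lemma coefficients:
  "kpl \<Longrightarrow> ca = p" "kpl \<Longrightarrow> cb = - q * p" "kpl \<Longrightarrow> cc = (1 + q) * p"
  "\<not> kpl \<Longrightarrow> cc = p" "\<not> kpl \<Longrightarrow> cb = q * p" "\<not> kpl \<Longrightarrow> ca = (1 + q) * p"
proof -
  define K L D where "K = real_of_int k" and "L = real_of_int l" and "D = 2 * Delta k l"
  have pos: "0 < K" "0 < L" "0 < D" using kl Delta_pos by (auto simp: K_def L_def D_def)
  have c: "ca = (K + L) / D" "cb = L / D" "cc = K / D" by (simp_all add: ca_def cb_def cc_def K_def L_def D_def)
  {
    assume kpl
    then have pq: "p = (K + L) / D" "q = - L / (K + L)"
      unfolding p_def by (simp add: kpl_def K_def L_def D_def, simp add: q_def K_def L_def)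
    define s where "s = K + L"
    have s: "s \<noteq> 0" "K = s - L" using pos by (simp_all add: s_def)
    show "ca = p" "cb = - q * p" "cc = (1 + q) * p"
      unfolding c pq s_def[symmetric] unfolding s(2) using s(1) pos(3) by (simp_all add: field_simps)
  }
  {
    assume "\<not> kpl"
    then have pq: "p = K / D" "q = L / K"
      unfolding p_def using i by (simp add: kpl_def K_def D_def, simp add: q_def K_def L_def)
    show "cc = p" "cb = q * p" "ca = (1 + q) * p" unfolding c pq using pos by (simp_all add: field_simps)
  }
qed

lemma field_eq:
  assumes "all_pos m"
  shows "spin7_field k l eps (\<sigma> m) = \<sigma> (mfield q m)"
proof -
  obtain x y z F where m: "m = (x, y, z, F)" by (cases m)
  have pos: "0 < x" "0 < y" "0 < z" "0 < F" using assms m by auto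
  show ?thesis
  proof (cases kpl)
    case True
    then show ?thesis
      unfolding m scale_last_def using pos p_pos
      by (simp add: spin7_field_eq coefficients eps_def field_simps power2_eq_square del: spin7_field.simps)
  next
    case False
    then show ?thesis
      unfolding m scale_last_def using pos p_pos
      by (simp add: spin7_field_eq coefficients eps_def field_simps power2_eq_square del: spin7_field.simps)
  qed
qed

text \<open>Stated for an arbitrary \<epsilon>, so that the chirality of a competing metric can be
  read off its boundary condition.\<close>

lemma fst_field:
  assumes "all_pos m"
  shows "fst (\<sigma>' (spin7_field k l \<epsilon> (\<sigma> m))) = (case m of (x, y, z, F) \<Rightarrow> y / z + z / y - x\<^sup>2 / (y * z) - \<epsilon> * eps * (F / x))"
proof -
  obtain x y z F where m: "m = (x, y, z, F)" by (cases m)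
  have pos: "0 < x" "0 < y" "0 < z" "0 < F" using assms m by auto
  show ?thesis
  proof (cases kpl)
    case True
    then show ?thesis
      unfolding m scale_last_def using pos p_pos
      by (simp add: spin7_field_eq coefficients eps_def field_simps power2_eq_square del: spin7_field.simps)
  next
    case False
    then show ?thesis
      unfolding m scale_last_def using pos p_pos
      by (simp add: spin7_field_eq coefficients eps_def field_simps power2_eq_square del: spin7_field.simps)
  qed
qed

lemma jet_eq:
  assumes "(m has_vector_derivative v) (at t)"
  shows "((\<lambda>t. \<sigma> (m t)) has_vector_derivative \<sigma> v) (at t)" "jet (\<lambda>t. \<sigma> (m t)) t = (\<sigma> (m t), \<sigma> v)"
proof -
  show d: "((\<lambda>t. \<sigma> (m t)) has_vector_derivative \<sigma> v) (at t)"
    by (rule bounded_linear.has_vector_derivative[OF bounded_linear_scale_last assms])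
  then show "jet (\<lambda>t. \<sigma> (m t)) t = (\<sigma> (m t), \<sigma> v)" by (simp add: jet_def vector_derivative_at)
qed

lemma XZ_eq:
  assumes "(m has_vector_derivative mfield q (m t)) (at t)"
  shows "trL (\<lambda>t. \<sigma> (m t)) t = mtr q (m t)" "XZ (\<lambda>t. \<sigma> (m t)) t = \<sigma>8 (mXZ q (m t))"
proof -
  obtain x y z F where m: "m t = (x, y, z, F)" by (cases "m t")
  obtain x' y' z' F' where f: "mfield q (x, y, z, F) = (x', y', z', F')" by (cases "mfield q (x, y, z, F)")
  note j = jet_eq(2)[OF assms, unfolded m f]
  show t: "trL (\<lambda>t. \<sigma> (m t)) t = mtr q (m t)"
    unfolding trL_def j mtr_def m using f p_pos by (cases kpl) (simp_all add: scale_last_def)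
  show "XZ (\<lambda>t. \<sigma> (m t)) t = \<sigma>8 (mXZ q (m t))"
    unfolding XZ_def j t mXZ_def unfolding m f using p_pos
    by (cases kpl) (simp_all add: scale_last_def scale_last8_def f mult.commute)
qed

lemma P0_eq: "P0 k l i = \<sigma>8 coeff0"
proof (cases kpl)
  case True
  have "P0 k l i = (1/3, 0, 0, 1/3, 0, 1/3, 1/3, 3 / p)"
    unfolding P0_def p_def using True by (simp add: kpl_def)
  then show ?thesis using True by (simp add: coeff0_def scale_last8_def)
next
  case False
  then have "i = k" "i \<noteq> k + l" using i by (auto simp: kpl_def)
  then have "P0 k l i = (0, 0, 1/3, 1/3, 1/3, 1/3, 0, 3 / p)"
    unfolding P0_def p_def by simp
  then show ?thesis using False by (simp add: coeff0_def scale_last8_def)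
qed

text \<open>With w = i s2 the entries of v2 are explained by q alone: for i = k + l, (4 - q) i = 4 k
  + 5 l and (5 + q) i = 5 k + 4 l; for i = k they are 4 k - l and 5 k + l.\<close>

lemma v_eq: "s1 *\<^sub>R v1 k l i + s2 *\<^sub>R v2 k l i = \<sigma>8 (coeff1 q s1 (of_int i * s2))"
proof -
  define K L where "K = real_of_int k" and "L = real_of_int l"
  have pos: "0 < K" "0 < L" using kl by (auto simp: K_def L_def)
  show ?thesis
  proof (cases kpl)
    case True
    have ri: "real_of_int i = K + L" using True by (simp add: kpl_def K_def L_def)
    have e1: "v1 k l i = (2, 0, 0, - 4, 0, - 1, - 1, - (18 / p))"
      unfolding v1_def p_def using True by (simp add: kpl_def)
    have e2: "v2 k l i = (- 3 * (K + L), 4 * K + 5 * L, 5 * K + 4 * L, - 12 * (K + L), 3 * (K + L), - 5 * K - 4 * L, - 4 * K - 5 * L, 0)"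
      unfolding v2_def using True by (simp add: kpl_def K_def L_def)
    have "q * (K + L) = - L" using True pos unfolding q_def by (simp add: K_def L_def)
    then have "(4 - q) * (K + L) = 4 * K + 5 * L" "(5 + q) * (K + L) = 5 * K + 4 * L"
      by (simp_all add: algebra_simps)
    then have "(4 - q) * ((K + L) * s2) = (4 * K + 5 * L) * s2" "(5 + q) * ((K + L) * s2) = (5 * K + 4 * L) * s2"
      by (simp_all flip: mult.assoc)
    then show ?thesis
      unfolding e1 e2 ri coeff1_def scale_last8_def using True by (simp add: algebra_simps)
  next
    case False
    then have ii: "i = k" "i \<noteq> k + l" using i by (auto simp: kpl_def)
    have ri: "real_of_int i = K" using ii by (simp add: K_def)
    have e1: "v1 k l i = (0, 0, 2, - 4, - 1, - 1, 0, - (18 / p))"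
      unfolding v1_def p_def using ii by simp
    have e2: "v2 k l i = (5 * K + L, 4 * K - L, - 3 * K, - 12 * K, - 4 * K + L, - 5 * K - L, 3 * K, 0)"
      unfolding v2_def using ii by (simp add: K_def L_def)
    have "q * K = L" using False pos unfolding q_def by (simp add: K_def L_def)
    then have "(4 - q) * K = 4 * K - L" "(5 + q) * K = 5 * K + L"
      by (simp_all add: algebra_simps)
    then have "(4 - q) * (K * s2) = (4 * K - L) * s2" "(5 + q) * (K * s2) = (5 * K + L) * s2"
      by (simp_all flip: mult.assoc)
    then show ?thesis
      unfolding e1 e2 ri coeff1_def scale_last8_def using False by (simp add: algebra_simps)
  qed
qed

text \<open>The initial data (S0, Q0) prescribed by \<open>expansion\<close>; s1, s2 > 0 makes both
  positive.\<close>

definition "par s = (9 * (of_int i * snd s), 9 * fst s + (27 - 9 * cq q) / 2 * (of_int i * snd s))"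
  for s :: "real \<times> real"
text \<open>A common bound for \<open>par\<close> on the arc: s1 and s2 are at most 1, and (27 - 9
  c) / 2 < 14.\<close>

definition "A = 9 + 14 * real_of_int i"

lemma par_mem: "s \<in> param_arc \<Longrightarrow> par s \<in> {0<..A} \<times> {0<..A}"
proof -
  assume s: "s \<in> param_arc"
  then have s': "0 < fst s" "0 < snd s" "norm s = 1" by (auto simp: param_arc_def)
  have le: "fst s \<le> 1" "snd s \<le> 1"
    using norm_fst_le[of "fst s" "snd s"] norm_snd_le[of "snd s" "fst s"] s' by auto
  have c: "0 < cq q" "cq q < 1" using q_bounds by (auto simp: cq_def)
  define w where "w = real_of_int i * snd s"
  have w: "0 < w" "w \<le> real_of_int i" using s' le i_pos by (auto simp: w_def)
  have "0 < (27 - 9 * cq q) / 2 * w" using c w by simp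
  moreover have "(27 - 9 * cq q) / 2 * w \<le> 14 * w" using c w by (intro mult_right_mono) auto
  ultimately have "0 < 9 * fst s + (27 - 9 * cq q) / 2 * w" "9 * fst s + (27 - 9 * cq q) / 2 * w \<le> 9 + 14 * real_of_int i"
    using s' le w by linarith+
  moreover have "0 < 9 * w" "9 * w \<le> 9 + 14 * real_of_int i" using w by linarith+
  ultimately show ?thesis unfolding par_def w_def[symmetric] A_def by simp
qed

lemma par_cont: "continuous_on X par"
  unfolding par_def by (intro continuous_intros)

end

section \<open>The family of metrics over the parameter arc\<close>

locale aloff_wallach_family = aloff_wallach +
  fixes u :: "real \<times> real \<Rightarrow> real \<Rightarrow> real \<times> real \<times> real"
  assumes u_cont: "continuous_on (({0<..A} \<times> {0<..A}) \<times> {0..}) (\<lambda>(a, T). u a T)"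
    and u_prof: "\<And>a. a \<in> {0<..A} \<times> {0<..A} \<Longrightarrow> is_profile q (fst a) (snd a) (u a)"
    and u_est: "\<And>a. a \<in> {0<..A} \<times> {0<..A} \<Longrightarrow> \<exists>C. \<forall>T\<in>{0..1}. norm (u a T - (fst a, snd a, 0)) \<le> C * T"
begin

definition "G s t = \<sigma> (mm q (u (par s)) t)"

lemma prof: "a \<in> {0<..A} \<times> {0<..A} \<Longrightarrow> profile q (fst a) (snd a) (u a)"
  using u_prof[of a] q_bounds by (auto simp: profile_def)

lemma prof': "s \<in> param_arc \<Longrightarrow> profile q (fst (par s)) (snd (par s)) (u (par s))"
  by (rule prof[OF par_mem])

text \<open>The jet expressed through \<open>met\<close> and \<open>vel\<close>, which still makes
  sense at t = 0 and gives the extension required by \<open>continuous_family\<close>.\<close>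

definition "J = (\<lambda>(s, t). (\<sigma> (met q (u (par s)) (mr q (u (par s)) t)), \<sigma> (vel q (u (par s)) (mr q (u (par s)) t))))"

lemma G_deriv:
  assumes s: "s \<in> param_arc" and t: "0 < t"
  shows "(G s has_vector_derivative spin7_field k l eps (G s t)) (at t)" "jet (G s) t = J (s, t)" "all_pos (G s t)"
proof -
  interpret profile q "fst (par s)" "snd (par s)" "u (par s)" by (rule prof'[OF s])
  note m = mm_deriv[OF t]
  show "(G s has_vector_derivative spin7_field k l eps (G s t)) (at t)"
    unfolding G_def[abs_def] field_eq[OF mm_pos[OF t]] by (rule jet_eq(1)[OF m])
  show "jet (G s) t = J (s, t)"
    unfolding G_def[abs_def] J_def using jet_eq(2)[OF m] by (simp add: mm_def vel_eq[OF mr_pos[OF t]])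
  show "all_pos (G s t)" unfolding G_def using mm_pos[OF t] p_pos by (simp add: all_pos_scale_last)
qed

lemma G_spin7: "s \<in> param_arc \<Longrightarrow> spin7_metric k l eps \<infinity> (G s)"
  unfolding spin7_metric_def using G_deriv by simp

lemma J_cont: "continuous_on (param_arc \<times> {0..}) J"
proof -
  let ?U = "{0<..A} \<times> {0<..A}"
  have ex: "\<exists>S0 Q0. profile q S0 Q0 (u a)" if "a \<in> ?U" for a using prof[OF that] by blast
  note c = continuous_on_m_derived[OF u_cont ex]
  have r: "continuous_on (?U \<times> {0..}) (\<lambda>(a, t). inv_into {0..} (mt q (u a)) t)"
  proof (rule continuous_on_inverse_param[OF c(3)])
    fix a assume a: "a \<in> ?U"
    interpret profile q "fst a" "snd a" "u a" by (rule prof[OF a])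
    show "strict_mono_on {0..} (mt q (u a))" by (rule mt_strict_mono)
    show "mt q (u a) ` {0..} = {0..}" by (rule mt_image)
  qed
  have pt: "continuous_on (param_arc \<times> {0..}) (\<lambda>x. (par (fst x), snd x :: real))"
    by (intro continuous_intros continuous_on_compose2[OF par_cont[of UNIV]]) auto
  have "(\<lambda>x. (par (fst x), snd x)) ` (param_arc \<times> {0..}) \<subseteq> ?U \<times> {0::real..}"
  proof (rule image_subsetI)
    fix x :: "(real \<times> real) \<times> real" assume "x \<in> param_arc \<times> {0..}"
    then show "(par (fst x), snd x) \<in> ?U \<times> {0::real..}" using par_mem[of "fst x"] unfolding mem_Times_iff by simp
  qed
  then have "continuous_on (param_arc \<times> {0..}) (\<lambda>x. (\<lambda>(a, t). inv_into {0..} (mt q (u a)) t) (par (fst x), snd x))"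
    by (rule continuous_on_compose2[OF r pt])
  then have r': "continuous_on (param_arc \<times> {0..}) (\<lambda>x. mr q (u (par (fst x))) (snd x))"
    by (simp add: mr_def)
  have pr: "continuous_on (param_arc \<times> {0..}) (\<lambda>x. (par (fst x), mr q (u (par (fst x))) (snd x)))"
    by (intro continuous_on_Pair r' continuous_on_compose2[OF par_cont[of UNIV]] continuous_intros) auto
  have im: "(\<lambda>x. (par (fst x), mr q (u (par (fst x))) (snd x))) ` (param_arc \<times> {0..}) \<subseteq> ?U \<times> {0..}"
  proof
    fix z assume "z \<in> (\<lambda>x. (par (fst x), mr q (u (par (fst x))) (snd x))) ` (param_arc \<times> {0..})"
    then obtain s t where z: "s \<in> param_arc" "0 \<le> t" "z = (par s, mr q (u (par s)) t)" by auto
    interpret profile q "fst (par s)" "snd (par s)" "u (par s)" by (rule prof'[OF z(1)])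
    show "z \<in> ?U \<times> {0..}" using par_mem[OF z(1)] mr_nonneg[OF z(2)] by (simp add: z(3))
  qed
  have 1: "continuous_on (param_arc \<times> {0..}) (\<lambda>x. met q (u (par (fst x))) (mr q (u (par (fst x))) (snd x)))"
    using continuous_on_compose2[OF c(4) pr im] by simp
  have 2: "continuous_on (param_arc \<times> {0..}) (\<lambda>x. vel q (u (par (fst x))) (mr q (u (par (fst x))) (snd x)))"
    using continuous_on_compose2[OF c(5) pr im] by simp
  show ?thesis
    unfolding J_def case_prod_beta
    by (intro continuous_on_Pair bounded_linear.continuous_on[OF bounded_linear_scale_last] 1 2)
qed

lemma G_continuous: "continuous_family param_arc G"
  unfolding continuous_family_def
  by (intro exI[of _ J] conjI J_cont ballI allI impI) (simp add: G_deriv(2))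

lemma closes_up_iff:
  "closes_up k l i g \<longleftrightarrow> (\<exists>y0>0. (jet g \<longlongrightarrow> (\<sigma> (0, y0, y0, 0), \<sigma> (1, 0, 0, 1))) (at_right 0))"
proof (cases kpl)
  case True
  then have "1 / p = 2 * Delta k l / of_int (k + l)" unfolding p_def by (simp add: kpl_def)
  then show ?thesis using True by (simp add: closes_up_def kpl_def[symmetric] scale_last_def)
next
  case False
  then have ii: "i = k" "i \<noteq> k + l" using i by (auto simp: kpl_def)
  then have "1 / p = 2 * Delta k l / of_int k" unfolding p_def by simp
  then show ?thesis using False ii(2) by (simp add: closes_up_def ii(1)[symmetric] scale_last_def)
qed

lemma G_closes:
  assumes s: "s \<in> param_arc" shows "closes_up k l i (G s)"
  unfolding closes_up_iff
proof (intro exI[of _ 1] conjI)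
  interpret profile q "fst (par s)" "snd (par s)" "u (par s)" by (rule prof'[OF s])
  have "continuous_on {0..} (\<lambda>t. J (s, t))"
    by (rule continuous_on_compose2[OF J_cont]) (use s in \<open>auto intro!: continuous_intros\<close>)
  then have "((\<lambda>t. J (s, t)) \<longlongrightarrow> J (s, 0)) (at 0 within {0..})" by (auto simp: continuous_on_def)
  then have "((\<lambda>t. J (s, t)) \<longlongrightarrow> J (s, 0)) (at_right 0)" by (rule tendsto_mono[rotated]) (auto intro: at_le)
  moreover have "J (s, 0) = (\<sigma> (0, 1, 1, 0), \<sigma> (1, 0, 0, 1))"
    by (simp add: J_def mr_0 met_0 vel_0)
  ultimately have "((\<lambda>t. J (s, t)) \<longlongrightarrow> (\<sigma> (0, 1, 1, 0), \<sigma> (1, 0, 0, 1))) (at_right 0)" by simp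
  then show "(jet (G s) \<longlongrightarrow> (\<sigma> (0, 1, 1, 0), \<sigma> (1, 0, 0, 1))) (at_right 0)"
    by (rule Lim_transform_eventually)
      (rule eventually_mono[OF eventually_at_right_less], simp add: G_deriv(2)[OF s])
qed simp

lemma XZ_error:
  "\<sigma>8 M - (P0 k l i + e *\<^sub>R (fst s *\<^sub>R v1 k l i + snd s *\<^sub>R v2 k l i)) =
    \<sigma>8 (M - (coeff0 + e *\<^sub>R coeff1 q (fst s) (of_int i * snd s)))"
  unfolding P0_eq v_eq
  by (simp add: linear_diff[OF linear_scale_last8] linear_add[OF linear_scale_last8] linear_scale[OF linear_scale_last8])

lemma G_parameters:
  assumes s: "s \<in> param_arc" shows "has_parameters k l i s (G s)"
proof -
  interpret profile q "fst (par s)" "snd (par s)" "u (par s)" by (rule prof'[OF s])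
  obtain C where C: "\<And>T. T \<in> {0..1} \<Longrightarrow> norm (u (par s) T - (fst (par s), snd (par s), 0)) \<le> C * T"
    using u_est[OF par_mem[OF s]] by blast
  obtain \<eta> where \<eta>: "\<And>t. 0 < t \<Longrightarrow> (\<eta> has_real_derivative mtr q (mm q (u (par s)) t)) (at t)"
    "filterlim \<eta> at_bot (at_right 0)"
    "(\<lambda>t. norm (mXZ q (mm q (u (par s)) t) - (coeff0 + exp (2 * \<eta> t / 3) *\<^sub>R coeff1 q (fst s) (of_int i * snd s))))
      \<in> O[at_right 0](\<lambda>t. exp ((2 / 3 + 2 / 3) * \<eta> t))"
    using expansion[OF C, of "of_int i * snd s" "fst s"] by (auto simp: par_def)
  have X: "trL (G s) t = mtr q (mm q (u (par s)) t)" "XZ (G s) t = \<sigma>8 (mXZ q (mm q (u (par s)) t))" if "0 < t" for t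
    unfolding G_def[abs_def] using XZ_eq[OF mm_deriv[OF that]] by simp_all
  have ev: "\<forall>\<^sub>F t::real in at_right 0. 0 < t" by (rule eventually_at_right_less)
  show ?thesis
    unfolding has_parameters_def
  proof (intro exI[of _ \<eta>] exI[of _ "2 / 3 :: real"] conjI)
    show "\<forall>\<^sub>F t in at_right 0. (\<eta> has_real_derivative trL (G s) t) (at t)"
      by (rule eventually_mono[OF ev]) (simp add: X \<eta>(1))
    show "filterlim \<eta> at_bot (at_right 0)" by (rule \<eta>(2))
    have "\<forall>\<^sub>F t in at_right 0. norm (\<sigma>8 (mXZ q (mm q (u (par s)) t) - (coeff0 + exp (2 * \<eta> t / 3) *\<^sub>R coeff1 q (fst s) (of_int i * snd s)))) =
      norm (XZ (G s) t - (P0 k l i + exp (2 * \<eta> t / 3) *\<^sub>R (fst s *\<^sub>R v1 k l i + snd s *\<^sub>R v2 k l i)))"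
      by (rule eventually_mono[OF ev]) (simp add: X XZ_error)
    from landau_o.big.in_cong[OF this] bigo_norm_linear[OF linear_scale_last8 \<eta>(3)]
    show "(\<lambda>t. norm (XZ (G s) t - (P0 k l i + exp (2 * \<eta> t / 3) *\<^sub>R (fst s *\<^sub>R v1 k l i + snd s *\<^sub>R v2 k l i))))
      \<in> O[at_right 0](\<lambda>t. exp ((2 / 3 + 2 / 3) * \<eta> t))" by blast
  qed simp
qed

lemma eps_sign: "eps \<in> {- 1, 1}" by (simp add: eps_def)

lemma G_is_gamma: "s \<in> param_arc \<Longrightarrow> is_gamma k l i s \<infinity> (G s)"
  unfolding is_gamma_def spin7_metric_on_M_def
  using G_spin7 G_closes G_parameters eps_sign by blast

lemma G_ALC:
  assumes s: "s \<in> param_arc" shows "ALC_over_nearly_Kaehler_cone (G s)"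
proof -
  interpret profile q "fst (par s)" "snd (par s)" "u (par s)" by (rule prof'[OF s])
  let ?m = "mm q (u (par s))"
  note a = mm_asymptotics
  obtain F0 where F0: "0 < F0" "((\<lambda>t. snd (snd (snd (?m t)))) \<longlongrightarrow> F0) at_top" using a(4) by blast
  have F: "((\<lambda>t. 1 / p * snd (snd (snd (?m t)))) \<longlongrightarrow> 1 / p * F0) at_top" by (intro tendsto_intros F0)
  have L: "((\<lambda>t. (fst (?m t) / t, fst (snd (?m t)) / t, fst (snd (snd (?m t))) / t)) \<longlongrightarrow> (1, 1, 1)) at_top"
    "((\<lambda>t. (fst (snd (snd (?m t))) / t, fst (snd (?m t)) / t, fst (?m t) / t)) \<longlongrightarrow> (1, 1, 1)) at_top"
    by (intro tendsto_Pair a)+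
  show ?thesis
    unfolding ALC_over_nearly_Kaehler_cone_def
  proof (intro conjI exI)
    show "nearly_Kaehler_G2_cone 1" by (rule nearly_Kaehler_1)
    show "((\<lambda>t. case G s t of (a, b, c, f) \<Rightarrow> (a / (1 * t), b / (1 * t), c / (1 * t))) \<longlongrightarrow> (1, 1, 1)) at_top"
      using L by (cases kpl) (simp_all add: G_def scale_last_def)
    show "0 < 1 / p * F0" using F0 p_pos by simp
    show "((\<lambda>t. case G s t of (a, b, c, f) \<Rightarrow> f) \<longlongrightarrow> 1 / p * F0) at_top"
      using F by (cases kpl) (simp_all add: G_def scale_last_def)
  qed
qed

text \<open>The converse of \<open>expansion\<close>: s = Z1 / Z2 and h = Z3 Z4 in the common
  naming, so the parameters determine the limit of (1 - h) / s. The factor exp (2 \<eta> / 3)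
  cancels, hence the additive constant in \<eta> is irrelevant here.\<close>

lemma ratio_from_expansion:
  fixes n :: "real \<Rightarrow> real4" and \<eta> :: "real \<Rightarrow> real"
  assumes pos: "\<forall>\<^sub>F t in at_right 0. all_pos (n t)"
    and \<eta>: "filterlim \<eta> at_bot (at_right 0)" and \<delta>: "0 < \<delta>" and w: "0 < w"
    and bo: "(\<lambda>t. norm (mXZ q (n t) - (coeff0 + exp (2 * \<eta> t / 3) *\<^sub>R coeff1 q s1 w))) \<in> O[at_right 0](\<lambda>t. exp ((2 / 3 + \<delta>) * \<eta> t))"
  shows "((\<lambda>t. case n t of (x, y, z, F) \<Rightarrow> (1 - F * z / (x * y)) / (x\<^sup>2 / y\<^sup>2)) \<longlongrightarrow>
    (9 * s1 + (27 - 9 * cq q) / 2 * w) / (9 * w)) (at_right 0)"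
proof -
  define e where "e t = exp (2 * \<eta> t / 3)" for t
  \<comment> \<open>The rescaled deviation from the fixed point. The error term has the extra factor
    exp (\<delta> \<eta>), so \<open>D\<close> tends to \<open>coeff1\<close>.\<close>
  define D where "D t = (1 / e t) *\<^sub>R (mXZ q (n t) - coeff0)" for t
  have e0: "0 < e t" for t by (simp add: e_def)
  have "filterlim (\<lambda>t. 2 / 3 * \<eta> t) at_bot (at_right 0)" "filterlim (\<lambda>t. \<delta> * \<eta> t) at_bot (at_right 0)"
    using \<delta> by (intro filterlim_tendsto_pos_mult_at_bot[OF tendsto_const _ \<eta>]; simp)+
  then have "((\<lambda>t. exp (2 / 3 * \<eta> t)) \<longlongrightarrow> 0) (at_right 0)" and dl: "((\<lambda>t. exp (\<delta> * \<eta> t)) \<longlongrightarrow> 0) (at_right 0)"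
    by (auto intro: filterlim_compose[OF exp_at_bot])
  then have el: "(e \<longlongrightarrow> 0) (at_right 0)" by (simp add: e_def[abs_def])
  obtain C where C: "\<forall>\<^sub>F t in at_right 0. norm (norm (mXZ q (n t) - (coeff0 + e t *\<^sub>R coeff1 q s1 w))) \<le> C * norm (exp ((2 / 3 + \<delta>) * \<eta> t))"
    using bo unfolding e_def by (elim landau_o.bigE)
  have "\<forall>\<^sub>F t in at_right 0. norm (D t - coeff1 q s1 w) \<le> C * exp (\<delta> * \<eta> t)"
    using C
  proof eventually_elim
    case (elim t)
    have "D t - coeff1 q s1 w = (1 / e t) *\<^sub>R (mXZ q (n t) - (coeff0 + e t *\<^sub>R coeff1 q s1 w))"
      using e0[of t] by (simp add: D_def scaleR_diff_right scaleR_add_right)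
    then have "norm (D t - coeff1 q s1 w) = 1 / e t * norm (mXZ q (n t) - (coeff0 + e t *\<^sub>R coeff1 q s1 w))"
      using e0[of t] by simp
    also have "\<dots> \<le> 1 / e t * (C * exp ((2 / 3 + \<delta>) * \<eta> t))" using elim e0[of t] by (intro mult_left_mono) auto
    also have "exp ((2 / 3 + \<delta>) * \<eta> t) = e t * exp (\<delta> * \<eta> t)" by (simp add: e_def exp_add[symmetric] algebra_simps)
    finally show ?case using e0[of t] by simp
  qed
  moreover have "((\<lambda>t. C * exp (\<delta> * \<eta> t)) \<longlongrightarrow> 0) (at_right 0)" using tendsto_mult[OF tendsto_const dl, of C] by simp
  ultimately have "((\<lambda>t. D t - coeff1 q s1 w) \<longlongrightarrow> 0) (at_right 0)" by (rule Lim_null_comparison)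
  then have Dl: "(D \<longlongrightarrow> coeff1 q s1 w) (at_right 0)" by (simp add: LIM_zero_iff)
  define c5 c6 c7 c8 :: "real8 \<Rightarrow> real" where "c5 m = fst (snd (snd (snd (snd m))))" and "c6 m = fst (snd (snd (snd (snd (snd m)))))"
    and "c7 m = fst (snd (snd (snd (snd (snd (snd m))))))" and "c8 m = snd (snd (snd (snd (snd (snd (snd m))))))" for m
  note cd = c5_def c6_def c7_def c8_def
  have l5: "((\<lambda>t. c5 (D t)) \<longlongrightarrow> 3 * w) (at_right 0)"
    using Dl[unfolded coeff1_def] unfolding c5_def
    by (auto dest!: tendsto_snd tendsto_fst[of "\<lambda>t. snd (snd (snd (snd (D t))))"])
  have l6: "((\<lambda>t. c6 (D t)) \<longlongrightarrow> - s1 - (5 + q) * w) (at_right 0)"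
    and l7: "((\<lambda>t. c7 (D t)) \<longlongrightarrow> - s1 - (4 - q) * w) (at_right 0)"
    and l8: "((\<lambda>t. c8 (D t)) \<longlongrightarrow> - 18 * s1) (at_right 0)"
  proof -
    note d5 = tendsto_snd[OF tendsto_snd[OF tendsto_snd[OF tendsto_snd[OF tendsto_snd[OF Dl]]]]]
    show "((\<lambda>t. c6 (D t)) \<longlongrightarrow> - s1 - (5 + q) * w) (at_right 0)"
      using tendsto_fst[OF d5] by (simp add: c6_def coeff1_def)
    show "((\<lambda>t. c7 (D t)) \<longlongrightarrow> - s1 - (4 - q) * w) (at_right 0)"
      using tendsto_fst[OF tendsto_snd[OF d5]] by (simp add: c7_def coeff1_def)
    show "((\<lambda>t. c8 (D t)) \<longlongrightarrow> - 18 * s1) (at_right 0)"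
      using tendsto_snd[OF tendsto_snd[OF d5]] by (simp add: c8_def coeff1_def)
  qed
  have "((\<lambda>t. 1 / 3 + e t * c6 (D t)) \<longlongrightarrow> 1 / 3 + 0 * (- s1 - (5 + q) * w)) (at_right 0)"
    by (intro tendsto_intros el l6)
  then have m6: "((\<lambda>t. 1 / 3 + e t * c6 (D t)) \<longlongrightarrow> 1 / 3) (at_right 0)" by simp
  have ne: "\<forall>\<^sub>F t in at_right 0. 1 / 3 + e t * c6 (D t) \<noteq> 0" by (rule tendsto_imp_eventually_ne[OF m6]) simp
  have "((\<lambda>t. 1 / 3 + e t * c7 (D t)) \<longlongrightarrow> 1 / 3 + 0 * (- s1 - (4 - q) * w)) (at_right 0)"
    by (intro tendsto_intros el l7)
  then have m7: "((\<lambda>t. 1 / 3 + e t * c7 (D t)) \<longlongrightarrow> 1 / 3) (at_right 0)" by simp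
  \<comment> \<open>The constant parts satisfy 3 * (1/3) = 1, so 1 - h has no term of order zero;
    its first coefficient is - (c8 / 3 + 3 c7), and that of s is 3 c5.\<close>
  have val: "- (- 18 * s1 * (1 / 3) + 3 * (- s1 - (4 - q) * w)) / (3 * w / (1 / 3)) = (9 * s1 + (27 - 9 * cq q) / 2 * w) / (9 * w)"
    using w by (simp add: cq_def field_simps)
  have "((\<lambda>t. - (c8 (D t) * (1 / 3 + e t * c7 (D t)) + 3 * c7 (D t)) / (c5 (D t) / (1 / 3 + e t * c6 (D t)))) \<longlongrightarrow>
    (9 * s1 + (27 - 9 * cq q) / 2 * w) / (9 * w)) (at_right 0)"
    unfolding val[symmetric] by (intro tendsto_intros l5 l7 l8 m6 m7) (use w in auto)
  then show ?thesis
  proof (rule Lim_transform_eventually)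
    show "\<forall>\<^sub>F t in at_right 0. - (c8 (D t) * (1 / 3 + e t * c7 (D t)) + 3 * c7 (D t)) / (c5 (D t) / (1 / 3 + e t * c6 (D t))) =
      (case n t of (x, y, z, F) \<Rightarrow> (1 - F * z / (x * y)) / (x\<^sup>2 / y\<^sup>2))"
      using pos ne
    proof eventually_elim
      case (elim t)
      obtain x y z F where n: "n t = (x, y, z, F)" by (cases "n t")
      have p: "0 < x" "0 < y" "0 < z" "0 < F" using elim(1) n by auto
      define tr where "tr = mtr q (n t)"
      have M: "mXZ q (n t) = coeff0 + e t *\<^sub>R D t" using e0[of t] by (simp add: D_def)
      have c: "c5 (mXZ q (n t)) = e t * c5 (D t)" "c6 (mXZ q (n t)) = 1 / 3 + e t * c6 (D t)"
        "c7 (mXZ q (n t)) = 1 / 3 + e t * c7 (D t)" "c8 (mXZ q (n t)) = 3 + e t * c8 (D t)"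
        unfolding M by (simp_all add: cd coeff0_def)
      have m: "c5 (mXZ q (n t)) = (x / (y * z)) / tr" "c6 (mXZ q (n t)) = (y / (x * z)) / tr"
        "c7 (mXZ q (n t)) = (z / (x * y)) / tr" "c8 (mXZ q (n t)) = F * tr"
        unfolding tr_def mXZ_def n by (simp_all add: cd split: prod.split)
      have tr: "tr \<noteq> 0" using elim(2) c(2) m(2) by auto
      have s: "x\<^sup>2 / y\<^sup>2 = e t * (c5 (D t) / (1 / 3 + e t * c6 (D t)))"
      proof -
        have "x\<^sup>2 / y\<^sup>2 = c5 (mXZ q (n t)) / c6 (mXZ q (n t))"
          unfolding m using tr p by (simp add: field_simps power2_eq_square)
        then show ?thesis unfolding c by simp
      qed
      have h: "1 - F * z / (x * y) = e t * - (c8 (D t) * (1 / 3 + e t * c7 (D t)) + 3 * c7 (D t))"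
      proof -
        have "F * z / (x * y) = c8 (mXZ q (n t)) * c7 (mXZ q (n t))"
          unfolding m using tr p by simp
        then show ?thesis unfolding c by (simp add: algebra_simps)
      qed
      show ?case
        unfolding n prod.case s h using e0[of t] by simp
    qed
  qed
qed

text \<open>The metric may exist only up to T and have either chirality. Its boundary condition
  fixes the chirality, its expansion fixes the ratio Q0 / S0, and then the comparison with the
  profile applies on every shorter interval.\<close>

lemma uniqueness:
  assumes s: "s \<in> param_arc" and g: "is_gamma k l i s T g"
  shows "homothetic_on T g (G s)"
proof -
  interpret profile q "fst (par s)" "snd (par s)" "u (par s)" by (rule prof'[OF s])
  obtain \<epsilon> where \<epsilon>: "\<epsilon> \<in> {- 1, 1}" "spin7_metric k l \<epsilon> T g" and cl: "closes_up k l i g" and hp: "has_parameters k l i s g"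
    using g unfolding is_gamma_def spin7_metric_on_M_def by blast
  have T0: "0 < T" and gs: "\<And>t. 0 < t \<Longrightarrow> ereal t < T \<Longrightarrow> all_pos (g t) \<and> (g has_vector_derivative spin7_field k l \<epsilon> (g t)) (at t)"
    using \<epsilon>(2) by (auto simp: spin7_metric_def)
  have vd: "vector_derivative g (at t) = spin7_field k l \<epsilon> (g t)" if "0 < t" "ereal t < T" for t
    using gs[OF that] by (simp add: vector_derivative_at)
  obtain \<tau>0 where \<tau>0: "0 < \<tau>0" "ereal \<tau>0 < T"
    using ereal_dense2[OF T0] by (auto simp: zero_ereal_def)
  have ev: "\<forall>\<^sub>F t in at_right 0. 0 < t \<and> ereal t < T"
    unfolding eventually_at_right_field
    by (intro exI[of _ \<tau>0]) (use \<tau>0 in \<open>auto intro: less_trans[of _ "ereal \<tau>0"]\<close>)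
  define n where "n t = \<sigma>' (g t)" for t
  define v where "v t = \<sigma>' (spin7_field k l \<epsilon> (g t))" for t
  have gn: "g t = \<sigma> (n t)" for t
    unfolding n_def using scale_last_inverse[of "1 / p" kpl "g t"] p_pos by simp
  have s's: "\<sigma>' (\<sigma> m) = m" for m using scale_last_inverse[of p kpl m] p_pos by simp
  have n_pos: "all_pos (n t)" if "0 < t" "ereal t < T" for t
    unfolding n_def using gs[OF that] p_pos by (simp add: all_pos_scale_last)
  have n_der: "(n has_vector_derivative v t) (at t)" if "0 < t" "ereal t < T" for t
    unfolding n_def[abs_def] v_def using gs[OF that] by (intro bounded_linear.has_vector_derivative[OF bounded_linear_scale_last]) auto
  obtain y0 where y0: "0 < y0" and jl: "(jet g \<longlongrightarrow> (\<sigma> (0, y0, y0, 0), \<sigma> (1, 0, 0, 1))) (at_right 0)"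
    using cl unfolding closes_up_iff by blast
  have n_lim: "(n \<longlongrightarrow> (0, y0, y0, 0)) (at_right 0)"
    using bounded_linear.tendsto[OF bounded_linear_scale_last[of p kpl] tendsto_fst[OF jl]]
    by (simp add: s's n_def[abs_def] jet_def)
  have v_lim: "(v \<longlongrightarrow> (1, 0, 0, 1)) (at_right 0)"
  proof -
    have "((\<lambda>t. \<sigma>' (snd (jet g t))) \<longlongrightarrow> (1, 0, 0, 1)) (at_right 0)"
      using bounded_linear.tendsto[OF bounded_linear_scale_last[of p kpl] tendsto_snd[OF jl]] by (simp add: s's)
    then show ?thesis
      by (rule Lim_transform_eventually)
        (rule eventually_mono[OF ev], simp add: jet_def v_def vd)
  qed
  define x y z F where "x t = fst (n t)" and "y t = fst (snd (n t))" and "z t = fst (snd (snd (n t)))" and "F t = snd (snd (snd (n t)))" for t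
  have n4: "n t = (x t, y t, z t, F t)" for t by (simp add: x_def y_def z_def F_def)
  have lims: "(x \<longlongrightarrow> 0) (at_right 0)" "(y \<longlongrightarrow> y0) (at_right 0)" "(z \<longlongrightarrow> y0) (at_right 0)" "(F \<longlongrightarrow> 0) (at_right 0)"
    unfolding x_def[abs_def] y_def[abs_def] z_def[abs_def] F_def[abs_def]
    using tendsto_fst[OF n_lim] tendsto_fst[OF tendsto_snd[OF n_lim]] tendsto_fst[OF tendsto_snd[OF tendsto_snd[OF n_lim]]]
      tendsto_snd[OF tendsto_snd[OF tendsto_snd[OF n_lim]]] by simp_all
  have vl: "((\<lambda>t. fst (v t)) \<longlongrightarrow> 1) (at_right 0)" "((\<lambda>t. snd (snd (snd (v t)))) \<longlongrightarrow> 1) (at_right 0)"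
    using tendsto_fst[OF v_lim] tendsto_snd[OF tendsto_snd[OF tendsto_snd[OF v_lim]]] by simp_all
  have Fx: "((\<lambda>t. F t / x t) \<longlongrightarrow> 1) (at_right 0)"
  proof (rule lhopital_right_0[where f' = "\<lambda>t. snd (snd (snd (v t)))" and g' = "\<lambda>t. fst (v t)"])
    show "\<forall>\<^sub>F t in at_right 0. x t \<noteq> 0"
      by (rule eventually_mono[OF ev]) (use n_pos n4 in force)
    show "\<forall>\<^sub>F t in at_right 0. fst (v t) \<noteq> 0" by (rule tendsto_imp_eventually_ne[OF vl(1)]) simp
    show "\<forall>\<^sub>F t in at_right 0. (x has_real_derivative fst (v t)) (at t)"
      by (rule eventually_mono[OF ev])
        (use bounded_linear.has_vector_derivative[OF bounded_linear_fst n_der] in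
          \<open>auto simp: x_def[abs_def] has_real_derivative_iff_has_vector_derivative\<close>)
    show "\<forall>\<^sub>F t in at_right 0. (F has_real_derivative snd (snd (snd (v t)))) (at t)"
      by (rule eventually_mono[OF ev])
        (use bounded_linear.has_vector_derivative[OF bounded_linear_snd bounded_linear.has_vector_derivative[OF bounded_linear_snd
            bounded_linear.has_vector_derivative[OF bounded_linear_snd n_der]]] in
          \<open>auto simp: F_def[abs_def] has_real_derivative_iff_has_vector_derivative\<close>)
    show "((\<lambda>t. snd (snd (snd (v t))) / fst (v t)) \<longlongrightarrow> 1) (at_right 0)"
      using tendsto_divide[OF vl(2,1)] by simp
  qed (rule lims)+
  \<comment> \<open>The limit of the velocity of the collapsing direction is 2 - \<epsilon>
    \<open>eps\<close>, because F / x tends to 1; the boundary condition requires 1.\<close>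
  have "\<epsilon> = eps"
  proof -
    have "((\<lambda>t. y t / z t + z t / y t - (x t)\<^sup>2 / (y t * z t) - \<epsilon> * eps * (F t / x t)) \<longlongrightarrow>
      y0 / y0 + y0 / y0 - 0\<^sup>2 / (y0 * y0) - \<epsilon> * eps * 1) (at_right 0)"
      by (intro tendsto_intros lims Fx) (use y0 in auto)
    then have "((\<lambda>t. fst (v t)) \<longlongrightarrow> y0 / y0 + y0 / y0 - 0\<^sup>2 / (y0 * y0) - \<epsilon> * eps * 1) (at_right 0)"
    proof (rule Lim_transform_eventually)
      show "\<forall>\<^sub>F t in at_right 0. y t / z t + z t / y t - (x t)\<^sup>2 / (y t * z t) - \<epsilon> * eps * (F t / x t) = fst (v t)"
        by (rule eventually_mono[OF ev]) (use fst_field[OF n_pos] n4 in \<open>simp add: v_def gn\<close>)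
    qed
    from tendsto_unique[OF _ this vl(1)] have "2 - \<epsilon> * eps = 1" using y0 by simp
    then show ?thesis using \<epsilon>(1) eps_sign by auto
  qed
  then have v_eq: "v t = mfield q (n t)" if "0 < t" "ereal t < T" for t
    unfolding v_def gn using field_eq[OF n_pos[OF that]] s's by simp
  have n_der': "(n has_vector_derivative mfield q (n t)) (at t)" if "0 < t" "ereal t < T" for t
    using n_der[OF that] v_eq[OF that] by simp
  have v_lim': "((\<lambda>t. mfield q (n t)) \<longlongrightarrow> (1, 0, 0, 1)) (at_right 0)"
    using v_lim by (rule Lim_transform_eventually) (rule eventually_mono[OF ev], simp add: v_eq)
  obtain \<eta> \<delta> where \<delta>: "0 < \<delta>" and \<eta>: "filterlim \<eta> at_bot (at_right 0)"
    and bo: "(\<lambda>t. norm (XZ g t - (P0 k l i + exp (2 * \<eta> t / 3) *\<^sub>R (fst s *\<^sub>R v1 k l i + snd s *\<^sub>R v2 k l i))))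
          \<in> O[at_right 0](\<lambda>t. exp ((2 / 3 + \<delta>) * \<eta> t))"
    using hp unfolding has_parameters_def by blast
  define w where "w = real_of_int i * snd s"
  have w: "0 < w" using s i_pos by (auto simp: w_def param_arc_def)
  have XZg: "XZ g t = \<sigma>8 (mXZ q (n t))" if "0 < t" "ereal t < T" for t
  proof -
    have "g = (\<lambda>t. \<sigma> (n t))" using gn by (rule ext)
    then show ?thesis using XZ_eq(2)[OF n_der'[OF that]] by simp
  qed
  have "\<forall>\<^sub>F t in at_right 0. norm (XZ g t - (P0 k l i + exp (2 * \<eta> t / 3) *\<^sub>R (fst s *\<^sub>R v1 k l i + snd s *\<^sub>R v2 k l i))) =
     norm (\<sigma>8 (mXZ q (n t) - (coeff0 + exp (2 * \<eta> t / 3) *\<^sub>R coeff1 q (fst s) w)))"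
    by (rule eventually_mono[OF ev]) (simp add: XZg XZ_error w_def)
  from landau_o.big.in_cong[OF this] bo
  have "(\<lambda>t. norm (\<sigma>8 (mXZ q (n t) - (coeff0 + exp (2 * \<eta> t / 3) *\<^sub>R coeff1 q (fst s) w)))) \<in> O[at_right 0](\<lambda>t. exp ((2 / 3 + \<delta>) * \<eta> t))"
    by blast
  from bigo_norm_linear[OF linear_scale_last8[of p kpl] this]
  have bo': "(\<lambda>t. norm (mXZ q (n t) - (coeff0 + exp (2 * \<eta> t / 3) *\<^sub>R coeff1 q (fst s) w))) \<in> O[at_right 0](\<lambda>t. exp ((2 / 3 + \<delta>) * \<eta> t))"
    using scale_last8_inverse[of p kpl] p_pos by simp
  have "((\<lambda>t. case n t of (x, y, z, F) \<Rightarrow> (1 - F * z / (x * y)) / (x\<^sup>2 / y\<^sup>2)) \<longlongrightarrow>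
    (9 * fst s + (27 - 9 * cq q) / 2 * w) / (9 * w)) (at_right 0)"
    by (rule ratio_from_expansion[OF _ \<eta> \<delta> w bo']) (rule eventually_mono[OF ev], simp add: n_pos)
  then have ratio: "((\<lambda>t. (1 - F t * z t / (x t * y t)) / ((x t)\<^sup>2 / (y t)\<^sup>2)) \<longlongrightarrow> snd (par s) / fst (par s)) (at_right 0)"
    by (simp add: n4 par_def w_def)
  have eqn: "n t = y0 *\<^sub>R mm q (u (par s)) (t / y0)" if t: "0 < t" "ereal t < T" for t
  proof -
    \<comment> \<open>The comparison needs a real end point, whereas T may be infinite.\<close>
    obtain \<tau> where \<tau>: "t < \<tau>" "ereal \<tau> < T" using ereal_dense2[OF t(2)] by auto
    have sub: "ereal r < T" if "r < \<tau>" for r using that \<tau>(2) by (meson ereal_less_eq(3) less_imp_le order_le_less_trans)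
    interpret C: competitor q "fst (par s)" "snd (par s)" "u (par s)" n \<tau> y0
      by unfold_locales (use t \<tau> y0 n_pos n_der' n_lim v_lim' sub in auto)
    have "C.h = (\<lambda>t. F t * z t / (x t * y t))" "C.s = (\<lambda>t. (x t)\<^sup>2 / (y t)\<^sup>2)"
      by (simp_all add: fun_eq_iff C.h_def C.s_def C.x_def C.y_def C.z_def C.F_def x_def y_def z_def F_def)
    then interpret M: matching_competitor q "fst (par s)" "snd (par s)" "u (par s)" n \<tau> y0
      by unfold_locales (use ratio in simp)
    show ?thesis by (rule M.competitor_eq[OF t(1) \<tau>(1)])
  qed
  show ?thesis
    unfolding homothetic_on_def
  proof (intro exI[of _ y0] conjI allI impI)
    show "0 < y0" by (rule y0)
    fix t assume t: "0 < t" "ereal t < T"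
    show "g t = y0 *\<^sub>R G s (t / y0)"
      unfolding gn eqn[OF t] G_def by (rule linear_scale[OF linear_scale_last])
  qed
qed

end

section \<open>Existence of the two families and their chiralities\<close>

context aloff_wallach
begin

theorem family_exists:
  "\<exists>G. continuous_family param_arc G \<and>
    (\<forall>s\<in>param_arc. is_gamma k l i s \<infinity> (G s) \<and> (\<forall>T g. is_gamma k l i s T g \<longrightarrow> homothetic_on T g (G s)) \<and>
      spin7_metric k l eps \<infinity> (G s) \<and> ALC_over_nearly_Kaehler_cone (G s))"
proof -
  have "0 < A" using i_pos by (simp add: A_def)
  then obtain u where u: "continuous_on (({0<..A} \<times> {0<..A}) \<times> {0..}) (\<lambda>(a, T). u a T)"
    "\<And>a. a \<in> {0<..A} \<times> {0<..A} \<Longrightarrow> is_profile q (fst a) (snd a) (u a)"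
    "\<And>a. a \<in> {0<..A} \<times> {0<..A} \<Longrightarrow> \<exists>C. \<forall>T\<in>{0..1}. norm (u a T - (fst a, snd a, 0)) \<le> C * T"
    using profiles_exist[OF q_bounds] by blast
  interpret aloff_wallach_family k l i u
    by unfold_locales (use u in auto)
  show ?thesis
    by (intro exI[of _ G] conjI ballI allI impI G_continuous G_is_gamma uniqueness G_spin7 G_ALC)
qed

end

theorem theorem1p1:
  fixes k l :: int
  assumes "0 \<le> l" and "l \<le> k" and "coprime k l"
    and "generic k l"
  shows "\<exists>\<gamma> :: int \<Rightarrow> real \<times> real \<Rightarrow> coh1_metric.
    (\<forall>i\<in>{k + l, k}.
       continuous_family param_arc (\<gamma> i) \<and>
       (\<forall>s\<in>param_arc. is_gamma k l i s \<infinity> (\<gamma> i s) \<and>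
          (\<forall>T g. is_gamma k l i s T g \<longrightarrow> homothetic_on T g (\<gamma> i s)))) \<and>
    (\<exists>\<epsilon>\<in>{-1, 1}. \<forall>s\<in>param_arc.
       spin7_metric k l \<epsilon> \<infinity> (\<gamma> (k + l) s) \<and> spin7_metric k l (- \<epsilon>) \<infinity> (\<gamma> k s)) \<and>
    (\<forall>i\<in>{k + l, k}. \<forall>s\<in>param_arc. ALC_over_nearly_Kaehler_cone (\<gamma> i s))"
proof -
  \<comment> \<open>Genericity excludes l = 0 and l = k. In particular the two labels k + l and k
    are distinct.\<close>
  have kl: "0 < l" "l < k"
    using assms by (auto simp: generic_def order_less_le)
  interpret A: aloff_wallach k l "k + l" using kl by unfold_locales auto
  interpret B: aloff_wallach k l k using kl by unfold_locales auto
  obtain G1 where G1: "continuous_family param_arc G1"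
    "\<And>s. s \<in> param_arc \<Longrightarrow> is_gamma k l (k + l) s \<infinity> (G1 s) \<and> (\<forall>T g. is_gamma k l (k + l) s T g \<longrightarrow> homothetic_on T g (G1 s)) \<and>
      spin7_metric k l A.eps \<infinity> (G1 s) \<and> ALC_over_nearly_Kaehler_cone (G1 s)"
    using A.family_exists by blast
  obtain G2 where G2: "continuous_family param_arc G2"
    "\<And>s. s \<in> param_arc \<Longrightarrow> is_gamma k l k s \<infinity> (G2 s) \<and> (\<forall>T g. is_gamma k l k s T g \<longrightarrow> homothetic_on T g (G2 s)) \<and>
      spin7_metric k l B.eps \<infinity> (G2 s) \<and> ALC_over_nearly_Kaehler_cone (G2 s)"
    using B.family_exists by blast
  have e: "A.eps = 1" "B.eps = - 1"
    using kl by (simp_all add: A.eps_def B.eps_def A.kpl_def B.kpl_def)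
  define \<gamma> where "\<gamma> i = (if i = k + l then G1 else G2)" for i
  have \<gamma>: "\<gamma> (k + l) = G1" "\<gamma> k = G2" using kl by (simp_all add: \<gamma>_def)
  have 1: "\<forall>i\<in>{k + l, k}. continuous_family param_arc (\<gamma> i) \<and>
       (\<forall>s\<in>param_arc. is_gamma k l i s \<infinity> (\<gamma> i s) \<and>
          (\<forall>T g. is_gamma k l i s T g \<longrightarrow> homothetic_on T g (\<gamma> i s)))"
    using G1 G2 \<gamma> by auto
  have 2: "\<forall>s\<in>param_arc. spin7_metric k l 1 \<infinity> (\<gamma> (k + l) s) \<and> spin7_metric k l (- 1) \<infinity> (\<gamma> k s)"
    using G1(2) G2(2) unfolding \<gamma> e by blast
  have 3: "\<forall>i\<in>{k + l, k}. \<forall>s\<in>param_arc. ALC_over_nearly_Kaehler_cone (\<gamma> i s)"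
    using G1(2) G2(2) \<gamma> by auto
  show ?thesis
    by (rule exI[of _ \<gamma>], intro conjI 1 3, rule bexI[of _ 1], rule 2, simp)
qed

end
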